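(* Let $\gamma>2$, $\mathbf U(x_1,x_2)=(2-\sin(2\pi x_1)-\sin(2\pi x_2))^\gamma$ on $\mathbb T^2$, let $\xi\in\mathbb R^2$ with Diophantine index $\sigma_\xi<2$, $H(x,p)=\frac12|p|^2-\mathbf U(\xi x)$ on $\mathbb R\times\mathbb R$, and $u_0\in\mathrm{BUC}(\mathbb R)\cap\mathrm{Lip}(\mathbb R)$. Let $u^\varepsilon$ be the viscosity solution of the oscillating problem and $u$ that of the effective problem (see context). Then there is $C>0$ independent of $\varepsilon\in(0,1)$ such that $$-C\varepsilon\le u^\varepsilon(0,1)-u(0,1)\le C\varepsilon^{\frac{\gamma-2}{3\gamma-2}}.$$
   Context: $\mathbb T^2=\mathbb R^2/\mathbb Z^2$; functions on $\mathbb T^2$ are identified with $\mathbb Z^2$-periodic functions, $\xi x=(\xi_1x,\xi_2x)$. $\xi\in\mathbb R^2$ has Diophantine index $\sigma=\sigma_\xi>0$ if there is $C_\xi>0$ with $|\xi\cdot\kappa|\ge C_\xi|\kappa|^{-\sigma}$ for all $\kappa\in\mathbb Z^2\setminus\{0\}$. $\mathrm{BUC}(\mathbb R)$: bounded uniformly continuous functions; $\mathrm{Lip}(\mathbb R)$: Lipschitz functions. Oscillating problem: for each $\varepsilon>0$, $u^\varepsilon\in C(\mathbb R\times[0,\infty))$ is the viscosity solution of $u^\varepsilon_t+H(x/\varepsilon,Du^\varepsilon)=0$ in $\mathbb R\times(0,\infty)$, $u^\varepsilon(x,0)=u_0(x)$ on $\mathbb R$. Effective Hamiltonian: for $p\in\mathbb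 R$, $\overline H(p)$ is the unique constant such that for every $\delta>0$ there is a viscosity solution $w_\delta\in\mathrm{BUC}(\mathbb R)\cap\mathrm{Lip}(\mathbb R)$ of $\overline H(p)-\delta\le H(x,p+Dw_\delta(x))\le\overline H(p)+\delta$ in $\mathbb R$. Effective problem: $u$ is the viscosity solution of $u_t+\overline H(Du)=0$ in $\mathbb R\times(0,\infty)$, $u(x,0)=u_0(x)$ on $\mathbb R$. *)

theory Defs
  imports "HOL-Analysis.Analysis"
begin

definition BUC :: "(real \<Rightarrow> real) set" where
  "BUC = {f. bounded (range f) \<and> uniformly_continuous_on UNIV f}"

definition Lip :: "(real \<Rightarrow> real) set" where
  "Lip = {f. \<exists>L. L-lipschitz_on UNIV f}"

definition diophantine_index :: "real ^ 2 \<Rightarrow> real \<Rightarrow> bool" where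
  "diophantine_index \<xi> \<sigma> \<longleftrightarrow>
     \<sigma> > 0 \<and>
     (\<exists>C>0. \<forall>\<kappa> :: real ^ 2. (\<forall>i. \<kappa> $ i \<in> \<int>) \<and> \<kappa> \<noteq> 0 \<longrightarrow>
        \<bar>\<xi> \<bullet> \<kappa>\<bar> \<ge> C * norm \<kappa> powr (- \<sigma>))"

text \<open>
  Viscosity sub- and supersolutions of \<open>F(y, Du(y)) = 0\<close> in an open set \<open>\<Omega>\<close>, in the sense of
  Crandall and Lions: candidates are continuous, and test functions \<open>\<phi>\<close> are of class \<open>C\<^sup>1\<close> in \<open>\<Omega>\<close>
  with gradient \<open>D\<phi>\<close>.  For evolution equations \<open>y = (x, t)\<close> and the gradient is the
  pair of the \<open>x\<close>-derivative and the \<open>t\<close>-derivative.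
\<close>

definition C1_on :: "'a::euclidean_space set \<Rightarrow> ('a \<Rightarrow> real) \<Rightarrow> ('a \<Rightarrow> 'a) \<Rightarrow> bool" where
  "C1_on \<Omega> \<phi> D\<phi> \<longleftrightarrow> (\<forall>y\<in>\<Omega>. GDERIV \<phi> y :> D\<phi> y) \<and> continuous_on \<Omega> D\<phi>"

definition viscosity_subsolution ::
  "'a::euclidean_space set \<Rightarrow> ('a \<Rightarrow> 'a \<Rightarrow> real) \<Rightarrow> ('a \<Rightarrow> real) \<Rightarrow> bool" where
  "viscosity_subsolution \<Omega> F u \<longleftrightarrow>
     continuous_on \<Omega> u \<and>
     (\<forall>\<phi> D\<phi>. C1_on \<Omega> \<phi> D\<phi> \<longrightarrow>
       (\<forall>y\<in>\<Omega>. (\<forall>\<^sub>F z in nhds y. u z - \<phi> z \<le> u y - \<phi> y) \<longrightarrow> F y (D\<phi> y) \<le> 0))"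

definition viscosity_supersolution ::
  "'a::euclidean_space set \<Rightarrow> ('a \<Rightarrow> 'a \<Rightarrow> real) \<Rightarrow> ('a \<Rightarrow> real) \<Rightarrow> bool" where
  "viscosity_supersolution \<Omega> F u \<longleftrightarrow>
     continuous_on \<Omega> u \<and>
     (\<forall>\<phi> D\<phi>. C1_on \<Omega> \<phi> D\<phi> \<longrightarrow>
       (\<forall>y\<in>\<Omega>. (\<forall>\<^sub>F z in nhds y. u z - \<phi> z \<ge> u y - \<phi> y) \<longrightarrow> F y (D\<phi> y) \<ge> 0))"

definition viscosity_solution ::
  "'a::euclidean_space set \<Rightarrow> ('a \<Rightarrow> 'a \<Rightarrow> real) \<Rightarrow> ('a \<Rightarrow> real) \<Rightarrow> bool" where
  "viscosity_solution \<Omega> F u \<longleftrightarrow> viscosity_subsolution \<Omega> F u \<and> viscosity_supersolution \<Omega> F u"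

text \<open>
  \<open>u\<^sub>t + H(x, Du) = 0\<close> in \<open>\<real> \<times> (0,\<infinity>)\<close>, \<open>u(x,0) = u\<^sub>0(x)\<close> on \<open>\<real>\<close>, with \<open>u \<in> C(\<real> \<times> [0,\<infinity>))\<close>.
\<close>

definition cauchy_viscosity_solution ::
  "(real \<Rightarrow> real \<Rightarrow> real) \<Rightarrow> (real \<Rightarrow> real) \<Rightarrow> (real \<times> real \<Rightarrow> real) \<Rightarrow> bool" where
  "cauchy_viscosity_solution H u\<^sub>0 u \<longleftrightarrow>
     continuous_on (UNIV \<times> {0..}) u \<and>
     viscosity_solution (UNIV \<times> {0<..}) (\<lambda>(x, t) (u\<^sub>x, u\<^sub>t). u\<^sub>t + H x u\<^sub>x) u \<and>
     (\<forall>x. u (x, 0) = u\<^sub>0 x)"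

definition effective_hamiltonian :: "(real \<Rightarrow> real \<Rightarrow> real) \<Rightarrow> real \<Rightarrow> real" where
  "effective_hamiltonian H p =
     (THE c. \<forall>\<delta>>0. \<exists>w \<in> BUC \<inter> Lip.
        viscosity_supersolution UNIV (\<lambda>x q. H x (p + q) - (c - \<delta>)) w \<and>
        viscosity_subsolution UNIV (\<lambda>x q. H x (p + q) - (c + \<delta>)) w)"

text \<open>A function on \<open>\<real>\<^sup>2/\<int>\<^sup>2\<close>, given as a \<open>\<int>\<^sup>2\<close>-periodic function on \<open>\<real>\<^sup>2\<close>.\<close>

definition potential :: "real \<Rightarrow> real ^ 2 \<Rightarrow> real" where
  "potential \<gamma> x = (2 - sin (2 * pi * x $ 1) - sin (2 * pi * x $ 2)) powr \<gamma>"

definition hamiltonian :: "real \<Rightarrow> real ^ 2 \<Rightarrow> real \<Rightarrow> real \<Rightarrow> real" where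
  "hamiltonian \<gamma> \<xi> x p = 1 / 2 * \<bar>p\<bar>\<^sup>2 - potential \<gamma> (x *\<^sub>R \<xi>)"

end

theory Submission
  imports Defs
begin

text \<open>
  Write \<open>V(t) = U(t\<xi>)\<close> and let \<open>S\<^sub>E\<close> be an antiderivative of the momentum \<open>(2(E + V))\<^sup>1\<^sup>/\<^sup>2\<close> at energy
  \<open>E \<ge> 0\<close>. With \<open>2 cos \<theta> = sin(2\<pi>x\<^sub>1) + sin(2\<pi>x\<^sub>2)\<close> the momentum is a function of \<open>\<theta>\<close> whose cosine
  coefficients are \<open>O(k\<^sup>-\<^sup>3)\<close> uniformly in \<open>E\<close>; this is where \<open>\<gamma> > 2\<close> enters. Each \<open>cos(k\<theta>)\<close> is a
  trigonometric polynomial of degree \<open>k\<close> bounded by \<open>1\<close>, so Bessel's inequality and the separation of the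
  small divisors bound its primitive along the flow by \<open>O(k\<^sup>\<sigma>)\<close>. As \<open>\<sigma> < 2\<close>, summation gives
  \<open>S\<^sub>E(b) - S\<^sub>E(a) = s(E)(b - a) + O(1)\<close> uniformly in \<open>E\<close>, and the effective Hamiltonian is the inverse of
  \<open>E \<mapsto> s(E)\<close>, extended by \<open>0\<close> to \<open>\<bar>p\<bar> \<le> s(0)\<close>.

  Solutions of either problem are bounded from below by comparison with cones
  \<open>m - max\<^sub>E (\<bar>S\<^sub>E(y)\<bar> - E(1 - t))\<close>, with \<open>s(E)y\<close> in place of \<open>S\<^sub>E(y)\<close> for the effective problem,
  and from above by testing along trajectories. The two sets of bounds differ by \<open>O(\<epsilon>)\<close>, except when
  the trajectories of every positive energy reach the origin too early; they then wait near a zero of \<open>V\<close>, and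
  a crude recurrence estimate for the flow makes this cost \<open>O(\<epsilon>\<^sup>1\<^sup>/\<^sup>3)\<close>, which is better than required.
\<close>

subsection \<open>Trigonometric polynomials along a linear flow\<close>

text \<open>The two solutions are never compared with each other. Both are tied, at the single point
  (0,1), to the quantities u0(y) + s(E)|y| - E: testing along trajectories yields for every y an
  energy E for which such a quantity bounds one solution from above, up to an error, and this is the
  hypothesis under which a cone lies below the other solution.

  Two obstacles shape the estimates. Bounding the primitive of a trigonometric polynomial one
  character at a time would lose further powers of the degree; the l2 argument loses only the
  inverse of the smallest gap between frequencies, and k^(\<sigma>-3) is summable exactly when
  \<sigma> < 2. At energy 0 the momentum vanishes together with V, so neither smoothness of the
  square root nor finiteness of travel times is guaranteed there: the coefficient bounds have to be
  uniform as E tends to 0, and trajectories are used for E > 0 only.\<close>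

inductive trig_poly :: "nat \<Rightarrow> (real \<Rightarrow> real \<Rightarrow> complex) \<Rightarrow> bool" for k where
  char: "\<bar>i\<bar> \<le> int k \<Longrightarrow> \<bar>j\<bar> \<le> int k \<Longrightarrow>
    trig_poly k (\<lambda>x y. cis (of_int i * x + of_int j * y))"
| add: "trig_poly k f \<Longrightarrow> trig_poly k g \<Longrightarrow> trig_poly k (\<lambda>x y. f x y + g x y)"
| scale: "trig_poly k f \<Longrightarrow> trig_poly k (\<lambda>x y. c * f x y)"

abbreviation box2 :: "nat \<Rightarrow> (int \<times> int) set" where
  "box2 k \<equiv> {- int k..int k} \<times> {- int k..int k}"

text \<open>The inductive form is suited to building polynomials, the coefficient form to l2
  estimates. Summing over the full box, with zero coefficients for absent characters, lets sums and
  multiples act coefficientwise.\<close>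

lemma trig_poly_coeffs:
  assumes "trig_poly k f"
  obtains q where "\<And>x y. f x y = (\<Sum>p\<in>box2 k. q p * cis (of_int (fst p) * x + of_int (snd p) * y))"
proof -
  have "\<exists>q. \<forall>x y. f x y = (\<Sum>p\<in>box2 k. q p * cis (of_int (fst p) * x + of_int (snd p) * y))"
    using assms
  proof induction
    case (char i j)
    have "(\<Sum>p\<in>box2 k. (if p = (i, j) then 1 else 0) * cis (of_int (fst p) * x + of_int (snd p) * y))
       = cis (of_int i * x + of_int j * y)" for x y
    proof -
      have "(\<Sum>p\<in>box2 k. (if p = (i, j) then 1 else 0) * cis (of_int (fst p) * x + of_int (snd p) * y))
        = (\<Sum>p\<in>box2 k. if p = (i, j) then cis (of_int i * x + of_int j * y) else 0)"
        by (rule sum.cong) auto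
      also have "\<dots> = cis (of_int i * x + of_int j * y)"
        using char by (subst sum.delta) auto
      finally show ?thesis .
    qed
    then show ?case
      by (intro exI[of _ "\<lambda>p. if p = (i, j) then 1 else 0"] allI) (simp only:)
  next
    case (add f g)
    from add.IH(1) obtain q where
      "\<forall>x y. f x y = (\<Sum>p\<in>box2 k. q p * cis (of_int (fst p) * x + of_int (snd p) * y))" ..
    moreover from add.IH(2) obtain r where
      "\<forall>x y. g x y = (\<Sum>p\<in>box2 k. r p * cis (of_int (fst p) * x + of_int (snd p) * y))" ..
    ultimately show ?case
      by (intro exI[of _ "\<lambda>p. q p + r p"]) (simp add: sum.distrib distrib_right)
  next
    case (scale f c)
    from scale.IH obtain q where
      "\<forall>x y. f x y = (\<Sum>p\<in>box2 k. q p * cis (of_int (fst p) * x + of_int (snd p) * y))" ..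
    then show ?case
      by (intro exI[of _ "\<lambda>p. c * q p"]) (simp add: sum_distrib_left mult.assoc)
  qed
  then show ?thesis using that by blast
qed

lemma trig_poly_mono: "trig_poly k f \<Longrightarrow> k \<le> l \<Longrightarrow> trig_poly l f"
proof (induction rule: trig_poly.induct)
  case (char i j)
  then show ?case by (intro trig_poly.char) linarith+
qed (auto intro: trig_poly.intros)

lemma trig_poly_mult_char:
  assumes "trig_poly k f" "\<bar>i\<bar> \<le> 1" "\<bar>j\<bar> \<le> 1"
  shows "trig_poly (Suc k) (\<lambda>x y. cis (of_int i * x + of_int j * y) * f x y)"
  using assms(1)
proof induction
  case (char a b)
  have "trig_poly (Suc k) (\<lambda>x y. cis (of_int (i + a) * x + of_int (j + b) * y))"
    using assms char by (intro trig_poly.char) linarith+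
  also have "(\<lambda>x y. cis (of_int (i + a) * x + of_int (j + b) * y)) =
     (\<lambda>x y. cis (of_int i * x + of_int j * y) * cis (of_int a * x + of_int b * y))"
    by (auto simp: cis_mult algebra_simps)
  finally show ?case .
next
  case (add f g)
  then show ?case using trig_poly.add[OF add.IH] by (simp add: distrib_left)
next
  case (scale f c)
  then show ?case using trig_poly.scale[OF scale.IH, of c] by (simp add: mult.left_commute)
qed

text \<open>\<open>cos x + cos y\<close> is half the sum of four characters, each moving frequencies
  by one unit in one coordinate.\<close>

lemma trig_poly_mult_cos_sum:
  assumes "trig_poly k f"
  shows "trig_poly (Suc k) (\<lambda>x y. of_real (cos x + cos y) * f x y)"
proof -
  have c: "complex_of_real (cos x) = cis x / 2 + cis (- x) / 2" for x
    by (simp add: complex_eq_iff)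
  have "trig_poly (Suc k) (\<lambda>x y. (1/2) * (cis (of_int 1 * x + of_int 0 * y) * f x y)
      + (1/2) * (cis (of_int (-1) * x + of_int 0 * y) * f x y)
      + (1/2) * (cis (of_int 0 * x + of_int 1 * y) * f x y)
      + (1/2) * (cis (of_int 0 * x + of_int (-1) * y) * f x y))"
    by (intro trig_poly.add trig_poly.scale trig_poly_mult_char[OF assms]) auto
  also have "(\<lambda>x y. (1/2) * (cis (of_int 1 * x + of_int 0 * y) * f x y)
      + (1/2) * (cis (of_int (-1) * x + of_int 0 * y) * f x y)
      + (1/2) * (cis (of_int 0 * x + of_int 1 * y) * f x y)
      + (1/2) * (cis (of_int 0 * x + of_int (-1) * y) * f x y)) =
      (\<lambda>x y. of_real (cos x + cos y) * f x y)"
    by (auto simp: c field_simps fun_eq_iff)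
  finally show ?thesis .
qed

lemma trig_poly_one: "trig_poly k (\<lambda>x y. 1)"
  using trig_poly.char[of 0 k 0] by simp

text \<open>The Chebyshev polynomial of the first kind on [-1,1]; this form is the one met when a
  cosine series is evaluated at \<open>arccos c\<close>.\<close>

definition cheb :: "nat \<Rightarrow> real \<Rightarrow> real" where
  "cheb k c = cos (real k * arccos c)"

lemma cheb_Suc_Suc:
  assumes "\<bar>c\<bar> \<le> 1"
  shows "cheb (Suc (Suc k)) c = 2 * c * cheb (Suc k) c - cheb k c"
proof -
  have c: "cos (arccos c) = c" using assms by (simp add: abs_le_iff)
  define a where "a = arccos c"
  have "cos ((real k + 1) * a + a) + cos ((real k + 1) * a - a) = 2 * cos ((real k + 1) * a) * cos a"
    by (simp add: cos_add cos_diff)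
  moreover have "(real k + 1) * a + a = real (Suc (Suc k)) * a" "(real k + 1) * a - a = real k * a"
    by (auto simp: algebra_simps)
  ultimately show ?thesis unfolding cheb_def using c a_def by (simp add: algebra_simps)
qed

lemma abs_half_cos_sum: "\<bar>(cos x + cos y) / 2\<bar> \<le> (1::real)"
  unfolding abs_le_iff
  using cos_ge_minus_one[of x] cos_ge_minus_one[of y] cos_le_one[of x] cos_le_one[of y]
  by (auto simp del: cos_ge_minus_one cos_le_one)

text \<open>In the three-term recurrence the factor \<open>2 * c\<close> is
  \<open>cos x + cos y\<close>, so each step costs one degree. The induction carries two consecutive
  indices for the recurrence to apply.\<close>

lemma trig_poly_cheb: "trig_poly k (\<lambda>x y. of_real (cheb k ((cos x + cos y) / 2)))"
proof -
  have "trig_poly k (\<lambda>x y. of_real (cheb k ((cos x + cos y) / 2))) \<and>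
     trig_poly (Suc k) (\<lambda>x y. of_real (cheb (Suc k) ((cos x + cos y) / 2)))"
  proof (induction k)
    case 0
    have 1: "(\<lambda>x y. complex_of_real (cheb 0 ((cos x + cos y) / 2))) = (\<lambda>x y. 1)"
      by (simp add: cheb_def)
    have 2: "(\<lambda>x y. complex_of_real (cheb (Suc 0) ((cos x + cos y) / 2)))
        = (\<lambda>x y. (1/2) * (of_real (cos x + cos y) * 1))"
    proof (intro ext)
      fix x y :: real
      have "cos (arccos ((cos x + cos y) / 2)) = (cos x + cos y) / 2"
        using abs_half_cos_sum[of x y] by (intro cos_arccos) (auto simp: abs_le_iff)
      from arg_cong[OF this, of complex_of_real]
      show "complex_of_real (cheb (Suc 0) ((cos x + cos y) / 2)) = (1/2) * (of_real (cos x + cos y) * 1)"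
        by (simp add: cheb_def)
    qed
    show ?case unfolding 1 2
      by (intro conjI trig_poly_one trig_poly.scale trig_poly_mult_cos_sum)
  next
    case (Suc k)
    have "(\<lambda>x y. complex_of_real (cheb (Suc (Suc k)) ((cos x + cos y) / 2))) =
      (\<lambda>x y. of_real (cos x + cos y) * of_real (cheb (Suc k) ((cos x + cos y) / 2))
         + (-1) * of_real (cheb k ((cos x + cos y) / 2)))"
      by (intro ext, subst cheb_Suc_Suc[OF abs_half_cos_sum]) simp
    moreover have "trig_poly (Suc (Suc k)) (\<lambda>x y. of_real (cos x + cos y) * of_real (cheb (Suc k) ((cos x + cos y) / 2))
         + (-1) * of_real (cheb k ((cos x + cos y) / 2)))"
      using Suc by (intro trig_poly.add trig_poly.scale trig_poly_mult_cos_sum)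
         (auto intro: trig_poly_mono)
    ultimately show ?case using Suc by metis
  qed
  then show ?thesis by blast
qed

text \<open>The base has values in [0,1] and equals 1 only where both cosines are 1; after a shift
  of phase these points are the zeros of the potential, and high powers detect returns to them in
  \<open>potential_recurrence\<close>.\<close>

lemma trig_poly_peak: "trig_poly n (\<lambda>x y. of_real (((2 + (cos x + cos y)) / 4) ^ n))"
proof (induction n)
  case 0
  then show ?case using trig_poly_one by simp
next
  case (Suc n)
  have "trig_poly (Suc n) (\<lambda>x y. (1/2) * of_real (((2 + (cos x + cos y)) / 4) ^ n)
     + (1/4) * (of_real (cos x + cos y) * of_real (((2 + (cos x + cos y)) / 4) ^ n)))"
    using Suc by (intro trig_poly.add trig_poly.scale trig_poly_mult_cos_sum)
         (auto intro: trig_poly_mono)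
  also have "(\<lambda>x y. (1/2) * complex_of_real (((2 + (cos x + cos y)) / 4) ^ n)
     + (1/4) * (of_real (cos x + cos y) * of_real (((2 + (cos x + cos y)) / 4) ^ n)))
     = (\<lambda>x y. of_real (((2 + (cos x + cos y)) / 4) ^ Suc n))"
    by (simp add: fun_eq_iff field_simps)
  finally show ?case .
qed

section \<open>Primitives and mean squares of exponential sums\<close>

lemma has_derivative_cis_linear:
  "((\<lambda>t. cis (w * t)) has_vector_derivative (\<i> * of_real w * cis (w * t))) (at t)"
  unfolding has_vector_derivative_def
  by (rule has_derivative_eq_rhs, rule has_derivative_cis)
     (auto intro!: derivative_eq_intros simp: fun_eq_iff scaleR_conv_of_real algebra_simps)

lemma has_derivative_cis_antideriv:
  assumes "w \<noteq> 0"
  shows "((\<lambda>t. Re (c * cis (w * t) / (\<i> * of_real w))) has_real_derivative Re (c * cis (w * t))) (at t)"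
proof -
  have "((\<lambda>t. c / (\<i> * of_real w) * cis (w * t)) has_vector_derivative
     c / (\<i> * of_real w) * (\<i> * of_real w * cis (w * t))) (at t)"
    by (intro has_vector_derivative_mult_right has_derivative_cis_linear)
  then have "((\<lambda>t. Re (c / (\<i> * of_real w) * cis (w * t))) has_vector_derivative
     Re (c / (\<i> * of_real w) * (\<i> * of_real w * cis (w * t)))) (at t)"
    by (rule bounded_linear.has_vector_derivative[OF bounded_linear_Re])
  then show ?thesis using assms
    by (simp add: has_real_derivative_iff_has_vector_derivative)
qed

lemma norm_cis_antideriv: "\<bar>Re (c * cis s / (\<i> * of_real w))\<bar> \<le> norm c / \<bar>w\<bar>"
  using abs_Re_le_cmod[of "c * cis s / (\<i> * of_real w)"] by (simp add: norm_mult norm_divide)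

text \<open>Expanding the square, every off-diagonal product is an exponential of nonzero frequency
  \<open>w p - w p'\<close>, by injectivity, and has a bounded primitive; the diagonal gives the
  slope. The bound \<open>M\<close> depends on the frequencies, but only the slope matters
  later.\<close>

lemma trig_sum_mean_square:
  fixes w :: "'a \<Rightarrow> real" and c :: "'a \<Rightarrow> complex"
  assumes "finite B" "inj_on w B"
  obtains F M where
    "\<And>t. (F has_real_derivative (norm (\<Sum>p\<in>B. c p * cis (w p * t)))\<^sup>2) (at t)"
    "\<And>t. \<bar>F t - t * (\<Sum>p\<in>B. (norm (c p))\<^sup>2)\<bar> \<le> M"
proof -
  define G where "G p p' t = (if p = p' then 0
      else Re (c p * cnj (c p') * cis ((w p - w p') * t) / (\<i> * of_real (w p - w p'))))" for p p' t
  define F where "F t = t * (\<Sum>p\<in>B. (norm (c p))\<^sup>2) + (\<Sum>p\<in>B. \<Sum>p'\<in>B. G p p' t)" for t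
  define M where "M = (\<Sum>p\<in>B. \<Sum>p'\<in>B. norm (c p * cnj (c p')) / \<bar>w p - w p'\<bar>)"
  have d: "(G p p' has_real_derivative
      (if p = p' then 0 else Re (c p * cnj (c p') * cis ((w p - w p') * t)))) (at t)"
    if "p \<in> B" "p' \<in> B" for p p' t
  proof (cases "p = p'")
    case True
    then have "G p p' = (\<lambda>_. 0)" by (auto simp: G_def)
    then show ?thesis using True by simp
  next
    case False
    then have "w p - w p' \<noteq> 0" using assms(2) that by (auto dest: inj_onD)
    from has_derivative_cis_antideriv[OF this, of "c p * cnj (c p')"] show ?thesis
      using False by (simp only: G_def[abs_def] if_False simp_thms)
  qed
  have e: "(norm (\<Sum>p\<in>B. c p * cis (w p * t)))\<^sup>2 =
     (\<Sum>p\<in>B. (norm (c p))\<^sup>2) +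
     (\<Sum>p\<in>B. \<Sum>p'\<in>B. if p = p' then 0 else Re (c p * cnj (c p') * cis ((w p - w p') * t)))" for t
  proof -
    have "complex_of_real ((norm (\<Sum>p\<in>B. c p * cis (w p * t)))\<^sup>2) =
      (\<Sum>p\<in>B. c p * cis (w p * t)) * cnj (\<Sum>p\<in>B. c p * cis (w p * t))"
      by (rule complex_norm_square)
    also have "\<dots> = (\<Sum>p\<in>B. \<Sum>p'\<in>B. c p * cnj (c p') * cis ((w p - w p') * t))"
    proof -
      have *: "c p * cis (w p * t) * cnj (c p' * cis (w p' * t)) = c p * cnj (c p') * cis ((w p - w p') * t)"
        for p p'
      proof -
        have "cis (w p * t) * cis (- (w p' * t)) = cis ((w p - w p') * t)"
          by (simp add: cis_mult left_diff_distrib)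
        then show ?thesis by (simp only: complex_cnj_mult cis_cnj mult_ac)
      qed
      show ?thesis unfolding cnj_sum sum_product * ..
    qed
    finally have "Re (complex_of_real ((norm (\<Sum>p\<in>B. c p * cis (w p * t)))\<^sup>2)) =
      (\<Sum>p\<in>B. \<Sum>p'\<in>B. Re (c p * cnj (c p') * cis ((w p - w p') * t)))"
      by (simp only: Re_sum)
    then have "(norm (\<Sum>p\<in>B. c p * cis (w p * t)))\<^sup>2 =
      (\<Sum>p\<in>B. \<Sum>p'\<in>B. Re (c p * cnj (c p') * cis ((w p - w p') * t)))"
      by simp
    also have "\<dots> = (\<Sum>p\<in>B. \<Sum>p'\<in>B. (if p = p' then (norm (c p))\<^sup>2 else 0) +
       (if p = p' then 0 else Re (c p * cnj (c p') * cis ((w p - w p') * t))))"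
      by (intro sum.cong refl) (auto simp: cmod_power2; simp add: power2_eq_square)
    also have "\<dots> = (\<Sum>p\<in>B. (norm (c p))\<^sup>2) +
     (\<Sum>p\<in>B. \<Sum>p'\<in>B. if p = p' then 0 else Re (c p * cnj (c p') * cis ((w p - w p') * t)))"
      using assms(1) by (simp add: sum.distrib)
    finally show ?thesis .
  qed
  have 1: "(F has_real_derivative (norm (\<Sum>p\<in>B. c p * cis (w p * t)))\<^sup>2) (at t)" for t
    unfolding F_def[abs_def] e
    by (auto intro!: derivative_eq_intros d)
  have 2: "\<bar>F t - t * (\<Sum>p\<in>B. (norm (c p))\<^sup>2)\<bar> \<le> M" for t
  proof -
    have "\<bar>F t - t * (\<Sum>p\<in>B. (norm (c p))\<^sup>2)\<bar> = \<bar>\<Sum>p\<in>B. \<Sum>p'\<in>B. G p p' t\<bar>" by (simp add: F_def)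
    also have "\<dots> \<le> (\<Sum>p\<in>B. \<Sum>p'\<in>B. \<bar>G p p' t\<bar>)"
      by (rule order_trans[OF sum_abs]) (intro sum_mono sum_abs)
    also have "\<dots> \<le> M" unfolding M_def
    proof (intro sum_mono)
      fix p p'
      show "\<bar>G p p' t\<bar> \<le> norm (c p * cnj (c p')) / \<bar>w p - w p'\<bar>"
        using norm_cis_antideriv[of "c p * cnj (c p')" "(w p - w p') * t" "w p - w p'"]
        by (cases "p = p'") (simp_all only: G_def if_False if_True abs_zero, simp)
    qed
    finally show ?thesis .
  qed
  show ?thesis using that[OF 1 2] .
qed

text \<open>A comparison of growth rates as t tends to infinity; it replaces limits of averages when
  mean values are estimated.\<close>

lemma bounded_diff_imp_le:
  fixes \<alpha> \<beta> M :: real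
  assumes "\<And>t. t > 0 \<Longrightarrow> t * \<alpha> \<le> t * \<beta> + M"
  shows "\<alpha> \<le> \<beta>"
proof (rule ccontr)
  assume "\<not> \<alpha> \<le> \<beta>"
  then have p: "\<alpha> - \<beta> > 0" by simp
  \<comment> \<open>At this time the gap \<open>t * (\<alpha> - \<beta>)\<close> is
    \<open>\<bar>M\<bar> + 1\<close>, more than the permitted error.\<close>
  define t where "t = (\<bar>M\<bar> + 1) / (\<alpha> - \<beta>)"
  have "t > 0" using p by (simp add: t_def divide_pos_pos)
  have "t * (\<alpha> - \<beta>) = \<bar>M\<bar> + 1" using p by (simp add: t_def)
  with assms[OF \<open>t > 0\<close>] show False by (simp add: algebra_simps)
qed

text \<open>The primitive of the squared modulus grows with slope equal to the sum of squares, while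
  its derivative is at most 1.\<close>

lemma trig_sum_bessel:
  fixes w :: "'a \<Rightarrow> real" and c :: "'a \<Rightarrow> complex"
  assumes "finite B" "inj_on w B" "\<And>t. norm (\<Sum>p\<in>B. c p * cis (w p * t)) \<le> 1"
  shows "(\<Sum>p\<in>B. (norm (c p))\<^sup>2) \<le> 1"
proof -
  obtain F M where F: "\<And>t. (F has_real_derivative (norm (\<Sum>p\<in>B. c p * cis (w p * t)))\<^sup>2) (at t)"
    and M: "\<And>t. \<bar>F t - t * (\<Sum>p\<in>B. (norm (c p))\<^sup>2)\<bar> \<le> M"
    using trig_sum_mean_square[OF assms(1,2)] by blast
  show ?thesis
  proof (rule bounded_diff_imp_le)
    fix t :: real assume "t > 0"
    from MVT2[OF this F] obtain z where
      "F t - F 0 = (t - 0) * (norm (\<Sum>p\<in>B. c p * cis (w p * z)))\<^sup>2" by blast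
    moreover have "(norm (\<Sum>p\<in>B. c p * cis (w p * z)))\<^sup>2 \<le> 1"
      using assms(3)[of z] by (simp add: power_le_one)
    ultimately have "F t - F 0 \<le> t" using \<open>t > 0\<close> by (simp add: mult_left_le)
    then show "t * (\<Sum>p\<in>B. (norm (c p))\<^sup>2) \<le> t * 1 + (M + M)"
      using M[of t] M[of 0] by (simp add: abs_le_iff)
  qed
qed

lemma sum_inverse_squares_le: "(\<Sum>n=1..N. 1 / (real n)\<^sup>2) \<le> 2"
proof -
  \<comment> \<open>Strengthened by 1/N so that the induction telescopes.\<close>
  have "(\<Sum>n=1..N. 1 / (real n)\<^sup>2) \<le> 2 - 1 / real N" if "N > 0" for N
    using that
  proof (induction N)
    case (Suc N)
    show ?case
    proof (cases "N = 0")
      case False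
      have "1 / (real (Suc N))\<^sup>2 \<le> 1 / real N - 1 / real (Suc N)"
        using False by (simp add: divide_simps power2_eq_square)
      then show ?thesis using Suc False by simp
    qed simp
  qed simp
  from this[of N] show ?thesis by (cases "N = 0") (auto intro: order_trans)
qed

text \<open>Sort the numbers by sign and by the integer part of
  \<open>\<bar>w p\<bar> / \<delta>\<close>. Two members of one cell would be closer than
  \<open>\<delta>\<close>, so cells hold at most one; the n-th cell of either sign contributes at
  most \<open>1 / (n * \<delta>)\<^sup>2\<close>, and 4 is twice the bound 2 for the sum of inverse
  squares.\<close>

lemma sum_inverse_squares_separated:
  fixes w :: "'a \<Rightarrow> real"
  assumes fin: "finite B" and d: "\<delta> > 0"
    and lo: "\<And>p. p \<in> B \<Longrightarrow> \<bar>w p\<bar> \<ge> \<delta>"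
    and sep: "\<And>p p'. p \<in> B \<Longrightarrow> p' \<in> B \<Longrightarrow> p \<noteq> p' \<Longrightarrow> \<bar>w p - w p'\<bar> \<ge> \<delta>"
  shows "(\<Sum>p\<in>B. 1 / (w p)\<^sup>2) \<le> 4 / \<delta>\<^sup>2"
proof -
  define m where "m p = nat \<lfloor>\<bar>w p\<bar> / \<delta>\<rfloor>" for p
  define g where "g p = (m p, w p > 0)" for p
  have m1: "m p \<ge> 1" if "p \<in> B" for p
  proof -
    have "1 \<le> \<bar>w p\<bar> / \<delta>" using lo[OF that] d by simp
    then have "1 \<le> \<lfloor>\<bar>w p\<bar> / \<delta>\<rfloor>" by simp
    then show ?thesis unfolding m_def by linarith
  qed
  have mb: "real (m p) \<le> \<bar>w p\<bar> / \<delta>" "\<bar>w p\<bar> / \<delta> < real (m p) + 1" for p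
  proof -
    have "0 \<le> \<bar>w p\<bar> / \<delta>" using d by simp
    then show "real (m p) \<le> \<bar>w p\<bar> / \<delta>" "\<bar>w p\<bar> / \<delta> < real (m p) + 1"
      unfolding m_def by linarith+
  qed
  have inj: "inj_on g B"
  proof (rule inj_onI, rule ccontr)
    fix p p' assume *: "p \<in> B" "p' \<in> B" "g p = g p'" "p \<noteq> p'"
    then have "m p = m p'" "(w p > 0) = (w p' > 0)" by (auto simp: g_def)
    then have "\<bar>\<bar>w p\<bar> / \<delta> - \<bar>w p'\<bar> / \<delta>\<bar> < 1" using mb[of p] mb[of p'] by linarith
    then have "\<bar>\<bar>w p\<bar> - \<bar>w p'\<bar>\<bar> < \<delta>" using d
      by (simp add: diff_divide_distrib[symmetric])
    then have "\<bar>w p - w p'\<bar> < \<delta>" using \<open>(w p > 0) = (w p' > 0)\<close> by linarith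
    then show False using sep[of p p'] * by linarith
  qed
  obtain N where N: "\<And>p. p \<in> B \<Longrightarrow> m p \<le> N"
    using fin by (metis Max_ge finite_imageI imageI)
  have "(\<Sum>p\<in>B. 1 / (w p)\<^sup>2) \<le> (\<Sum>p\<in>B. (1 / \<delta>\<^sup>2) * (1 / (real (fst (g p)))\<^sup>2))"
  proof (rule sum_mono)
    fix p assume p: "p \<in> B"
    have "real (m p) * \<delta> \<le> \<bar>w p\<bar>" using mb(1)[of p] d by (simp add: field_simps)
    then have "(real (m p) * \<delta>)\<^sup>2 \<le> (w p)\<^sup>2"      using d power_mono[of "real (m p) * \<delta>" "\<bar>w p\<bar>" 2] by simp
    moreover have "0 < (real (m p) * \<delta>)\<^sup>2" using m1[OF p] d by simp
    ultimately have "1 / (w p)\<^sup>2 \<le> 1 / (real (m p) * \<delta>)\<^sup>2" by (rule frac_le[OF zero_le_one order_refl, rotated])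
    then show "1 / (w p)\<^sup>2 \<le> (1 / \<delta>\<^sup>2) * (1 / (real (fst (g p)))\<^sup>2)"
      by (simp add: g_def power_mult_distrib mult.commute)
  qed
  also have "\<dots> = (1 / \<delta>\<^sup>2) * (\<Sum>p\<in>B. 1 / (real (fst (g p)))\<^sup>2)"
    by (rule sum_distrib_left[symmetric])
  also have "(\<Sum>p\<in>B. 1 / (real (fst (g p)))\<^sup>2) = (\<Sum>z\<in>g ` B. 1 / (real (fst z))\<^sup>2)"
    by (simp add: sum.reindex[OF inj])
  also have "\<dots> \<le> (\<Sum>z\<in>{1..N} \<times> (UNIV :: bool set). 1 / (real (fst z))\<^sup>2)"
    by (rule sum_mono2) (use m1 N in \<open>auto simp: g_def\<close>)
  also have "\<dots> = (\<Sum>n=1..N. 2 * (1 / (real n)\<^sup>2))"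
  proof -
    have "(\<Sum>n=1..N. 2 * (1 / (real n)\<^sup>2)) = (\<Sum>n=1..N. \<Sum>b\<in>(UNIV :: bool set). 1 / (real n)\<^sup>2)"
      by (simp add: UNIV_bool)
    also have "\<dots> = (\<Sum>z\<in>{1..N} \<times> (UNIV :: bool set). 1 / (real (fst z))\<^sup>2)"
      by (simp only: sum.cartesian_product case_prod_unfold)
    finally show ?thesis ..
  qed
  also have "\<dots> = 2 * (\<Sum>n=1..N. 1 / (real n)\<^sup>2)" by (rule sum_distrib_left[symmetric])
  also have "\<dots> \<le> 4" using sum_inverse_squares_le[of N] by simp
  finally show ?thesis using d by (simp add: divide_right_mono)
qed

section \<open>Small divisors: separation of frequencies and bounded discrepancy\<close>

locale diophantine_pair =
  fixes w1 w2 c \<sigma> \<beta> :: real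
  assumes c_pos: "c > 0" and \<sigma>_pos: "\<sigma> > 0"
    and dioph: "\<And>i j :: int. (i, j) \<noteq> (0, 0) \<Longrightarrow>
      \<bar>of_int i * w1 + of_int j * w2\<bar> \<ge> c * (\<bar>of_int i\<bar> + \<bar>of_int j\<bar>) powr (- \<sigma>)"
begin

definition freq :: "int \<times> int \<Rightarrow> real" where
  "freq p = of_int (fst p) * w1 + of_int (snd p) * w2"

lemma freq_diff: "freq p - freq p' = freq (p - p')"
  by (simp add: freq_def algebra_simps)

lemma freq_lower:
  assumes "\<bar>fst p\<bar> \<le> int k" "\<bar>snd p\<bar> \<le> int k" "p \<noteq> 0"
  shows "\<bar>freq p\<bar> \<ge> c * (2 * real k) powr (- \<sigma>)"
proof -
  have n: "(fst p, snd p) \<noteq> (0, 0)" using assms(3) by (auto simp: prod_eq_iff)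
  have a: "\<bar>real_of_int (fst p)\<bar> \<le> real k" "\<bar>real_of_int (snd p)\<bar> \<le> real k"
    using assms(1,2) by linarith+
  have b: "\<bar>real_of_int (fst p)\<bar> + \<bar>real_of_int (snd p)\<bar> > 0"
  proof (rule ccontr)
    assume "\<not> ?thesis"
    then have "real_of_int (fst p) = 0" "real_of_int (snd p) = 0" by linarith+
    then show False using n by simp
  qed
  have "(2 * real k) powr (- \<sigma>) \<le> (\<bar>real_of_int (fst p)\<bar> + \<bar>real_of_int (snd p)\<bar>) powr (- \<sigma>)"
    using a b \<sigma>_pos by (intro powr_mono2') auto
  then have "c * (2 * real k) powr (- \<sigma>) \<le> c * (\<bar>real_of_int (fst p)\<bar> + \<bar>real_of_int (snd p)\<bar>) powr (- \<sigma>)"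
    using c_pos by (intro mult_left_mono) auto
  also have "\<dots> \<le> \<bar>freq p\<bar>" using dioph[OF n] by (simp add: freq_def)
  finally show ?thesis .
qed

text \<open>Differences of points of the box lie in the box of twice the size, where the l1 norm is
  at most 4k.\<close>

lemma freq_separated:
  assumes "p \<in> box2 k" "p' \<in> box2 k" "p \<noteq> p'"
  shows "\<bar>freq p - freq p'\<bar> \<ge> c * (4 * real k) powr (- \<sigma>)"
proof -
  have "\<bar>fst (p - p')\<bar> \<le> int (2 * k)" "\<bar>snd (p - p')\<bar> \<le> int (2 * k)" "p - p' \<noteq> 0"
    using assms by (auto simp: abs_le_iff)
  from freq_lower[OF this] show ?thesis by (simp add: freq_diff)
qed

lemma inj_on_freq: assumes "k \<ge> 1" shows "inj_on freq (box2 k)"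
proof (rule inj_onI, rule ccontr)
  fix p p' assume "p \<in> box2 k" "p' \<in> box2 k" "freq p = freq p'" "p \<noteq> p'"
  with freq_separated[of p k p'] have "c * (4 * real k) powr (- \<sigma>) \<le> 0" by simp
  moreover have "c * (4 * real k) powr (- \<sigma>) > 0" using c_pos assms by simp
  ultimately show False by simp
qed

text \<open>The common phase \<open>\<beta>\<close> only rotates the coefficients, so their moduli
  still sum to at least the modulus of the value at the origin, which for the peak polynomial is the
  maximum. Later \<open>\<beta>\<close> is \<open>- (pi / 2)\<close>, turning cosines into
  sines.\<close>

lemma trig_poly_on_orbit:
  assumes "trig_poly k f"
  obtains b where
    "\<And>t. f (w1 * t + \<beta>) (w2 * t + \<beta>) = (\<Sum>p\<in>box2 k. b p * cis (freq p * t))"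
    "norm (f 0 0) \<le> (\<Sum>p\<in>box2 k. norm (b p))"
proof -
  obtain q where q: "\<And>x y. f x y = (\<Sum>p\<in>box2 k. q p * cis (of_int (fst p) * x + of_int (snd p) * y))"
    using trig_poly_coeffs[OF assms] by blast
  define b where "b p = q p * cis (of_int (fst p + snd p) * \<beta>)" for p
  have "f (w1 * t + \<beta>) (w2 * t + \<beta>) = (\<Sum>p\<in>box2 k. b p * cis (freq p * t))" for t
    unfolding q
  proof (rule sum.cong[OF refl])
    fix p
    have "cis (of_int (fst p) * (w1 * t + \<beta>) + of_int (snd p) * (w2 * t + \<beta>)) =
       cis (of_int (fst p + snd p) * \<beta>) * cis (freq p * t)"
      by (simp add: cis_mult freq_def algebra_simps)
    then show "q p * cis (of_int (fst p) * (w1 * t + \<beta>) + of_int (snd p) * (w2 * t + \<beta>)) =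
       b p * cis (freq p * t)"
      by (simp add: b_def)
  qed
  moreover have "norm (f 0 0) \<le> (\<Sum>p\<in>box2 k. norm (b p))"
    unfolding q by (rule order_trans[OF norm_sum]) (simp add: b_def norm_mult)
  ultimately show ?thesis using that by blast
qed

text \<open>The mean is the real part of the coefficient at frequency 0. For the rest, integration
  divides \<open>b p\<close> by \<open>freq p\<close>; Cauchy-Schwarz pairs Bessel's inequality for
  \<open>b\<close> with the separated sum of \<open>1 / (freq p)\<^sup>2\<close>, so that only the
  inverse of the smallest gap is lost.\<close>

lemma trig_poly_primitive:
  assumes tp: "trig_poly k (\<lambda>x y. of_real (f x y))" and k: "k \<ge> 1" and bd: "\<And>x y. \<bar>f x y\<bar> \<le> 1"
  obtains P m where
    "\<And>t. (P has_real_derivative f (w1 * t + \<beta>) (w2 * t + \<beta>)) (at t)"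
    "\<And>t. \<bar>P t - m * t\<bar> \<le> 2 / c * (4 * real k) powr \<sigma>" "\<bar>m\<bar> \<le> 1"
proof -
  obtain b where b: "\<And>t. complex_of_real (f (w1 * t + \<beta>) (w2 * t + \<beta>)) = (\<Sum>p\<in>box2 k. b p * cis (freq p * t))"
    using trig_poly_on_orbit[OF tp] by blast
  define m where "m = Re (b 0)"
  define B where "B = box2 k - {0}"
  define P where "P t = m * t + (\<Sum>p\<in>B. Re (b p * cis (freq p * t) / (\<i> * of_real (freq p))))" for t
  \<comment> \<open>One gap serves twice: frequencies of the box differ by at least
    \<open>\<delta>\<close>, and comparison with the frequency 0 keeps the others away from
    0.\<close>
  define \<delta> where "\<delta> = c * (4 * real k) powr (- \<sigma>)"
  have \<delta>: "\<delta> > 0" using c_pos k by (simp add: \<delta>_def)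
  have finB: "finite B" by (simp add: B_def)
  have lo: "\<bar>freq p\<bar> \<ge> \<delta>" if "p \<in> B" for p
  proof -
    have "0 \<in> box2 k" "p \<in> box2 k" "p \<noteq> 0" using that by (auto simp: B_def zero_prod_def)
    from freq_separated[OF this(2,1,3)] show ?thesis by (simp add: \<delta>_def freq_def)
  qed
  have bessel: "(\<Sum>p\<in>box2 k. (norm (b p))\<^sup>2) \<le> 1"
  proof (rule trig_sum_bessel[OF _ inj_on_freq[OF k]])
    show "norm (\<Sum>p\<in>box2 k. b p * cis (freq p * t)) \<le> 1" for t
      using bd by (simp add: b[symmetric])
  qed simp
  have z: "(0 :: int \<times> int) \<in> box2 k" by (auto simp: zero_prod_def)
  have "(P has_real_derivative f (w1 * t + \<beta>) (w2 * t + \<beta>)) (at t)" for t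
  proof -
    have "(P has_real_derivative m + (\<Sum>p\<in>B. Re (b p * cis (freq p * t)))) (at t)"
      unfolding P_def[abs_def]
    proof (intro DERIV_add DERIV_sum)
      show "((*) m has_real_derivative m) (at t)"
        by (auto intro!: derivative_eq_intros)
      show "((\<lambda>t. Re (b p * cis (freq p * t) / (\<i> * of_real (freq p)))) has_real_derivative
        Re (b p * cis (freq p * t))) (at t)" if "p \<in> B" for p
        using lo[OF that] \<delta> by (intro has_derivative_cis_antideriv) auto
    qed
    moreover have "m + (\<Sum>p\<in>B. Re (b p * cis (freq p * t))) = Re (\<Sum>p\<in>box2 k. b p * cis (freq p * t))"
      unfolding Re_sum B_def m_def using sum.remove[OF _ z, of "\<lambda>p. Re (b p * cis (freq p * t))"]
      by (simp add: freq_def)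
    ultimately show ?thesis unfolding b[symmetric] by simp
  qed
  moreover have "\<bar>P t - m * t\<bar> \<le> 2 / c * (4 * real k) powr \<sigma>" for t
  proof -
    have "\<bar>P t - m * t\<bar> \<le> (\<Sum>p\<in>B. \<bar>Re (b p * cis (freq p * t) / (\<i> * of_real (freq p)))\<bar>)"
      by (simp add: P_def sum_abs)
    also have "\<dots> \<le> (\<Sum>p\<in>B. \<bar>norm (b p)\<bar> * \<bar>1 / freq p\<bar>)"
      by (intro sum_mono) (use norm_cis_antideriv in simp)
    also have "\<dots> \<le> L2_set (\<lambda>p. norm (b p)) B * L2_set (\<lambda>p. 1 / freq p) B"
      by (rule L2_set_mult_ineq)
    also have "\<dots> \<le> 1 * (2 / \<delta>)"
    proof (rule mult_mono)
      have "(\<Sum>p\<in>B. (norm (b p))\<^sup>2) \<le> (\<Sum>p\<in>box2 k. (norm (b p))\<^sup>2)"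
        by (rule sum_mono2) (auto simp: B_def)
      then show "L2_set (\<lambda>p. norm (b p)) B \<le> 1" using bessel by (simp add: L2_set_def)
      have "(\<Sum>p\<in>B. 1 / (freq p)\<^sup>2) \<le> 4 / \<delta>\<^sup>2"
        by (rule sum_inverse_squares_separated[OF finB \<delta> lo])
           (auto simp: B_def \<delta>_def intro: freq_separated)
      then have "(\<Sum>p\<in>B. (1 / freq p)\<^sup>2) \<le> (2 / \<delta>)\<^sup>2" by (simp add: power_divide)
      then show "L2_set (\<lambda>p. 1 / freq p) B \<le> 2 / \<delta>"
        unfolding L2_set_def using \<delta> by (intro real_le_lsqrt) auto
    qed (auto simp: L2_set_nonneg)
    also have "1 * (2 / \<delta>) = 2 / c * (4 * real k) powr \<sigma>"
      by (simp add: \<delta>_def powr_minus divide_inverse)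
    finally show ?thesis .
  qed
  moreover have "\<bar>m\<bar> \<le> 1"
  proof -
    have "(norm (b 0))\<^sup>2 \<le> (\<Sum>p\<in>box2 k. (norm (b p))\<^sup>2)"
      by (rule member_le_sum[OF z]) auto
    then have "(norm (b 0))\<^sup>2 \<le> 1\<^sup>2" using bessel by simp
    then have "norm (b 0) \<le> 1" by (rule power2_le_imp_le) simp
    then show ?thesis unfolding m_def using abs_Re_le_cmod[of "b 0"] by linarith
  qed
  ultimately show ?thesis using that by blast
qed

text \<open>The mean of the square of the peak polynomial is a sum of squared coefficients, whose sum
  is at least its maximum \<open>1\<close>; Cauchy-Schwarz over the box of frequencies bounds it from below.\<close>

lemma peak_primitive:
  assumes n: "n \<ge> 1"
  obtains P m where
    "\<And>t. (P has_real_derivative ((2 + (cos (w1 * t + \<beta>) + cos (w2 * t + \<beta>))) / 4) ^ (2 * n)) (at t)"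
    "\<And>t. \<bar>P t - m * t\<bar> \<le> 2 / c * (8 * real n) powr \<sigma>" "m \<ge> 1 / (2 * real n + 1)\<^sup>2"
proof -
  define g where "g x y = (2 + (cos x + cos y)) / 4" for x y :: real
  have g1: "\<bar>g x y\<bar> \<le> 1" for x y
    unfolding g_def using cos_ge_minus_one[of x] cos_ge_minus_one[of y] cos_le_one[of x] cos_le_one[of y]
    by (auto simp: abs_le_iff simp del: cos_ge_minus_one cos_le_one)
  have g2: "\<bar>g x y ^ n\<bar> \<le> 1" for x y n using g1 by (simp add: power_abs power_le_one)
  have tp: "trig_poly k (\<lambda>x y. of_real (g x y ^ k))" for k
    unfolding g_def by (rule trig_poly_peak)
  \<comment> \<open>\<open>P\<close> belongs to the polynomial of degree 2n and carries the
    discrepancy bound; \<open>F\<close> below belongs to the mean square of the polynomial of degree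
    n and has a computable slope.\<close>
  obtain P m where P: "\<And>t. (P has_real_derivative g (w1 * t + \<beta>) (w2 * t + \<beta>) ^ (2 * n)) (at t)"
    and Pm: "\<And>t. \<bar>P t - m * t\<bar> \<le> 2 / c * (4 * real (2 * n)) powr \<sigma>"
  proof -
    have "2 * n \<ge> 1" using n by simp
    show ?thesis
      by (rule trig_poly_primitive[OF tp \<open>2 * n \<ge> 1\<close> g2], rule that)
  qed
  obtain b where b: "\<And>t. complex_of_real (g (w1 * t + \<beta>) (w2 * t + \<beta>) ^ n) = (\<Sum>p\<in>box2 n. b p * cis (freq p * t))"
    and b0: "norm (complex_of_real (g 0 0 ^ n)) \<le> (\<Sum>p\<in>box2 n. norm (b p))"
    using trig_poly_on_orbit[OF tp[of n]] by blast
  define A where "A = (\<Sum>p\<in>box2 n. (norm (b p))\<^sup>2)"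
  obtain F M where F: "\<And>t. (F has_real_derivative (norm (\<Sum>p\<in>box2 n. b p * cis (freq p * t)))\<^sup>2) (at t)"
    and FM: "\<And>t. \<bar>F t - t * A\<bar> \<le> M"
    unfolding A_def using trig_sum_mean_square[OF _ inj_on_freq[OF n], of b] by blast
  have F': "(F has_real_derivative g (w1 * t + \<beta>) (w2 * t + \<beta>) ^ (2 * n)) (at t)" for t
  proof -
    have "(norm (complex_of_real (x ^ n)))\<^sup>2 = x ^ (2 * n)" for x
      unfolding norm_of_real power2_abs power_mult[symmetric] mult.commute[of n 2] ..
    then show ?thesis using F[of t] unfolding b[symmetric] by (simp only:)
  qed
  \<comment> \<open>Both are primitives of the same power, so they have the same slope; this passes
    the lower bound for \<open>A\<close> on to \<open>m\<close>.\<close>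
  have const: "F t - P t = F 0 - P 0" for t
  proof -
    have "((\<lambda>t. F t - P t) has_real_derivative 0) (at t)" for t
      using DERIV_diff[OF F' P, of t] by simp
    then show ?thesis using DERIV_isconst_all by blast
  qed
  have "A \<le> m"
  proof (rule bounded_diff_imp_le)
    fix t :: real assume "t > 0"
    show "t * A \<le> t * m + (M + \<bar>F 0 - P 0\<bar> + 2 / c * (4 * real (2 * n)) powr \<sigma>)"
      using FM[of t] Pm[of t] const[of t] mult.commute[of t m] by linarith
  qed
  moreover have "A \<ge> 1 / (2 * real n + 1)\<^sup>2"
  proof -
    have "1 \<le> (\<Sum>p\<in>box2 n. norm (b p))" using b0 by (simp add: g_def)
    also have "\<dots> = (\<Sum>p\<in>box2 n. \<bar>1\<bar> * \<bar>norm (b p)\<bar>)" by simp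
    also have "\<dots> \<le> L2_set (\<lambda>_. 1) (box2 n) * L2_set (\<lambda>p. norm (b p)) (box2 n)"
      by (rule L2_set_mult_ineq)
    finally have "1 \<le> (L2_set (\<lambda>_. 1) (box2 n) * L2_set (\<lambda>p. norm (b p)) (box2 n))\<^sup>2"
      by (simp add: one_le_power)
    also have "\<dots> = real (card (box2 n)) * A"
      by (simp add: power_mult_distrib L2_set_def A_def sum_nonneg; simp add: power2_eq_square)
    also have "real (card (box2 n)) = (2 * real n + 1)\<^sup>2"
      by (simp add: card_cartesian_product power2_eq_square)
    finally show ?thesis by (simp add: divide_simps mult.commute)
  qed
  ultimately have "m \<ge> 1 / (2 * real n + 1)\<^sup>2" by linarith
  moreover have "\<bar>P t - m * t\<bar> \<le> 2 / c * (8 * real n) powr \<sigma>" for t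
    using Pm[of t] by (simp add: mult.assoc[symmetric])
  ultimately show ?thesis using that[OF P[unfolded g_def]] by blast
qed

end

subsection \<open>Cosine series along the orbit\<close>

text \<open>The product formula for cosines turns vanishing cosine moments into vanishing integrals
  against all polynomials in \<open>cos \<theta>\<close>. As a function of
  \<open>cos \<theta>\<close>, \<open>d\<close> itself is a uniform limit of such polynomials, so
  the integral of its square is 0.\<close>

lemma cos_moments_zero:
  fixes d :: "real \<Rightarrow> real"
  assumes cont: "continuous_on {0..pi} d"
    and mom: "\<And>k::nat. integral {0..pi} (\<lambda>\<theta>. d \<theta> * cos (real k * \<theta>)) = 0"
    and \<theta>: "\<theta> \<in> {0..pi}"
  shows "d \<theta> = 0"
proof -
  have int: "(\<lambda>\<theta>. d \<theta> * cos \<theta> ^ n * cos (real k * \<theta>)) integrable_on {0..pi}" for n k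
    by (intro integrable_continuous_real continuous_intros cont)
  \<comment> \<open>The index \<open>k\<close> must be free: one more cosine replaces it by its two
    neighbours, and for \<open>k = 0\<close> the new factor is itself the cosine of index 1.\<close>
  have m2: "integral {0..pi} (\<lambda>\<theta>. d \<theta> * cos \<theta> ^ n * cos (real k * \<theta>)) = 0" for n k
  proof (induction n arbitrary: k)
    case 0
    then show ?case using mom by simp
  next
    case (Suc n)
    show ?case
    proof (cases k)
      case 0
      then show ?thesis using Suc[of 1] by (simp add: mult_ac)
    next
      case (Suc l)
      have "d t * cos t ^ Suc n * cos (real k * t) =
         (1/2) * (d t * cos t ^ n * cos (real (Suc k) * t)) + (1/2) * (d t * cos t ^ n * cos (real l * t))" for t
      proof -
        have "cos (real k * t + t) + cos (real k * t - t) = 2 * cos (real k * t) * cos t"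
          by (simp add: cos_add cos_diff)
        moreover have "real k * t + t = real (Suc k) * t" "real k * t - t = real l * t"
          by (auto simp: Suc algebra_simps)
        ultimately have *: "cos t * cos (real k * t) = (1/2) * (cos (real (Suc k) * t) + cos (real l * t))"
          by simp
        have "d t * cos t ^ Suc n * cos (real k * t) = d t * cos t ^ n * (cos t * cos (real k * t))"
          by simp
        then show ?thesis unfolding * by (simp only: distrib_left mult.left_commute)
      qed
      then have "integral {0..pi} (\<lambda>t. d t * cos t ^ Suc n * cos (real k * t)) =
        integral {0..pi} (\<lambda>t. (1/2) * (d t * cos t ^ n * cos (real (Suc k) * t)) + (1/2) * (d t * cos t ^ n * cos (real l * t)))"
        by (simp only:)
      also have "\<dots> = (1/2) * integral {0..pi} (\<lambda>t. d t * cos t ^ n * cos (real (Suc k) * t))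
         + (1/2) * integral {0..pi} (\<lambda>t. d t * cos t ^ n * cos (real l * t))"
        by (subst integral_add) (auto intro!: integrable_on_cmult_left int simp del: of_nat_Suc)
      also have "\<dots> = 0" using \<open>\<And>k. integral {0..pi} (\<lambda>\<theta>. d \<theta> * cos \<theta> ^ n * cos (real k * \<theta>)) = 0\<close>
        by (simp del: of_nat_Suc)
      finally show ?thesis .
    qed
  qed
  have m3: "integral {0..pi} (\<lambda>t. d t * g (cos t)) = 0" if "real_polynomial_function g" for g
  proof -
    from that obtain a n where g: "g = (\<lambda>x. \<Sum>i\<le>n. a i * x ^ i)"
      unfolding real_polynomial_function_iff_sum by (elim exE)
    have "integral {0..pi} (\<lambda>t. d t * g (cos t)) = integral {0..pi} (\<lambda>t. \<Sum>i\<le>(n::nat). a i * (d t * cos t ^ i))"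
      by (simp add: g sum_distrib_left mult_ac)
    also have "\<dots> = (\<Sum>i\<le>n. integral {0..pi} (\<lambda>t. a i * (d t * cos t ^ i)))"
      by (intro integral_sum integrable_continuous_real continuous_intros cont) auto
    also have "\<dots> = 0" using m2[of _ 0] by simp
    finally show ?thesis .
  qed
  define D where "D c = d (arccos c)" for c
  have D: "continuous_on {-1..1} D"
    unfolding D_def by (intro continuous_on_compose2[OF cont] continuous_on_arccos')
      (auto intro: arccos_lbound arccos_ubound)
  have Dc: "D (cos t) = d t" if "t \<in> {0..pi}" for t
    using that by (simp add: D_def arccos_cos)
  obtain B where "\<forall>x\<in>d ` {0..pi}. norm x \<le> B"
    using compact_imp_bounded[OF compact_continuous_image[OF cont compact_Icc]]
    unfolding bounded_iff ..
  then have B: "\<And>t. t \<in> {0..pi} \<Longrightarrow> \<bar>d t\<bar> \<le> B" by simp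
  have B0: "B \<ge> 0" using B[OF \<theta>] by linarith
  have i2: "(\<lambda>t. (d t)\<^sup>2) integrable_on {0..pi}"
    by (intro integrable_continuous_real continuous_intros cont)
  have "integral {0..pi} (\<lambda>t. (d t)\<^sup>2) \<le> 0"
  proof (rule field_le_epsilon)
    fix e :: real assume e: "e > 0"
    \<comment> \<open>With \<open>d\<close> bounded by \<open>B\<close> on an interval of length pi,
      this accuracy costs at most \<open>e\<close>.\<close>
    define e' where "e' = e / (pi * (B + 1))"
    have "e' > 0" using e B0 by (simp add: e'_def)
    obtain g where g: "real_polynomial_function g" "\<And>c. c \<in> {-1..1} \<Longrightarrow> \<bar>D c - g c\<bar> < e'"
      using Stone_Weierstrass_real_polynomial_function[OF compact_Icc D \<open>e' > 0\<close>] by blast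
    have cg: "continuous_on {0..pi} (\<lambda>t. g (cos t))"
    proof -
      have "continuous_on UNIV g" using g(1)
        by (simp add: continuous_on_polymonial_function real_polynomial_function_eq)
      then show ?thesis
        by (rule continuous_on_compose2) (auto intro!: continuous_intros)
    qed
    have "integral {0..pi} (\<lambda>t. (d t)\<^sup>2) = integral {0..pi} (\<lambda>t. (d t)\<^sup>2) - integral {0..pi} (\<lambda>t. d t * g (cos t))"
      using m3[OF g(1)] by simp
    also have "\<dots> = integral {0..pi} (\<lambda>t. (d t)\<^sup>2 - d t * g (cos t))"
      by (intro integral_diff[symmetric] i2 integrable_continuous_real continuous_intros cont cg)
    also have "\<dots> \<le> integral {0..pi} (\<lambda>t. B * e')"
    proof (rule integral_le)
      show "(\<lambda>t. (d t)\<^sup>2 - d t * g (cos t)) integrable_on {0..pi}"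
        by (intro integrable_continuous_real continuous_intros cont cg)
      fix t assume t: "t \<in> {0..pi}"
      have "(d t)\<^sup>2 - d t * g (cos t) = d t * (D (cos t) - g (cos t))"
        using Dc[OF t] by (simp add: power2_eq_square algebra_simps)
      also have "\<dots> \<le> \<bar>d t\<bar> * \<bar>D (cos t) - g (cos t)\<bar>" by (metis abs_ge_self abs_mult)
      also have "\<dots> \<le> B * e'"
        using B[OF t] g(2)[of "cos t"] B0 by (intro mult_mono) auto
      finally show "(d t)\<^sup>2 - d t * g (cos t) \<le> B * e'" .
    qed auto
    also have "\<dots> = pi * (B * e')" by simp
    also have "\<dots> \<le> pi * ((B + 1) * e')" using \<open>e' > 0\<close> by simp
    also have "\<dots> = e" using B0 by (simp add: e'_def)
    finally show "integral {0..pi} (\<lambda>t. (d t)\<^sup>2) \<le> 0 + e" by simp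
  qed
  moreover have "integral {0..pi} (\<lambda>t. (d t)\<^sup>2) \<ge> 0" by (rule integral_nonneg[OF i2]) auto
  ultimately have "integral (cbox 0 pi) (\<lambda>t. (d t)\<^sup>2) = 0" by simp
  moreover have "integral (cbox 0 pi) (\<lambda>t. (d t)\<^sup>2) = 0 \<longleftrightarrow> (\<forall>t \<in> cbox 0 pi. (d t)\<^sup>2 = 0)"
    by (rule integral_cbox_eq_0_iff) (auto intro!: continuous_intros cont simp: not_le)
  ultimately show ?thesis using \<theta> by auto
qed

lemma integral_cos_int:
  "((\<lambda>\<theta>. cos (real_of_int m * \<theta>)) has_integral (if m = 0 then pi else 0)) {0..pi}"
proof (cases "m = 0")
  case True
  then show ?thesis using has_integral_const_real[of "1::real" 0 pi] by simp
next
  case False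
  have "((\<lambda>\<theta>. cos (real_of_int m * \<theta>)) has_integral
     sin (real_of_int m * pi) / real_of_int m - sin (real_of_int m * 0) / real_of_int m) {0..pi}"
    by (rule fundamental_theorem_of_calculus)
       (use False in \<open>auto intro!: derivative_eq_intros
          simp: has_real_derivative_iff_has_vector_derivative[symmetric]\<close>)
  moreover have "sin (real_of_int m * pi) = 0" by (metis mult.commute sin_npi_int)
  ultimately show ?thesis using False by simp
qed

lemma integral_cos_cos:
  "((\<lambda>\<theta>. cos (real k * \<theta>) * cos (real j * \<theta>)) has_integral
     (if k = j then if k = 0 then pi else pi / 2 else 0)) {0..pi}"
proof -
  have "(\<lambda>\<theta>. cos (real k * \<theta>) * cos (real j * \<theta>)) =
    (\<lambda>\<theta>. (1/2) * (cos (real_of_int (int k + int j) * \<theta>) + cos (real_of_int (int k - int j) * \<theta>)))"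
    by (auto simp: distrib_right left_diff_distrib cos_add cos_diff)
  moreover have "((\<lambda>\<theta>. (1/2) * (cos (real_of_int (int k + int j) * \<theta>) + cos (real_of_int (int k - int j) * \<theta>)))
     has_integral (1/2) * ((if int k + int j = 0 then pi else 0) + (if int k - int j = 0 then pi else 0))) {0..pi}"
    by (intro has_integral_mult_right has_integral_add integral_cos_int)
  moreover have "(1/2) * ((if int k + int j = 0 then pi else 0) + (if int k - int j = 0 then pi else 0))
     = (if k = j then if k = 0 then pi else pi / 2 else 0)" by auto
  ultimately show ?thesis by simp
qed

text \<open>The denominators are the squared norms of \<open>cos (k * \<theta>)\<close> on [0,pi],
  so the series has no halved constant term.\<close>

definition cos_coeff :: "(real \<Rightarrow> real) \<Rightarrow> nat \<Rightarrow> real" where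
  "cos_coeff h k = integral {0..pi} (\<lambda>\<theta>. h \<theta> * cos (real k * \<theta>)) / (if k = 0 then pi else pi / 2)"

text \<open>Absolute summability makes the series converge uniformly to a continuous function with
  the same cosine moments as \<open>h\<close>; the two then agree by
  \<open>cos_moments_zero\<close>.\<close>

lemma cosine_series:
  fixes h :: "real \<Rightarrow> real"
  assumes cont: "continuous_on {0..pi} h" and summ: "summable (\<lambda>k. \<bar>cos_coeff h k\<bar>)"
    and \<theta>: "\<theta> \<in> {0..pi}"
  shows "(\<lambda>k. cos_coeff h k * cos (real k * \<theta>)) sums h \<theta>"
proof -
  define a where "a = cos_coeff h"
  define g where "g \<theta> = (\<Sum>k. a k * cos (real k * \<theta>))" for \<theta>
  have sm: "summable (\<lambda>k. a k * cos (real k * t))" for t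
    using summ unfolding a_def
    by (rule summable_comparison_test'[where N = 0]) (simp add: abs_mult mult_left_le)
  have unif: "uniform_limit {0..pi} (\<lambda>n t. \<Sum>k<n. a k * cos (real k * t) * cos (real j * t))
      (\<lambda>t. g t * cos (real j * t)) sequentially" for j
  proof -
    have "uniform_limit {0..pi} (\<lambda>n t. \<Sum>k<n. a k * cos (real k * t) * cos (real j * t))
      (\<lambda>t. \<Sum>k. a k * cos (real k * t) * cos (real j * t)) sequentially"
    proof (rule Weierstrass_m_test)
      show "summable (\<lambda>k. \<bar>a k\<bar>)" using summ by (simp add: a_def)
      show "norm (a n * cos (real n * x) * cos (real j * x)) \<le> \<bar>a n\<bar>" for n x
        by (simp add: abs_mult mult.assoc mult_left_le mult_le_one)
    qed
    also have "(\<lambda>t. \<Sum>k. a k * cos (real k * t) * cos (real j * t)) = (\<lambda>t. g t * cos (real j * t))"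
      unfolding g_def using suminf_mult2[OF sm] by (auto simp: fun_eq_iff)
    finally show ?thesis .
  qed
  have contg: "continuous_on {0..pi} g"
    by (rule uniform_limit_theorem[OF _ unif[of 0, simplified]])
       (auto intro!: always_eventually continuous_intros)
  have gint: "integral {0..pi} (\<lambda>t. g t * cos (real j * t)) = a j * (if j = 0 then pi else pi / 2)" for j
  proof -
    obtain I J where I: "\<And>n. ((\<lambda>t. \<Sum>k<n. a k * cos (real k * t) * cos (real j * t)) has_integral I n) {0..pi}"
      and J: "((\<lambda>t. g t * cos (real j * t)) has_integral J) {0..pi}" and lim: "I \<longlonglongrightarrow> J"
    proof (rule uniform_limit_integral[OF unif[of j]])
      show "continuous_on {0..pi} (\<lambda>t. \<Sum>k<n. a k * cos (real k * t) * cos (real j * t))" for n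
        by (intro continuous_intros)
    qed (use that in auto)
    have "I n = a j * (if j = 0 then pi else pi / 2)" if "n > j" for n
    proof -
      have "((\<lambda>t. \<Sum>k<n. a k * (cos (real k * t) * cos (real j * t))) has_integral
        (\<Sum>k<n. a k * (if k = j then if k = 0 then pi else pi / 2 else 0))) {0..pi}"
        by (intro has_integral_sum has_integral_mult_right integral_cos_cos) auto
      moreover have "(\<Sum>k<n. a k * (if k = j then if k = 0 then pi else pi / 2 else 0)) =
        (\<Sum>k<n. if k = j then a j * (if j = 0 then pi else pi / 2) else 0)"
        by (rule sum.cong) auto
      ultimately have "((\<lambda>t. \<Sum>k<n. a k * cos (real k * t) * cos (real j * t)) has_integral
        a j * (if j = 0 then pi else pi / 2)) {0..pi}"
        using that by (simp add: mult.assoc)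
      then show ?thesis using I[of n] has_integral_unique by blast
    qed
    with eventually_gt_at_top[of j]
    have "eventually (\<lambda>n. I n = a j * (if j = 0 then pi else pi / 2)) sequentially"
      by (rule eventually_mono)
    then have "I \<longlonglongrightarrow> a j * (if j = 0 then pi else pi / 2)"
      by (rule tendsto_eventually)
    with lim have "J = a j * (if j = 0 then pi else pi / 2)" by (rule LIMSEQ_unique)
    then show ?thesis using J by (simp add: integral_unique)
  qed
  have "h \<theta> - g \<theta> = 0"
  proof (rule cos_moments_zero[OF _ _ \<theta>])
    show "continuous_on {0..pi} (\<lambda>t. h t - g t)" by (intro continuous_intros cont contg)
    fix k :: nat
    have "integral {0..pi} (\<lambda>t. (h t - g t) * cos (real k * t)) =
      integral {0..pi} (\<lambda>t. h t * cos (real k * t) - g t * cos (real k * t))"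
      by (simp add: left_diff_distrib)
    also have "\<dots> = integral {0..pi} (\<lambda>t. h t * cos (real k * t)) - integral {0..pi} (\<lambda>t. g t * cos (real k * t))"
      by (intro integral_diff integrable_continuous_real continuous_intros cont contg)
    also have "\<dots> = 0" unfolding gint by (simp add: a_def cos_coeff_def)
    finally show "integral {0..pi} (\<lambda>t. (h t - g t) * cos (real k * t)) = 0" .
  qed
  then show ?thesis using summable_sums[OF sm[of \<theta>]] by (simp add: g_def a_def)
qed

context diophantine_pair
begin

lemma cheb_primitive:
  obtains P m where
    "\<And>t. (P has_real_derivative cheb k ((cos (w1 * t + \<beta>) + cos (w2 * t + \<beta>)) / 2)) (at t)"
    "\<And>t. \<bar>P t - m * t\<bar> \<le> 2 / c * 4 powr \<sigma> * real k powr \<sigma>" "\<bar>m\<bar> \<le> 1"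
proof (cases "k = 0")
  \<comment> \<open>The bound is 0 here, since \<open>0 powr \<sigma> = 0\<close>; the constant 1
    has an exactly linear primitive.\<close>
  case True
  show ?thesis
  proof (rule that[of "\<lambda>t. t" 1])
    show "((\<lambda>t. t) has_real_derivative cheb k ((cos (w1 * t + \<beta>) + cos (w2 * t + \<beta>)) / 2)) (at t)" for t
      using True by (simp add: cheb_def)
  qed (use True in auto)
next
  case False
  then have "k \<ge> 1" by simp
  from trig_poly_primitive[OF trig_poly_cheb this]
  obtain P m where "\<And>t. (P has_real_derivative cheb k ((cos (w1 * t + \<beta>) + cos (w2 * t + \<beta>)) / 2)) (at t)"
    "\<And>t. \<bar>P t - m * t\<bar> \<le> 2 / c * (4 * real k) powr \<sigma>" "\<bar>m\<bar> \<le> 1"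
    by (auto simp: cheb_def)
  then show ?thesis using that[of P m] by (simp add: powr_mult mult.assoc)
qed

text \<open>Composed with \<open>arccos\<close>, the k-th cosine is a Chebyshev polynomial, whose
  primitive has discrepancy of order \<open>k powr \<sigma>\<close>; against coefficients of order
  k^-3 this is summable. \<open>C\<close> is chosen before \<open>h\<close>, \<open>A\<close> and
  \<open>F\<close>, which is what makes the later bound uniform in the energy.\<close>

lemma orbit_discrepancy:
  assumes \<sigma>2: "\<sigma> < 2"
  obtains C where "C \<ge> 0" and
    "\<And>h A F. continuous_on {0..pi} h \<Longrightarrow> A \<ge> 0 \<Longrightarrow>
       (\<And>k. k \<ge> 1 \<Longrightarrow> \<bar>integral {0..pi} (\<lambda>\<theta>. h \<theta> * cos (real k * \<theta>))\<bar> \<le> A / real k ^ 3) \<Longrightarrow>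
       (\<And>t. (F has_real_derivative h (arccos ((cos (w1 * t + \<beta>) + cos (w2 * t + \<beta>)) / 2))) (at t)) \<Longrightarrow>
       \<exists>m. \<forall>a b. \<bar>F b - F a - m * (b - a)\<bar> \<le> C * A"
proof -
  define K where "K = 2 / c * 4 powr \<sigma>"
  have K: "K \<ge> 0" using c_pos by (simp add: K_def)
  \<comment> \<open>The factor 2/pi comes from \<open>cos_coeff\<close>, 2K from the discrepancies
    at two endpoints, and the exponent \<open>\<sigma> - 3\<close> is below -1.\<close>
  define u where "u k = 2 / pi * (2 * K) * real k powr (\<sigma> - 3)" for k
  have su: "summable u" unfolding u_def
    by (intro summable_mult) (use \<sigma>2 in \<open>simp add: summable_real_powr_iff\<close>)
  have u0: "u k \<ge> 0" for k using K by (simp add: u_def)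
  define C where "C = suminf u"
  show ?thesis
  proof (rule that[of C])
    show "C \<ge> 0" unfolding C_def using su u0 by (rule suminf_nonneg)
    fix h :: "real \<Rightarrow> real" and A :: real and F :: "real \<Rightarrow> real"
    assume cont: "continuous_on {0..pi} h" and A: "A \<ge> 0"
      and hk: "\<And>k. k \<ge> 1 \<Longrightarrow> \<bar>integral {0..pi} (\<lambda>\<theta>. h \<theta> * cos (real k * \<theta>))\<bar> \<le> A / real k ^ 3"
      and F: "\<And>t. (F has_real_derivative h (arccos ((cos (w1 * t + \<beta>) + cos (w2 * t + \<beta>)) / 2))) (at t)"
    define a where "a = cos_coeff h"
    have ak: "\<bar>a k\<bar> \<le> 2 / pi * A * real k powr (-3)" if "k \<ge> 1" for k
    proof -
      have "\<bar>a k\<bar> = 2 / pi * \<bar>integral {0..pi} (\<lambda>\<theta>. h \<theta> * cos (real k * \<theta>))\<bar>"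
        using that by (simp add: a_def cos_coeff_def abs_mult)
      also have "\<dots> \<le> 2 / pi * (A / real k ^ 3)" by (intro mult_left_mono hk that) simp
      also have "A / real k ^ 3 = A * real k powr (-3)"
        using that by (simp add: powr_minus divide_inverse flip: powr_numeral)
      finally show ?thesis by simp
    qed
    have sa: "summable (\<lambda>k. \<bar>a k\<bar>)"
    proof (rule summable_comparison_test'[where N = 1])
      show "summable (\<lambda>k. 2 / pi * A * real k powr (-3))"
        by (intro summable_mult) (simp add: summable_real_powr_iff)
    qed (use ak in auto)
    have "\<forall>k. \<exists>P m. (\<forall>t. (P has_real_derivative cheb k ((cos (w1 * t + \<beta>) + cos (w2 * t + \<beta>)) / 2)) (at t)) \<and>
      (\<forall>t. \<bar>P t - m * t\<bar> \<le> K * real k powr \<sigma>) \<and> \<bar>m\<bar> \<le> 1"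
      using cheb_primitive unfolding K_def by metis
    then obtain P m where
      P: "\<And>k t. (P k has_real_derivative cheb k ((cos (w1 * t + \<beta>) + cos (w2 * t + \<beta>)) / 2)) (at t)" and
      Pm: "\<And>k t. \<bar>P k t - m k * t\<bar> \<le> K * real k powr \<sigma>" and m1: "\<And>k. \<bar>m k\<bar> \<le> 1"
      by metis
    have sam: "summable (\<lambda>k. a k * m k)"
      using sa by (rule summable_comparison_test'[where N = 0]) (simp add: abs_mult mult_left_le m1)
    define mm where "mm = (\<Sum>k. a k * m k)"
    have "\<bar>F b' - F a' - mm * (b' - a')\<bar> \<le> C * A" if ab: "a' < b'" for a' b'
    proof -
      define r where "r N = (\<Sum>k. \<bar>a k\<bar>) - (\<Sum>k<N. \<bar>a k\<bar>)" for N
      \<comment> \<open>Truncation leaves an error proportional to the length of the interval. It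
        disappears for fixed endpoints as \<open>N\<close> tends to infinity, while the contribution
        of the primitives is bounded independently of \<open>N\<close>.\<close>
      have key: "\<bar>F b' - F a' - (\<Sum>k<N. a k * m k) * (b' - a')\<bar> \<le> r N * (b' - a') + C * A" for N
      proof -
        define G where "G t = F t - (\<Sum>k<N. a k * P k t)" for t
        define Q where "Q t = arccos ((cos (w1 * t + \<beta>) + cos (w2 * t + \<beta>)) / 2)" for t
        have Qr: "Q t \<in> {0..pi}" for t
          unfolding Q_def using abs_half_cos_sum[of "w1 * t + \<beta>" "w2 * t + \<beta>"]
          by (auto simp: abs_le_iff intro!: arccos_lbound arccos_ubound)
        have dG: "(G has_real_derivative h (Q t) - (\<Sum>k<N. a k * cos (real k * Q t))) (at t)" for t
          unfolding G_def[abs_def] using P[of _ t] F[of t]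
          by (auto intro!: derivative_eq_intros simp: cheb_def Q_def mult.commute)
        have bG: "\<bar>h t - (\<Sum>k<N. a k * cos (real k * t))\<bar> \<le> r N" if t: "t \<in> {0..pi}" for t
        proof -
          have s1: "(\<lambda>k. a k * cos (real k * t)) sums h t"
            using cosine_series[OF cont _ t] sa by (simp add: a_def)
          have s2: "(\<lambda>k. a (k + N) * cos (real (k + N) * t)) sums (h t - (\<Sum>k<N. a k * cos (real k * t)))"
            using sums_split_initial_segment[OF s1, of N] by simp
          have s3: "(\<lambda>k. \<bar>a (k + N)\<bar>) sums r N"
            unfolding r_def using sums_split_initial_segment[OF summable_sums[OF sa], of N] by simp
          have "\<bar>h t - (\<Sum>k<N. a k * cos (real k * t))\<bar> = norm (\<Sum>k. a (k + N) * cos (real (k + N) * t))"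
            using s2 by (simp add: sums_iff)
          also have "\<dots> \<le> (\<Sum>k. \<bar>a (k + N)\<bar>)"
            by (rule norm_suminf_le) (use s3 in \<open>auto simp: sums_iff abs_mult mult_left_le\<close>)
          also have "\<dots> = r N" using s3 by (simp add: sums_iff)
          finally show ?thesis .
        qed
        obtain z where "G b' - G a' = (b' - a') * (h (Q z) - (\<Sum>k<N. a k * cos (real k * Q z)))"
          using MVT2[OF ab dG] by blast
        then have "\<bar>G b' - G a'\<bar> \<le> (b' - a') * r N"
          using bG[OF Qr, of z] ab by (simp add: abs_mult mult_left_mono)
        moreover have "F b' - F a' - (\<Sum>k<N. a k * m k) * (b' - a') =
           (G b' - G a') + (\<Sum>k<N. a k * ((P k b' - m k * b') - (P k a' - m k * a')))"
        proof -
          have "(\<Sum>k<N. a k * ((P k b' - m k * b') - (P k a' - m k * a'))) =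
            (\<Sum>k<N. a k * P k b' - a k * P k a' - a k * m k * (b' - a'))"
            by (rule sum.cong) (auto simp: algebra_simps)
          then show ?thesis by (simp add: G_def sum_subtractf sum_distrib_right)
        qed
        moreover have "\<bar>\<Sum>k<N. a k * ((P k b' - m k * b') - (P k a' - m k * a'))\<bar> \<le> C * A"
        proof -
          have "\<bar>\<Sum>k<N. a k * ((P k b' - m k * b') - (P k a' - m k * a'))\<bar> \<le>
            (\<Sum>k<N. \<bar>a k * ((P k b' - m k * b') - (P k a' - m k * a'))\<bar>)" by (rule sum_abs)
          also have "\<dots> \<le> (\<Sum>k<N. u k * A)"
          proof (rule sum_mono)
            fix k
            show "\<bar>a k * ((P k b' - m k * b') - (P k a' - m k * a'))\<bar> \<le> u k * A"
            \<comment> \<open>The decay hypothesis says nothing about the constant term, which has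
              no discrepancy: both sides are 0 because 0 to any \<open>powr\<close> is 0.\<close>
            proof (cases "k = 0")
              case True
              then show ?thesis using Pm[of 0 b'] Pm[of 0 a'] by (simp add: u_def)
            next
              case False
              have "\<bar>(P k b' - m k * b') - (P k a' - m k * a')\<bar> \<le> 2 * K * real k powr \<sigma>"
                using Pm[of k b'] Pm[of k a'] by linarith
              then have "\<bar>a k * ((P k b' - m k * b') - (P k a' - m k * a'))\<bar> \<le>
                 (2 / pi * A * real k powr (-3)) * (2 * K * real k powr \<sigma>)"
                unfolding abs_mult using False A by (intro mult_mono ak) auto
              also have "\<dots> = u k * A"
              proof -
                have "real k powr (-3) * real k powr \<sigma> = real k powr (\<sigma> - 3)"
                  by (simp flip: powr_add)
                moreover have "2 / pi * A * real k powr (-3) * (2 * K * real k powr \<sigma>) =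
                  2 / pi * (2 * K) * (real k powr (-3) * real k powr \<sigma>) * A" by simp
                ultimately show ?thesis unfolding u_def by (simp only:)
              qed
              finally show ?thesis .
            qed
          qed
          also have "\<dots> = (\<Sum>k<N. u k) * A" by (rule sum_distrib_right[symmetric])
          also have "\<dots> \<le> C * A" unfolding C_def using su u0 A
            by (intro mult_right_mono sum_le_suminf) auto
          finally show ?thesis .
        qed
        ultimately show ?thesis by (simp add: mult.commute)
      qed
      have rl: "r \<longlonglongrightarrow> 0"
        unfolding r_def using tendsto_diff[OF tendsto_const summable_LIMSEQ[OF sa], of "\<Sum>k. \<bar>a k\<bar>"] by simp
      show ?thesis
      proof (rule LIMSEQ_le)
        show "(\<lambda>N. r N * (b' - a') + C * A) \<longlonglongrightarrow> C * A"
          using tendsto_add[OF tendsto_mult_left_zero[OF rl, of "b' - a'"] tendsto_const, of "C * A"] by simp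
        show "(\<lambda>N. \<bar>F b' - F a' - (\<Sum>k<N. a k * m k) * (b' - a')\<bar>) \<longlonglongrightarrow> \<bar>F b' - F a' - mm * (b' - a')\<bar>"
          unfolding mm_def by (intro tendsto_intros summable_LIMSEQ sam)
      qed (use key in blast)
    qed
    then have lt: "\<bar>F b' - F a' - mm * (b' - a')\<bar> \<le> C * A" if "a' < b'" for a' b' using that .
    have "\<bar>F b' - F a' - mm * (b' - a')\<bar> \<le> C * A" for a' b'
    proof (rule linorder_cases[of a' b'])
      assume "a' > b'"
      moreover have "\<bar>F b' - F a' - mm * (b' - a')\<bar> = \<bar>F a' - F b' - mm * (a' - b')\<bar>"
        by (simp add: algebra_simps abs_minus_commute)
      ultimately show ?thesis using lt[of b' a'] by simp
    qed (use lt A \<open>C \<ge> 0\<close> in auto)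
    then show "\<exists>m. \<forall>a b. \<bar>F b - F a - m * (b - a)\<bar> \<le> C * A" by blast
  qed
qed

end

subsection \<open>Cosine coefficients of the energy\<close>

text \<open>Three integrations by parts, packed into the single primitive \<open>G\<close>. The
  boundary terms carry a sine, which vanishes at both ends, or \<open>h1\<close>, which does so by
  hypothesis. Only an integrable majorant of \<open>h3\<close> in the interior is asked for, as
  \<open>h3\<close> may blow up at 0.\<close>

lemma cos_integral_by_parts:
  fixes h h1 h2 h3 B b :: "real \<Rightarrow> real"
  assumes k: "k \<ge> (1::nat)"
    and c: "continuous_on {0..pi} h" "continuous_on {0..pi} h1" "continuous_on {0..pi} h2"
    and d: "\<And>x. x \<in> {0<..<pi} \<Longrightarrow> (h has_real_derivative h1 x) (at x)"
      "\<And>x. x \<in> {0<..<pi} \<Longrightarrow> (h1 has_real_derivative h2 x) (at x)"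
      "\<And>x. x \<in> {0<..<pi} \<Longrightarrow> (h2 has_real_derivative h3 x) (at x)"
    and bdry: "h1 0 = 0" "h1 pi = 0"
    and B: "(b has_integral I) {0..pi}" "\<And>x. x \<in> {0<..<pi} \<Longrightarrow> \<bar>h3 x\<bar> \<le> b x"
  shows "\<bar>integral {0..pi} (\<lambda>x. h x * cos (real k * x))\<bar> \<le> I / real k ^ 3"
proof -
  define n where "n = real k"
  have n: "n > 0" using k by (simp add: n_def)
  define i where "i = 1 / n"
  have i: "n * i = 1" using n by (simp add: i_def)
  define G where "G x = h x * sin (n * x) * i + h1 x * cos (n * x) * i\<^sup>2 - h2 x * sin (n * x) * i ^ 3" for x
  define G' where "G' x = h x * cos (n * x) - h3 x * sin (n * x) / n ^ 3" for x
  have spi: "sin (n * pi) = 0" unfolding n_def by (metis mult.commute sin_npi2)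
  have "(G' has_integral G pi - G 0) {0..pi}"
  proof (rule fundamental_theorem_of_calculus_interior)
    show "continuous_on {0..pi} G" unfolding G_def
      by (intro continuous_intros c)
    fix x assume x: "x \<in> {0<..<pi}"
    have "(G has_real_derivative
       (h1 x * sin (n * x) + h x * (cos (n * x) * n)) * i
       + (h2 x * cos (n * x) + h1 x * (- sin (n * x) * n)) * i\<^sup>2
       - (h3 x * sin (n * x) + h2 x * (cos (n * x) * n)) * i ^ 3) (at x)"
      unfolding G_def[abs_def] by (auto intro!: derivative_eq_intros d[OF x]; simp add: algebra_simps)
    moreover have "(h1 x * sin (n * x) + h x * (cos (n * x) * n)) * i
       + (h2 x * cos (n * x) + h1 x * (- sin (n * x) * n)) * i\<^sup>2
       - (h3 x * sin (n * x) + h2 x * (cos (n * x) * n)) * i ^ 3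
       = h x * cos (n * x) * (n * i) + h1 x * sin (n * x) * (i - n * i\<^sup>2)
         + h2 x * cos (n * x) * (i\<^sup>2 - n * i ^ 3) - h3 x * sin (n * x) * i ^ 3"
      by (simp add: algebra_simps)
    moreover have "n * i\<^sup>2 = i" "n * i ^ 3 = i\<^sup>2"
      using n by (simp_all add: i_def power2_eq_square power3_eq_cube)
    ultimately have "(G has_real_derivative G' x) (at x)"
      by (simp add: G'_def i power_divide) (simp add: i_def power_divide)
    then show "(G has_vector_derivative G' x) (at x)"
      by (simp add: has_real_derivative_iff_has_vector_derivative)
  qed simp
  then have G': "(G' has_integral 0) {0..pi}" by (simp add: G_def spi bdry)
  have ih: "((\<lambda>x. h x * cos (n * x)) has_integral integral {0..pi} (\<lambda>x. h x * cos (n * x))) {0..pi}"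
    by (intro integrable_integral integrable_continuous_real continuous_intros c)
  from has_integral_diff[OF ih G']
  have i3: "((\<lambda>x. h3 x * sin (n * x) / n ^ 3) has_integral integral {0..pi} (\<lambda>x. h x * cos (n * x))) {0..pi}"
    by (simp add: G'_def)
  have i3': "((\<lambda>x. if x \<in> {0<..<pi} then h3 x * sin (n * x) / n ^ 3 else 0)
      has_integral integral {0..pi} (\<lambda>x. h x * cos (n * x))) {0..pi}"
    by (rule has_integral_spike_finite[OF _ _ i3, of "{0, pi}"]) auto
  have b': "((\<lambda>x. if x \<in> {0<..<pi} then b x / n ^ 3 else 0) has_integral I / n ^ 3) {0..pi}"
    by (rule has_integral_spike_finite[OF _ _ has_integral_divide[OF B(1)], of "{0, pi}"]) auto
  have "norm (integral {0..pi} (\<lambda>x. h x * cos (n * x))) \<le> I / n ^ 3"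
    unfolding integral_unique[OF i3', symmetric] integral_unique[OF b', symmetric]
  proof (rule integral_norm_bound_integral)
    fix x
    show "norm (if x \<in> {0<..<pi} then h3 x * sin (n * x) / n ^ 3 else 0) \<le>
      (if x \<in> {0<..<pi} then b x / n ^ 3 else 0)"
    proof (cases "x \<in> {0<..<pi}")
      case True
      have "\<bar>h3 x\<bar> * \<bar>sin (n * x)\<bar> \<le> b x * 1"
        using B(2)[OF True] by (intro mult_mono) auto
      then show ?thesis using True n by (simp add: abs_mult divide_right_mono)
    qed auto
  qed (use i3' b' in auto)
  then show ?thesis by (simp add: n_def)
qed

text \<open>With \<open>r1\<close>, \<open>r2\<close>, \<open>r3\<close> the derivatives of
  \<open>r\<close>, the left side is the modulus of the third derivative of
  \<open>sqrt (E + r\<^sup>2)\<close>. Both \<open>E\<close> and \<open>r\<^sup>2\<close> are at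
  most \<open>N\<^sup>2\<close>, so powers of \<open>N\<close> can be traded against them until
  \<open>E\<close> disappears.\<close>

lemma norm_sqrt_chain_bound:
  fixes E r N r1 r2 r3 :: real
  assumes E: "E > 0" and r: "r > 0" and N: "N = sqrt (E + r\<^sup>2)"
  shows "\<bar>- 3 * E * r / N ^ 5 * r1 ^ 3 + 3 * (E / N ^ 3) * r1 * r2 + r / N * r3\<bar>
      \<le> 3 * \<bar>r1\<bar> ^ 3 / r\<^sup>2 + 3 * \<bar>r1\<bar> * \<bar>r2\<bar> / r + \<bar>r3\<bar>"
proof -
  have N2: "N\<^sup>2 = E + r\<^sup>2" using E by (simp add: N add_nonneg_nonneg)
  have Np: "N > 0" unfolding N using E by (simp add: add_pos_nonneg)
  have rN: "r \<le> N" unfolding N using E by (intro real_le_rsqrt) simp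
  have EN: "E \<le> N\<^sup>2" using N2 by simp
  have 1: "r / N \<le> 1" using rN Np by simp
  have 2: "E / N ^ 3 \<le> 1 / r"
  proof -
    have "E * r \<le> N\<^sup>2 * N" using EN rN r E by (intro mult_mono) auto
    then have "E * r \<le> N ^ 3" by (simp add: power2_eq_square power3_eq_cube)
    then show ?thesis using Np r by (simp add: field_simps)
  qed
  have 3: "E * r / N ^ 5 \<le> 1 / r\<^sup>2"
  proof -
    have "E * r ^ 3 \<le> N\<^sup>2 * N ^ 3" using EN rN r E by (intro mult_mono power_mono) auto
    then have "E * r ^ 3 \<le> N ^ 5" by (simp flip: power_add)
    then have "E * r * r\<^sup>2 \<le> N ^ 5" by (simp add: power2_eq_square power3_eq_cube mult.assoc)
    then show ?thesis using Np r by (simp add: field_simps)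
  qed
  have "\<bar>- 3 * E * r / N ^ 5 * r1 ^ 3\<bar> = 3 * (E * r / N ^ 5) * \<bar>r1\<bar> ^ 3"
    using E r Np by (simp add: abs_mult power_abs)
  also have "\<dots> \<le> 3 * (1 / r\<^sup>2) * \<bar>r1\<bar> ^ 3" using 3 by (intro mult_right_mono mult_left_mono) auto
  finally have a: "\<bar>- 3 * E * r / N ^ 5 * r1 ^ 3\<bar> \<le> 3 * \<bar>r1\<bar> ^ 3 / r\<^sup>2" by simp
  have "\<bar>3 * (E / N ^ 3) * r1 * r2\<bar> = (E / N ^ 3) * (3 * \<bar>r1\<bar> * \<bar>r2\<bar>)"
    using E Np by (simp add: abs_mult)
  also have "\<dots> \<le> (1 / r) * (3 * \<bar>r1\<bar> * \<bar>r2\<bar>)" using 2 by (intro mult_right_mono) auto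
  finally have b: "\<bar>3 * (E / N ^ 3) * r1 * r2\<bar> \<le> 3 * \<bar>r1\<bar> * \<bar>r2\<bar> / r" by simp
  have "\<bar>r / N * r3\<bar> = (r / N) * \<bar>r3\<bar>" using r Np by (simp add: abs_mult)
  also have "\<dots> \<le> 1 * \<bar>r3\<bar>" using 1 by (intro mult_right_mono) auto
  finally have c: "\<bar>r / N * r3\<bar> \<le> \<bar>r3\<bar>" by simp
  show ?thesis using a b c by linarith
qed

text \<open>In the variable \<open>\<theta>\<close> with \<open>2 cos \<theta> = cos x + cos y\<close> the base of the potential becomes
  \<open>4 sin\<^sup>2(\<theta>/2)\<close>.\<close>

definition sqrt_energy :: "real \<Rightarrow> real \<Rightarrow> real \<Rightarrow> real" where
  "sqrt_energy \<gamma> E \<theta> = sqrt (2 * (E + ((2 * sin (\<theta> / 2)) powr \<gamma>)\<^sup>2))"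

lemma continuous_on_half_sine_powr:
  "a > 0 \<Longrightarrow> continuous_on {0..pi} (\<lambda>\<theta>. (2 * sin (\<theta> / 2)) powr a)"
  by (intro continuous_on_powr' continuous_intros) (auto intro!: sin_ge_zero)

text \<open>With s = 2 sin(\<theta>/2) and r = s^\<gamma>, each term of the chain-rule bound is at
  most of order s^(\<gamma>-3), whatever \<open>E\<close> is. Times \<open>c\<close>, the derivative
  of \<open>s\<close>, this is the derivative of s^(\<gamma>-2)/(\<gamma>-2), which is continuous at
  0 because \<gamma> > 2.\<close>

lemma cos_coeff_sqrt_energy_pos:
  assumes \<gamma>: "\<gamma> > 2"
  obtains A where "A \<ge> 0" "\<And>E k. E > 0 \<Longrightarrow> k \<ge> 1 \<Longrightarrow>
    \<bar>integral {0..pi} (\<lambda>\<theta>. sqrt_energy \<gamma> E \<theta> * cos (real k * \<theta>))\<bar> \<le> A / real k ^ 3"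
proof -
  define s where "s \<theta> = 2 * sin (\<theta> / 2)" for \<theta> :: real
  define c where "c \<theta> = cos (\<theta> / 2)" for \<theta> :: real
  define r where "r \<theta> = s \<theta> powr \<gamma>" for \<theta>
  define r1 where "r1 \<theta> = \<gamma> * s \<theta> powr (\<gamma> - 1) * c \<theta>" for \<theta>
  define r2 where "r2 \<theta> = \<gamma> * (\<gamma> - 1) * s \<theta> powr (\<gamma> - 2) * (c \<theta>)\<^sup>2 - \<gamma> / 4 * s \<theta> powr \<gamma>" for \<theta>
  define r3 where "r3 \<theta> = \<gamma> * (\<gamma> - 1) * (\<gamma> - 2) * s \<theta> powr (\<gamma> - 3) * (c \<theta>) ^ 3
     - \<gamma> * (\<gamma> - 1) / 2 * s \<theta> powr (\<gamma> - 2) * s \<theta> * c \<theta> - \<gamma>\<^sup>2 / 4 * s \<theta> powr (\<gamma> - 1) * c \<theta>" for \<theta>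
  have sp: "s \<theta> > 0" if "\<theta> \<in> {0<..<pi}" for \<theta>
    using that by (auto simp: s_def intro!: sin_gt_zero)
  have sn: "s \<theta> \<ge> 0" if "\<theta> \<in> {0..pi}" for \<theta>
    using that by (auto simp: s_def intro!: sin_ge_zero)
  have s2: "s \<theta> \<le> 2" for \<theta> using sin_le_one[of "\<theta> / 2"] by (simp add: s_def)
  have cp: "0 \<le> c \<theta>" "c \<theta> \<le> 1" if "\<theta> \<in> {0..pi}" for \<theta>
    using that by (auto simp: c_def intro!: cos_ge_zero)
  have cs: "(c \<theta>)\<^sup>2 + (s \<theta>)\<^sup>2 / 4 = 1" for \<theta>
    using sin_cos_squared_add[of "\<theta> / 2"] by (simp add: c_def s_def power_mult_distrib)
  have ds: "(s has_real_derivative c \<theta>) (at \<theta>)" for \<theta>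
    unfolding s_def[abs_def] c_def by (auto intro!: derivative_eq_intros)
  have dc: "(c has_real_derivative - (s \<theta> / 4)) (at \<theta>)" for \<theta>
    unfolding s_def c_def[abs_def] by (auto intro!: derivative_eq_intros)
  have dpow: "((\<lambda>\<theta>. s \<theta> powr a) has_real_derivative a * s \<theta> powr (a - 1) * c \<theta>) (at \<theta>)"
    if "\<theta> \<in> {0<..<pi}" for a \<theta>
    using DERIV_fun_powr[OF ds sp[OF that], of a] by simp
  have dr: "(r has_real_derivative r1 \<theta>) (at \<theta>)" if "\<theta> \<in> {0<..<pi}" for \<theta>
    unfolding r_def[abs_def] r1_def using dpow[OF that] .
  have dr1: "(r1 has_real_derivative r2 \<theta>) (at \<theta>)" if \<theta>: "\<theta> \<in> {0<..<pi}" for \<theta>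
  proof -
    have e: "s \<theta> powr \<gamma> = s \<theta> powr (\<gamma> - 1) * s \<theta>" using sp[OF \<theta>] by (simp add: powr_diff)
    show ?thesis unfolding r1_def[abs_def] r2_def
      by (rule derivative_eq_intros dpow[OF \<theta>] dc refl | simp)+
         (simp add: e power2_eq_square algebra_simps)
  qed
  have dr2: "(r2 has_real_derivative r3 \<theta>) (at \<theta>)" if \<theta>: "\<theta> \<in> {0<..<pi}" for \<theta>
    unfolding r2_def[abs_def] r3_def
    by (rule derivative_eq_intros dpow[OF \<theta>] dc refl | simp)+
       (simp add: power2_eq_square power3_eq_cube algebra_simps)
  have cpow: "continuous_on {0..pi} (\<lambda>\<theta>. s \<theta> powr a)" if "a > 0" for a
    unfolding s_def using continuous_on_half_sine_powr[OF that] .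
  have cc: "continuous_on {0..pi} c" unfolding c_def by (intro continuous_intros) auto
  have cr: "continuous_on {0..pi} r" unfolding r_def using \<gamma> by (intro cpow) simp
  have cr1: "continuous_on {0..pi} r1" unfolding r1_def using \<gamma> by (intro continuous_intros cpow cc) simp
  have cr2: "continuous_on {0..pi} r2" unfolding r2_def using \<gamma> by (intro continuous_intros cpow cc) auto
  \<comment> \<open>Collects the coefficients of the three estimates below, with the weights 3, 3
    and 1 of the chain-rule bound.\<close>
  define K where "K = 3 * \<gamma> ^ 3 + 3 * \<gamma> * (\<gamma> * (\<gamma> - 1) + \<gamma>) + \<gamma> * (\<gamma> - 1) * (\<gamma> - 2) + 2 * \<gamma> * (\<gamma> - 1) + \<gamma>\<^sup>2"
  have K0: "K \<ge> 0" unfolding K_def using \<gamma> by simp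
  \<comment> \<open>This majorant has an explicit primitive. The second summand compensates for the
    factor \<open>c\<close> near pi, where \<open>c\<close> vanishes but \<open>s\<close> does
    not.\<close>
  define b where "b \<theta> = sqrt 2 * K * (s \<theta> powr (\<gamma> - 3) * c \<theta> + 2 powr (\<gamma> - 1) / 4)" for \<theta>
  define I where "I = sqrt 2 * K * (2 powr (\<gamma> - 2) / (\<gamma> - 2) + pi * 2 powr (\<gamma> - 1) / 4)"
  have bint: "(b has_integral I) {0..pi}"
  proof -
    define F where "F \<theta> = sqrt 2 * K * (s \<theta> powr (\<gamma> - 2) / (\<gamma> - 2) + \<theta> * (2 powr (\<gamma> - 1) / 4))" for \<theta>
    have "(b has_integral F pi - F 0) {0..pi}"
    proof (rule fundamental_theorem_of_calculus_interior)
      show "continuous_on {0..pi} F" unfolding F_def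
        using \<gamma> by (intro continuous_intros cpow) auto
      fix \<theta> assume \<theta>: "\<theta> \<in> {0<..<pi}"
      have "((\<lambda>\<theta>. s \<theta> powr (\<gamma> - 2) / (\<gamma> - 2)) has_real_derivative s \<theta> powr (\<gamma> - 3) * c \<theta>) (at \<theta>)"
        using DERIV_cdivide[OF dpow[OF \<theta>, of "\<gamma> - 2"], of "\<gamma> - 2"] \<gamma> by simp
      then have "(F has_real_derivative b \<theta>) (at \<theta>)"
        unfolding F_def[abs_def] b_def
        by (intro DERIV_cmult DERIV_add) (auto intro!: derivative_eq_intros)
      then show "(F has_vector_derivative b \<theta>) (at \<theta>)"
        by (simp add: has_real_derivative_iff_has_vector_derivative)
    qed simp
    moreover have "F pi - F 0 = I" using \<gamma> by (simp add: F_def I_def s_def)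
    ultimately show ?thesis by simp
  qed
  have I0: "I \<ge> 0" unfolding I_def using K0 \<gamma> by simp
  have bound: "3 * \<bar>r1 \<theta>\<bar> ^ 3 / (r \<theta>)\<^sup>2 + 3 * \<bar>r1 \<theta>\<bar> * \<bar>r2 \<theta>\<bar> / r \<theta> + \<bar>r3 \<theta>\<bar>
      \<le> K * (s \<theta> powr (\<gamma> - 3) * c \<theta> + 2 powr (\<gamma> - 1) / 4)" if \<theta>: "\<theta> \<in> {0<..<pi}" for \<theta>
  proof -
    define z where "z = s \<theta> powr (\<gamma> - 3)"
    define S where "S = s \<theta>"
    define q where "q = c \<theta>"
    have S: "S > 0" "S \<le> 2" using sp[OF \<theta>] s2 by (auto simp: S_def)
    have z: "z > 0" using S by (simp add: z_def S_def)
    have q: "0 \<le> q" "q \<le> 1" using cp[of \<theta>] \<theta> by (auto simp: q_def)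
    have qs: "q\<^sup>2 + S\<^sup>2 / 4 = 1" using cs by (simp add: q_def S_def)
    have p: "s \<theta> powr (\<gamma> - 2) = z * S" "s \<theta> powr (\<gamma> - 1) = z * S\<^sup>2" "s \<theta> powr \<gamma> = z * S ^ 3"
    proof -
      show "s \<theta> powr (\<gamma> - 2) = z * S" "s \<theta> powr (\<gamma> - 1) = z * S\<^sup>2" "s \<theta> powr \<gamma> = z * S ^ 3"
        using S unfolding z_def S_def
        by (simp_all add: powr_diff powr_numeral field_simps power2_eq_square power3_eq_cube)
    qed
    have R: "r \<theta> = z * S ^ 3" "r1 \<theta> = \<gamma> * (z * S\<^sup>2) * q"
      "r2 \<theta> = z * S * (\<gamma> * (\<gamma> - 1) * q\<^sup>2 - \<gamma> / 4 * S\<^sup>2)"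
      "r3 \<theta> = z * (\<gamma> * (\<gamma> - 1) * (\<gamma> - 2) * q ^ 3 - \<gamma> * (\<gamma> - 1) / 2 * S\<^sup>2 * q - \<gamma>\<^sup>2 / 4 * S\<^sup>2 * q)"
      unfolding r_def r1_def r2_def r3_def p z_def[symmetric] unfolding S_def[symmetric] q_def[symmetric]
      by (simp_all add: power2_eq_square power3_eq_cube algebra_simps)
    have S4: "S\<^sup>2 \<le> 4" using qs zero_le_power2[of q] by linarith
    have q3: "q ^ 3 \<le> 1" "q\<^sup>2 \<le> 1" using q by (auto intro: power_le_one)
    have 1: "\<bar>r1 \<theta>\<bar> ^ 3 / (r \<theta>)\<^sup>2 \<le> z * \<gamma> ^ 3"
    proof -
      have "\<bar>r1 \<theta>\<bar> ^ 3 / (r \<theta>)\<^sup>2 = z * \<gamma> ^ 3 * q ^ 3"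
        unfolding R using S z q \<gamma>
        by (simp add: abs_mult field_simps power2_eq_square power3_eq_cube)
      also have "\<dots> \<le> z * \<gamma> ^ 3 * 1" using q3 z \<gamma> by (intro mult_left_mono) auto
      finally show ?thesis by simp
    qed
    have r2b: "\<bar>\<gamma> * (\<gamma> - 1) * q\<^sup>2 - \<gamma> / 4 * S\<^sup>2\<bar> \<le> \<gamma> * (\<gamma> - 1) + \<gamma>"
    proof -
      have "0 \<le> \<gamma> * (\<gamma> - 1) * q\<^sup>2" "\<gamma> * (\<gamma> - 1) * q\<^sup>2 \<le> \<gamma> * (\<gamma> - 1) * 1"
        using q3 \<gamma> by (auto intro!: mult_left_mono)
      moreover have "0 \<le> \<gamma> / 4 * S\<^sup>2" "\<gamma> / 4 * S\<^sup>2 \<le> \<gamma> / 4 * 4" using \<gamma> S4 by (auto intro!: mult_left_mono)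
      ultimately show ?thesis by linarith
    qed
    have 2: "\<bar>r1 \<theta>\<bar> * \<bar>r2 \<theta>\<bar> / r \<theta> \<le> z * (\<gamma> * (\<gamma> * (\<gamma> - 1) + \<gamma>))"
    proof -
      have "\<bar>r2 \<theta>\<bar> = z * S * \<bar>\<gamma> * (\<gamma> - 1) * q\<^sup>2 - \<gamma> / 4 * S\<^sup>2\<bar>" "\<bar>r1 \<theta>\<bar> = \<gamma> * (z * S\<^sup>2) * q"
        unfolding R using S z q \<gamma> by (simp_all add: abs_mult)
      then have "\<bar>r1 \<theta>\<bar> * \<bar>r2 \<theta>\<bar> / r \<theta> = z * (\<gamma> * (q * \<bar>\<gamma> * (\<gamma> - 1) * q\<^sup>2 - \<gamma> / 4 * S\<^sup>2\<bar>))"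
        using S z by (simp only: R(1)) (simp add: power2_eq_square power3_eq_cube)
      also have "\<dots> \<le> z * (\<gamma> * (1 * (\<gamma> * (\<gamma> - 1) + \<gamma>)))"
        using r2b q z \<gamma> by (intro mult_left_mono mult_mono) auto
      finally show ?thesis by simp
    qed
    have 3: "\<bar>r3 \<theta>\<bar> \<le> z * (\<gamma> * (\<gamma> - 1) * (\<gamma> - 2) + 2 * \<gamma> * (\<gamma> - 1) + \<gamma>\<^sup>2)"
    proof -
      have a1: "0 \<le> \<gamma> * (\<gamma> - 1) * (\<gamma> - 2) * q ^ 3"
        "\<gamma> * (\<gamma> - 1) * (\<gamma> - 2) * q ^ 3 \<le> \<gamma> * (\<gamma> - 1) * (\<gamma> - 2) * 1"
        using q3 q \<gamma> by (auto intro!: mult_left_mono mult_nonneg_nonneg)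
      have sq: "S\<^sup>2 * q \<le> 4" "0 \<le> S\<^sup>2 * q" using mult_mono[OF S4 q(2)] q by auto
      have a2: "0 \<le> \<gamma> * (\<gamma> - 1) / 2 * (S\<^sup>2 * q)" "\<gamma> * (\<gamma> - 1) / 2 * (S\<^sup>2 * q) \<le> \<gamma> * (\<gamma> - 1) / 2 * 4"
        by (rule mult_nonneg_nonneg mult_left_mono sq | use \<gamma> in simp)+
      have a3: "0 \<le> \<gamma>\<^sup>2 / 4 * (S\<^sup>2 * q)" "\<gamma>\<^sup>2 / 4 * (S\<^sup>2 * q) \<le> \<gamma>\<^sup>2 / 4 * 4"
        by (rule mult_nonneg_nonneg mult_left_mono sq | use \<gamma> in simp)+
      have "\<bar>\<gamma> * (\<gamma> - 1) * (\<gamma> - 2) * q ^ 3 - \<gamma> * (\<gamma> - 1) / 2 * (S\<^sup>2 * q) - \<gamma>\<^sup>2 / 4 * (S\<^sup>2 * q)\<bar>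
         \<le> \<gamma> * (\<gamma> - 1) * (\<gamma> - 2) + 2 * \<gamma> * (\<gamma> - 1) + \<gamma>\<^sup>2"
        using a1 a2 a3 by linarith
      then show ?thesis unfolding R using z by (simp add: abs_mult mult.assoc)
    qed
    have "3 * \<bar>r1 \<theta>\<bar> ^ 3 / (r \<theta>)\<^sup>2 + 3 * \<bar>r1 \<theta>\<bar> * \<bar>r2 \<theta>\<bar> / r \<theta> + \<bar>r3 \<theta>\<bar> \<le> z * K"
    proof -
      have "z * K = 3 * (z * \<gamma> ^ 3) + 3 * (z * (\<gamma> * (\<gamma> * (\<gamma> - 1) + \<gamma>)))
         + z * (\<gamma> * (\<gamma> - 1) * (\<gamma> - 2) + 2 * \<gamma> * (\<gamma> - 1) + \<gamma>\<^sup>2)"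
        by (simp add: K_def algebra_simps)
      moreover have "3 * \<bar>r1 \<theta>\<bar> ^ 3 / (r \<theta>)\<^sup>2 = 3 * (\<bar>r1 \<theta>\<bar> ^ 3 / (r \<theta>)\<^sup>2)"
        "3 * \<bar>r1 \<theta>\<bar> * \<bar>r2 \<theta>\<bar> / r \<theta> = 3 * (\<bar>r1 \<theta>\<bar> * \<bar>r2 \<theta>\<bar> / r \<theta>)" by simp_all
      ultimately show ?thesis using 1 2 3 by linarith
    qed
    also have "\<dots> \<le> K * (z * q + 2 powr (\<gamma> - 1) / 4)"
    proof -
      \<comment> \<open>The part with \<open>q\<^sup>2\<close> keeps the factor needed for the
        primitive; the other part is a multiple of s^(\<gamma>-1), which is bounded.\<close>
      have "z = z * q\<^sup>2 + z * S\<^sup>2 / 4" using arg_cong[OF qs, of "(*) z"] by (simp add: distrib_left)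
      moreover have "z * q\<^sup>2 \<le> z * q"
        using q z by (intro mult_left_mono) (auto simp: power2_eq_square mult_left_le)
      moreover have "z * S\<^sup>2 \<le> 2 powr (\<gamma> - 1)"
        unfolding p(2)[symmetric] using S \<gamma> by (intro powr_mono2) (auto simp: S_def)
      ultimately have "z \<le> z * q + 2 powr (\<gamma> - 1) / 4" by linarith
      then show ?thesis using K0 by (simp add: mult.commute mult_left_mono)
    qed
    finally show ?thesis by (simp add: z_def q_def)
  qed
  show ?thesis
  proof (rule that[of I, OF I0])
    fix E :: real and k :: nat assume E: "E > 0" and k: "k \<ge> 1"
    define N where "N \<theta> = sqrt (E + (r \<theta>)\<^sup>2)" for \<theta>
    have Npos: "N \<theta> > 0" for \<theta> unfolding N_def using E by (simp add: add_pos_nonneg)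
    have N2: "(N \<theta>)\<^sup>2 = E + (r \<theta>)\<^sup>2" for \<theta> using E by (simp add: N_def add_nonneg_nonneg)
    define M where "M \<theta> = inverse (N \<theta>)" for \<theta>
    \<comment> \<open>This restates \<open>N\<^sup>2 = E + r\<^sup>2\<close>. It merges two
      contributions to the second derivative into \<open>E * M \<theta> ^ 3\<close>, the form for
      which a bound free of \<open>E\<close> is available.\<close>
    have ME: "M \<theta> = E * M \<theta> ^ 3 + (r \<theta>)\<^sup>2 * M \<theta> ^ 3" for \<theta>
    proof -
      have "(E + (r \<theta>)\<^sup>2) * M \<theta> ^ 3 = (N \<theta>)\<^sup>2 * M \<theta> ^ 3" using N2 by simp
      also have "\<dots> = M \<theta>" using Npos[of \<theta>]
        by (simp add: M_def field_simps power2_eq_square power3_eq_cube)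
      finally show ?thesis by (simp add: distrib_right)
    qed
    define h1 where "h1 \<theta> = sqrt 2 * (r \<theta> * M \<theta> * r1 \<theta>)" for \<theta>
    define h2 where "h2 \<theta> = sqrt 2 * (E * M \<theta> ^ 3 * (r1 \<theta>)\<^sup>2 + r \<theta> * M \<theta> * r2 \<theta>)" for \<theta>
    define h3 where "h3 \<theta> = sqrt 2 * (- 3 * E * r \<theta> * M \<theta> ^ 5 * r1 \<theta> ^ 3
       + 3 * (E * M \<theta> ^ 3) * r1 \<theta> * r2 \<theta> + r \<theta> * M \<theta> * r3 \<theta>)" for \<theta>
    have heq: "sqrt_energy \<gamma> E = (\<lambda>\<theta>. sqrt 2 * N \<theta>)"
      by (rule ext) (simp only: sqrt_energy_def N_def r_def s_def real_sqrt_mult)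
    have cN: "continuous_on {0..pi} N" unfolding N_def by (intro continuous_intros cr)
    have cM: "continuous_on {0..pi} M" unfolding M_def
      using Npos by (intro continuous_intros cN) (metis less_irrefl)
    have dN: "(N has_real_derivative r \<theta> * M \<theta> * r1 \<theta>) (at \<theta>)" if \<theta>: "\<theta> \<in> {0<..<pi}" for \<theta>
    proof -
      have "((\<lambda>\<theta>. E + (r \<theta>)\<^sup>2) has_real_derivative 2 * r \<theta> * r1 \<theta>) (at \<theta>)"
        by (auto intro!: derivative_eq_intros dr[OF \<theta>])
      then have "(N has_real_derivative inverse (sqrt (E + (r \<theta>)\<^sup>2)) / 2 * (2 * r \<theta> * r1 \<theta>)) (at \<theta>)"
        unfolding N_def[abs_def] using E
        by (intro DERIV_chain2[OF DERIV_real_sqrt]) (auto simp: add_pos_nonneg)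
      then show ?thesis by (simp add: M_def N_def mult_ac)
    qed
    have dM: "(M has_real_derivative - (M \<theta> ^ 3 * r \<theta> * r1 \<theta>)) (at \<theta>)" if \<theta>: "\<theta> \<in> {0<..<pi}" for \<theta>
      unfolding M_def[abs_def] using Npos[of \<theta>] DERIV_inverse_fun[OF dN[OF \<theta>]]
      by (simp add: M_def power2_eq_square power3_eq_cube mult_ac)
    show "\<bar>integral {0..pi} (\<lambda>\<theta>. sqrt_energy \<gamma> E \<theta> * cos (real k * \<theta>))\<bar> \<le> I / real k ^ 3"
    proof (rule cos_integral_by_parts[where ?h1.0 = h1 and ?h2.0 = h2 and ?h3.0 = h3 and b = b, OF k])
      show "continuous_on {0..pi} (sqrt_energy \<gamma> E)" unfolding heq by (intro continuous_intros cN)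
      show "continuous_on {0..pi} h1" "continuous_on {0..pi} h2" unfolding h1_def h2_def
        by (intro continuous_intros cM cr cr1 cr2)+
      show "h1 0 = 0" "h1 pi = 0" using \<gamma> by (auto simp: h1_def r1_def s_def c_def)
      show "(b has_integral I) {0..pi}" by (rule bint)
      fix \<theta> assume \<theta>: "\<theta> \<in> {0<..<pi}"
      show "(sqrt_energy \<gamma> E has_real_derivative h1 \<theta>) (at \<theta>)"
        unfolding heq h1_def by (intro DERIV_cmult dN \<theta>)
      have "(h1 has_real_derivative sqrt 2 * ((r1 \<theta> * M \<theta> + r \<theta> * (- (M \<theta> ^ 3 * r \<theta> * r1 \<theta>))) * r1 \<theta>
         + r \<theta> * M \<theta> * r2 \<theta>)) (at \<theta>)"
        unfolding h1_def[abs_def]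
        by (auto intro!: derivative_eq_intros dM[OF \<theta>] dr[OF \<theta>] dr1[OF \<theta>] simp: algebra_simps)
      moreover have "sqrt 2 * ((r1 \<theta> * M \<theta> + r \<theta> * (- (M \<theta> ^ 3 * r \<theta> * r1 \<theta>))) * r1 \<theta>
         + r \<theta> * M \<theta> * r2 \<theta>) = sqrt 2 * ((M \<theta> - (r \<theta>)\<^sup>2 * M \<theta> ^ 3) * (r1 \<theta>)\<^sup>2 + r \<theta> * M \<theta> * r2 \<theta>)"
        by (simp add: algebra_simps power2_eq_square)
      moreover have "M \<theta> - (r \<theta>)\<^sup>2 * M \<theta> ^ 3 = E * M \<theta> ^ 3" using ME[of \<theta>] by simp
      ultimately show "(h1 has_real_derivative h2 \<theta>) (at \<theta>)" unfolding h2_def by (simp only:)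
      have "(h2 has_real_derivative sqrt 2 * (E * (3 * (M \<theta>)\<^sup>2 * (- (M \<theta> ^ 3 * r \<theta> * r1 \<theta>))) * (r1 \<theta>)\<^sup>2
         + E * M \<theta> ^ 3 * (2 * r1 \<theta> * r2 \<theta>)
         + (r1 \<theta> * M \<theta> + r \<theta> * (- (M \<theta> ^ 3 * r \<theta> * r1 \<theta>))) * r2 \<theta> + r \<theta> * M \<theta> * r3 \<theta>)) (at \<theta>)"
        unfolding h2_def[abs_def]
        by (auto intro!: derivative_eq_intros dM[OF \<theta>] dr[OF \<theta>] dr1[OF \<theta>] dr2[OF \<theta>]
            simp: algebra_simps power2_eq_square)
      moreover have "sqrt 2 * (E * (3 * (M \<theta>)\<^sup>2 * (- (M \<theta> ^ 3 * r \<theta> * r1 \<theta>))) * (r1 \<theta>)\<^sup>2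
         + E * M \<theta> ^ 3 * (2 * r1 \<theta> * r2 \<theta>)
         + (r1 \<theta> * M \<theta> + r \<theta> * (- (M \<theta> ^ 3 * r \<theta> * r1 \<theta>))) * r2 \<theta> + r \<theta> * M \<theta> * r3 \<theta>) = sqrt 2 * (- 3 * E * r \<theta> * M \<theta> ^ 5 * r1 \<theta> ^ 3
         + 2 * (E * M \<theta> ^ 3) * r1 \<theta> * r2 \<theta> + (M \<theta> - (r \<theta>)\<^sup>2 * M \<theta> ^ 3) * r1 \<theta> * r2 \<theta> + r \<theta> * M \<theta> * r3 \<theta>)"
        by (simp add: algebra_simps power2_eq_square power3_eq_cube numeral_eq_Suc)
      moreover have "sqrt 2 * (- 3 * E * r \<theta> * M \<theta> ^ 5 * r1 \<theta> ^ 3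
         + 2 * (E * M \<theta> ^ 3) * r1 \<theta> * r2 \<theta> + (M \<theta> - (r \<theta>)\<^sup>2 * M \<theta> ^ 3) * r1 \<theta> * r2 \<theta> + r \<theta> * M \<theta> * r3 \<theta>) = h3 \<theta>"
        unfolding h3_def \<open>M \<theta> - (r \<theta>)\<^sup>2 * M \<theta> ^ 3 = E * M \<theta> ^ 3\<close> by (simp add: algebra_simps)
      ultimately show "(h2 has_real_derivative h3 \<theta>) (at \<theta>)" by (simp only:)
      have rp: "r \<theta> > 0" using sp[OF \<theta>] by (simp add: r_def)
      have "\<bar>h3 \<theta>\<bar> = sqrt 2 * \<bar>- 3 * E * r \<theta> / N \<theta> ^ 5 * r1 \<theta> ^ 3
       + 3 * (E / N \<theta> ^ 3) * r1 \<theta> * r2 \<theta> + r \<theta> / N \<theta> * r3 \<theta>\<bar>"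
        by (simp add: h3_def abs_mult M_def divide_inverse power_inverse)
      also have "\<dots> \<le> sqrt 2 * (3 * \<bar>r1 \<theta>\<bar> ^ 3 / (r \<theta>)\<^sup>2 + 3 * \<bar>r1 \<theta>\<bar> * \<bar>r2 \<theta>\<bar> / r \<theta> + \<bar>r3 \<theta>\<bar>)"
        by (intro mult_left_mono norm_sqrt_chain_bound[OF E rp]) (auto simp: N_def)
      also have "\<dots> \<le> sqrt 2 * (K * (s \<theta> powr (\<gamma> - 3) * c \<theta> + 2 powr (\<gamma> - 1) / 4))"
        by (intro mult_left_mono bound[OF \<theta>]) simp
      finally show "\<bar>h3 \<theta>\<bar> \<le> b \<theta>" by (simp add: b_def)
    qed
  qed
qed

lemma continuous_on_sqrt_energy:
  assumes "\<gamma> > 0" "E \<ge> 0" shows "continuous_on {0..pi} (sqrt_energy \<gamma> E)"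
  unfolding sqrt_energy_def[abs_def]
  by (intro continuous_intros continuous_on_half_sine_powr assms)


text \<open>Only E = 0 is new; there the function is a uniform limit, at distance at most sqrt(2E)
  from the one at energy E.\<close>

lemma cos_coeff_sqrt_energy:
  assumes \<gamma>: "\<gamma> > 2"
  obtains A where "A \<ge> 0" "\<And>E k. E \<ge> 0 \<Longrightarrow> k \<ge> 1 \<Longrightarrow>
    \<bar>integral {0..pi} (\<lambda>\<theta>. sqrt_energy \<gamma> E \<theta> * cos (real k * \<theta>))\<bar> \<le> A / real k ^ 3"
proof -
  obtain A where A: "A \<ge> 0" "\<And>E k. E > 0 \<Longrightarrow> k \<ge> 1 \<Longrightarrow>
    \<bar>integral {0..pi} (\<lambda>\<theta>. sqrt_energy \<gamma> E \<theta> * cos (real k * \<theta>))\<bar> \<le> A / real k ^ 3"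
    using cos_coeff_sqrt_energy_pos[OF \<gamma>] by blast
  have cont: "continuous_on {0..pi} (sqrt_energy \<gamma> E)" if "E \<ge> 0" for E
    using continuous_on_sqrt_energy that \<gamma> by simp
  have "\<bar>integral {0..pi} (\<lambda>\<theta>. sqrt_energy \<gamma> 0 \<theta> * cos (real k * \<theta>))\<bar> \<le> A / real k ^ 3" if k: "k \<ge> 1" for k
  proof (rule field_le_epsilon)
    fix e :: real assume e: "e > 0"
    \<comment> \<open>Chosen so that \<open>sqrt (2 * E) = e / pi\<close>, which integrates to
      \<open>e\<close>.\<close>
    define E where "E = (e / pi)\<^sup>2 / 2"
    have E: "E > 0" using e by (simp add: E_def)
    have sE: "sqrt (2 * E) = e / pi" using e by (simp add: E_def)
    have int: "(\<lambda>\<theta>. sqrt_energy \<gamma> E \<theta> * cos (real k * \<theta>)) integrable_on {0..pi}" if "E \<ge> 0" for E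
      by (intro integrable_continuous_real continuous_intros cont that)
    have "norm (integral {0..pi} (\<lambda>\<theta>. sqrt_energy \<gamma> 0 \<theta> * cos (real k * \<theta>) - sqrt_energy \<gamma> E \<theta> * cos (real k * \<theta>)))
       \<le> integral {0..pi} (\<lambda>_. e / pi)"
    proof (rule integral_norm_bound_integral)
      show "(\<lambda>\<theta>. sqrt_energy \<gamma> 0 \<theta> * cos (real k * \<theta>) - sqrt_energy \<gamma> E \<theta> * cos (real k * \<theta>)) integrable_on {0..pi}"
        using E by (intro integrable_diff int) auto
      fix \<theta>
      define R where "R = 2 * ((2 * sin (\<theta> / 2)) powr \<gamma>)\<^sup>2"
      have R: "R \<ge> 0" by (simp add: R_def)
      have "sqrt_energy \<gamma> 0 \<theta> = sqrt R" "sqrt_energy \<gamma> E \<theta> = sqrt (2 * E + R)"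
        by (simp_all add: sqrt_energy_def R_def distrib_left)
      moreover have "sqrt R \<le> sqrt (2 * E + R)" "sqrt (2 * E + R) \<le> sqrt (2 * E) + sqrt R"
        using E R by (auto intro!: sqrt_add_le_add_sqrt)
      ultimately have "\<bar>sqrt_energy \<gamma> 0 \<theta> - sqrt_energy \<gamma> E \<theta>\<bar> \<le> e / pi"
        using sE by linarith
      then have "\<bar>sqrt_energy \<gamma> 0 \<theta> - sqrt_energy \<gamma> E \<theta>\<bar> * \<bar>cos (real k * \<theta>)\<bar> \<le> e / pi * 1"
        by (intro mult_mono) auto
      then show "norm (sqrt_energy \<gamma> 0 \<theta> * cos (real k * \<theta>) - sqrt_energy \<gamma> E \<theta> * cos (real k * \<theta>)) \<le> e / pi"
        by (simp add: left_diff_distrib[symmetric] abs_mult)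
    qed auto
    also have "\<dots> = e" by simp
    finally have "\<bar>integral {0..pi} (\<lambda>\<theta>. sqrt_energy \<gamma> 0 \<theta> * cos (real k * \<theta>))
      - integral {0..pi} (\<lambda>\<theta>. sqrt_energy \<gamma> E \<theta> * cos (real k * \<theta>))\<bar> \<le> e"
      using E by (subst (asm) integral_diff) (auto intro: int)
    then show "\<bar>integral {0..pi} (\<lambda>\<theta>. sqrt_energy \<gamma> 0 \<theta> * cos (real k * \<theta>))\<bar> \<le> A / real k ^ 3 + e"
      using A(2)[OF E k] by linarith
  qed
  note zero = this
  show ?thesis
  proof (rule that[of A, OF A(1)])
    fix E :: real and k :: nat assume "E \<ge> 0" "k \<ge> 1"
    then show "\<bar>integral {0..pi} (\<lambda>\<theta>. sqrt_energy \<gamma> E \<theta> * cos (real k * \<theta>))\<bar> \<le> A / real k ^ 3"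
      using zero A(2) by (cases "E = 0") auto
  qed
qed

section \<open>The potential along the orbit: discrepancy and recurrence\<close>

lemma ex_antiderivative:
  fixes f :: "real \<Rightarrow> real"
  assumes "continuous_on UNIV f"
  obtains F where "\<And>x. (F has_real_derivative f x) (at x)"
proof
  fix x :: real
  define a b where "a = - \<bar>x\<bar> - 1" and "b = \<bar>x\<bar> + 1"
  have "((\<lambda>u. LBINT y=ereal 0..ereal u. f y) has_vector_derivative f x) (at x within {a..b})"
    by (rule interval_integral_FTC2) (auto simp: a_def b_def intro: continuous_on_subset[OF assms])
  moreover have "at x within {a..b} = at x"
    by (rule at_within_interior) (auto simp: a_def b_def)
  ultimately show "((\<lambda>u. LBINT y=ereal 0..ereal u. f y) has_real_derivative f x) (at x)"
    by (simp add: has_real_derivative_iff_has_vector_derivative)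
qed

text \<open>The l1 norm dominates the Euclidean norm, so its negative power is smaller and the given
  inequality survives; 2 pi goes into the constant.\<close>

lemma diophantine_pair_orbit:
  assumes "diophantine_index \<xi> \<sigma>"
  obtains c where "diophantine_pair (2 * pi * \<xi> $ 1) (2 * pi * \<xi> $ 2) c \<sigma>"
proof -
  from assms obtain C where \<sigma>: "\<sigma> > 0" and C: "C > 0"
    and D: "\<And>\<kappa> :: real ^ 2. (\<forall>i. \<kappa> $ i \<in> \<int>) \<Longrightarrow> \<kappa> \<noteq> 0 \<Longrightarrow> \<bar>\<xi> \<bullet> \<kappa>\<bar> \<ge> C * norm \<kappa> powr (- \<sigma>)"
    unfolding diophantine_index_def by auto
  have "diophantine_pair (2 * pi * \<xi> $ 1) (2 * pi * \<xi> $ 2) (2 * pi * C) \<sigma>"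
  proof
    fix i j :: int assume ij: "(i, j) \<noteq> (0, 0)"
    define \<kappa> :: "real ^ 2" where "\<kappa> = vector [of_int i, of_int j]"
    have k: "\<kappa> $ 1 = of_int i" "\<kappa> $ 2 = of_int j" by (simp_all add: \<kappa>_def)
    have kz: "\<forall>i. \<kappa> $ i \<in> \<int>" using k by (simp add: forall_2)
    have kn: "\<kappa> \<noteq> 0" using ij k by (auto simp: vec_eq_iff forall_2)
    have "norm \<kappa> \<le> \<bar>of_int i\<bar> + \<bar>of_int j\<bar>"
      using norm_le_l1_cart[of \<kappa>] k by (simp add: sum_2)
    then have "(\<bar>of_int i\<bar> + \<bar>of_int j\<bar>) powr (- \<sigma>) \<le> norm \<kappa> powr (- \<sigma>)"
      using \<sigma> kn by (intro powr_mono2') auto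
    then have "C * (\<bar>of_int i\<bar> + \<bar>of_int j\<bar>) powr (- \<sigma>) \<le> C * norm \<kappa> powr (- \<sigma>)"
      using C by (intro mult_left_mono) auto
    also have "\<dots> \<le> \<bar>\<xi> \<bullet> \<kappa>\<bar>" by (rule D[OF kz kn])
    also have "\<xi> \<bullet> \<kappa> = \<xi> $ 1 * of_int i + \<xi> $ 2 * of_int j"
      by (simp add: inner_vec_def sum_2 k)
    finally have "2 * pi * (C * (\<bar>of_int i\<bar> + \<bar>of_int j\<bar>) powr (- \<sigma>)) \<le>
       2 * pi * \<bar>\<xi> $ 1 * of_int i + \<xi> $ 2 * of_int j\<bar>" by (intro mult_left_mono) auto
    also have "\<dots> = \<bar>of_int i * (2 * pi * \<xi> $ 1) + of_int j * (2 * pi * \<xi> $ 2)\<bar>"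
    proof -
      have "of_int i * (2 * pi * \<xi> $ 1) + of_int j * (2 * pi * \<xi> $ 2) =
        (2 * pi) * (\<xi> $ 1 * of_int i + \<xi> $ 2 * of_int j)" by (simp add: algebra_simps)
      then show ?thesis by (simp only: abs_mult) simp
    qed
    finally show "2 * pi * C * (\<bar>of_int i\<bar> + \<bar>of_int j\<bar>) powr (- \<sigma>) \<le>
      \<bar>of_int i * (2 * pi * \<xi> $ 1) + of_int j * (2 * pi * \<xi> $ 2)\<bar>" by (simp add: mult.assoc)
  qed (use C \<sigma> in auto)
  then show ?thesis by (rule that)
qed

lemma potential_range: "\<gamma> > 0 \<Longrightarrow> 0 \<le> potential \<gamma> x \<and> potential \<gamma> x \<le> 4 powr \<gamma>"
  unfolding potential_def
  using sin_ge_minus_one[of "2 * pi * x $ 1"] sin_ge_minus_one[of "2 * pi * x $ 2"]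
    sin_le_one[of "2 * pi * x $ 1"] sin_le_one[of "2 * pi * x $ 2"]
  by (auto intro!: powr_mono2 simp del: sin_ge_minus_one sin_le_one)

lemma continuous_potential_line:
  "\<gamma> > 0 \<Longrightarrow> continuous_on UNIV (\<lambda>t. potential \<gamma> (t *\<^sub>R \<xi>))"
  unfolding potential_def
  by (intro continuous_on_powr' continuous_intros) (auto intro!: add_mono simp: algebra_simps intro: order_trans[OF add_mono[OF sin_le_one sin_le_one]])

text \<open>The shift of phase turns the cosines into the sines of the potential, whose base becomes
  2 - 2 cos a = 4 sin^2(a/2) with a the \<open>arccos\<close>.\<close>

lemma energy_along_orbit:
  fixes \<xi> :: "real ^ 2"
  assumes \<gamma>: "\<gamma> > 0"
  shows "sqrt (2 * (E + potential \<gamma> (t *\<^sub>R \<xi>))) = sqrt_energy \<gamma> E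
     (arccos ((cos (2 * pi * \<xi> $ 1 * t + - (pi / 2)) + cos (2 * pi * \<xi> $ 2 * t + - (pi / 2))) / 2))"
proof -
  define c where "c = (cos (2 * pi * \<xi> $ 1 * t + - (pi / 2)) + cos (2 * pi * \<xi> $ 2 * t + - (pi / 2))) / 2"
  have c1: "\<bar>c\<bar> \<le> 1" unfolding c_def by (rule abs_half_cos_sum)
  have c2: "2 * c = sin (2 * pi * (\<xi> $ 1 * t)) + sin (2 * pi * (\<xi> $ 2 * t))"
    by (simp add: c_def cos_sin_eq algebra_simps cos_add)
  define a where "a = arccos c"
  have a: "cos a = c" "0 \<le> a" "a \<le> pi" using c1 by (auto simp: a_def abs_le_iff arccos_lbound arccos_ubound)
  have s: "sin (a / 2) \<ge> 0" using a by (intro sin_ge_zero) auto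
  have "(2 * sin (a / 2))\<^sup>2 = 2 - 2 * c"
    using cos_double_sin[of "a / 2"] a by (simp add: power_mult_distrib)
  then have e: "2 - sin (2 * pi * (\<xi> $ 1 * t)) - sin (2 * pi * (\<xi> $ 2 * t)) = (2 * sin (a / 2))\<^sup>2"
    using c2 by simp
  have "potential \<gamma> (t *\<^sub>R \<xi>) = ((2 * sin (a / 2)) powr \<gamma>)\<^sup>2"
  proof -
    have "potential \<gamma> (t *\<^sub>R \<xi>) = ((2 * sin (a / 2))\<^sup>2) powr \<gamma>"
      using e by (simp add: potential_def mult_ac)
    also have "\<dots> = ((2 * sin (a / 2)) powr \<gamma>)\<^sup>2"
      unfolding power2_eq_square by (rule powr_mult)
    finally show ?thesis .
  qed
  then show ?thesis unfolding sqrt_energy_def c_def[symmetric] a_def[symmetric] by simp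
qed

lemma energy_discrepancy:
  fixes \<xi> :: "real ^ 2"
  assumes \<gamma>: "\<gamma> > 2" and D: "diophantine_index \<xi> \<sigma>" and \<sigma>: "\<sigma> < 2"
  obtains C where "C \<ge> 0" "\<And>E F. E \<ge> 0 \<Longrightarrow>
     (\<And>t. (F has_real_derivative sqrt (2 * (E + potential \<gamma> (t *\<^sub>R \<xi>)))) (at t)) \<Longrightarrow>
     \<exists>m. \<forall>a b. \<bar>F b - F a - m * (b - a)\<bar> \<le> C"
proof -
  obtain c where dp: "diophantine_pair (2 * pi * \<xi> $ 1) (2 * pi * \<xi> $ 2) c \<sigma>"
    using diophantine_pair_orbit[OF D] by blast
  obtain A where A: "A \<ge> 0" "\<And>E k. E \<ge> 0 \<Longrightarrow> k \<ge> 1 \<Longrightarrow>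
    \<bar>integral {0..pi} (\<lambda>\<theta>. sqrt_energy \<gamma> E \<theta> * cos (real k * \<theta>))\<bar> \<le> A / real k ^ 3"
    using cos_coeff_sqrt_energy[OF \<gamma>] by blast
  show thesis
  proof (rule diophantine_pair.orbit_discrepancy[OF dp \<sigma>, where \<beta> = "- (pi / 2)"])
    fix C assume C: "C \<ge> 0" and
    CC: "\<And>h A F. continuous_on {0..pi} h \<Longrightarrow> A \<ge> 0 \<Longrightarrow>
       (\<And>k. k \<ge> 1 \<Longrightarrow> \<bar>integral {0..pi} (\<lambda>\<theta>. h \<theta> * cos (real k * \<theta>))\<bar> \<le> A / real k ^ 3) \<Longrightarrow>
       (\<And>t. (F has_real_derivative h (arccos ((cos (2 * pi * \<xi> $ 1 * t + - (pi / 2)) + cos (2 * pi * \<xi> $ 2 * t + - (pi / 2))) / 2))) (at t)) \<Longrightarrow>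
       \<exists>m. \<forall>a b. \<bar>F b - F a - m * (b - a)\<bar> \<le> C * A"
    show thesis
    proof (rule that[of "C * A"])
      show "C * A \<ge> 0" using C A by simp
      fix E F
      assume E: "E \<ge> 0" and F: "\<And>t. (F has_real_derivative sqrt (2 * (E + potential \<gamma> (t *\<^sub>R \<xi>)))) (at t)"
      show "\<exists>m. \<forall>a b. \<bar>F b - F a - m * (b - a)\<bar> \<le> C * A"
      proof (rule CC[of "sqrt_energy \<gamma> E"])
        show "continuous_on {0..pi} (sqrt_energy \<gamma> E)" using \<gamma> E by (intro continuous_on_sqrt_energy) auto
        fix t
        show "(F has_real_derivative sqrt_energy \<gamma> E (arccos ((cos (2 * pi * \<xi> $ 1 * t + - (pi / 2)) + cos (2 * pi * \<xi> $ 2 * t + - (pi / 2))) / 2))) (at t)"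
          using F[of t] \<gamma> by (simp only: energy_along_orbit)
      qed (use A E in auto)
    qed
  qed
qed

text \<open>The mean of the peak polynomial is at least of order n^-2, so over a time of order n^4
  the bounded discrepancy cannot hide it and a value of that order is taken. A 2n-th power of 1 -
  s/4 of that size forces s = O(log n / n), hence V = s^\<gamma> = O(n^-2), the logarithm being
  absorbed because \<gamma> > 2.\<close>

lemma potential_recurrence:
  fixes \<xi> :: "real ^ 2"
  assumes \<gamma>: "\<gamma> > 2" and D: "diophantine_index \<xi> \<sigma>" and \<sigma>: "\<sigma> < 2"
  obtains R where "R > 0" "\<And>(n::nat) a. n \<ge> 1 \<Longrightarrow>
     \<exists>t\<in>{a..a + R * real n ^ 4}. potential \<gamma> (t *\<^sub>R \<xi>) \<le> R / (real n)\<^sup>2"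
proof -
  obtain c where dp: "diophantine_pair (2 * pi * \<xi> $ 1) (2 * pi * \<xi> $ 2) c \<sigma>"
    using diophantine_pair_orbit[OF D] by blast
  then have c: "c > 0" by (simp add: diophantine_pair_def)
  define M where "M = 2 / c * 8 powr \<sigma>"
  have M: "M > 0" using c by (simp add: M_def)
  \<comment> \<open>Solves \<open>(\<beta> - 1) * \<gamma> = - 2\<close>; the logarithm is bounded
    by a multiple of \<open>N powr \<beta>\<close>.\<close>
  define \<beta> where "\<beta> = (\<gamma> - 2) / \<gamma>"
  have \<beta>: "\<beta> > 0" using \<gamma> by (simp add: \<beta>_def)
  define L where "L = 2 * (ln 18 + 2 / \<beta>)"
  have L: "L > 0" using \<beta> by (simp add: L_def add_pos_pos)
  define R where "R = max (36 * M) (L powr \<gamma>)"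
  have R: "R > 0" "36 * M \<le> R" "L powr \<gamma> \<le> R" using M by (auto simp: R_def)
  have main: "\<exists>t\<in>{a..a + R * real n ^ 4}. potential \<gamma> (t *\<^sub>R \<xi>) \<le> R / (real n)\<^sup>2" if n: "n \<ge> 1" for n :: nat and a
  proof -
    define s where "s t = 2 - sin (2 * pi * (\<xi> $ 1 * t)) - sin (2 * pi * (\<xi> $ 2 * t))" for t
    have s: "0 \<le> s t" "s t \<le> 4" for t
      unfolding s_def using sin_ge_minus_one[of "2 * pi * (\<xi> $ 1 * t)"] sin_ge_minus_one[of "2 * pi * (\<xi> $ 2 * t)"]
        sin_le_one[of "2 * pi * (\<xi> $ 1 * t)"] sin_le_one[of "2 * pi * (\<xi> $ 2 * t)"] by linarith+
    have ps: "potential \<gamma> (t *\<^sub>R \<xi>) = s t powr \<gamma>" for t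
      by (simp add: potential_def s_def mult_ac)
    have se: "(2 + (cos (2 * pi * \<xi> $ 1 * t + - (pi / 2)) + cos (2 * pi * \<xi> $ 2 * t + - (pi / 2)))) / 4 = 1 - s t / 4" for t
    proof -
      have "cos (a + - (pi / 2)) = sin a" for a by (simp add: cos_diff)
      then show ?thesis by (simp only: s_def mult.assoc) (simp add: field_simps)
    qed
    obtain P m where P: "\<And>t. (P has_real_derivative (1 - s t / 4) ^ (2 * n)) (at t)"
      and Pm: "\<And>t. \<bar>P t - m * t\<bar> \<le> 2 / c * (8 * real n) powr \<sigma>" and m: "m \<ge> 1 / (2 * real n + 1)\<^sup>2"
      by (rule diophantine_pair.peak_primitive[OF dp n, where \<beta> = "- (pi / 2)", unfolded se], rule that)
    define N where "N = real n"
    have N: "N \<ge> 1" using n by (simp add: N_def)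
    have "N powr \<sigma> \<le> N powr 2" using N \<sigma> by (intro powr_mono) auto
    then have "(8 * N) powr \<sigma> \<le> 8 powr \<sigma> * N\<^sup>2"
      using N by (simp add: powr_mult)
    then have Pm': "\<bar>P t - m * t\<bar> \<le> M * N\<^sup>2" for t
    proof -
      have "2 / c * (8 * N) powr \<sigma> \<le> 2 / c * (8 powr \<sigma> * N\<^sup>2)"
        using \<open>(8 * N) powr \<sigma> \<le> 8 powr \<sigma> * N\<^sup>2\<close> c by (intro mult_left_mono) auto
      then show ?thesis using Pm[of t] by (simp add: M_def N_def mult.assoc)
    qed
    have m': "m \<ge> 1 / (9 * N\<^sup>2)"
    proof -
      have "(2 * N + 1)\<^sup>2 \<le> (3 * N)\<^sup>2" using N by (intro power_mono) auto
      then have "1 / (9 * N\<^sup>2) \<le> 1 / (2 * N + 1)\<^sup>2"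
        using N by (intro divide_left_mono) (auto simp: power_mult_distrib)
      then show ?thesis using m by (simp add: N_def)
    qed
    \<comment> \<open>Over this length the mean contributes at least 4MN^2, twice the discrepancy
      2MN^2 of the two ends; what remains is d/(18N^2).\<close>
    define d where "d = 36 * M * N ^ 4"
    have d: "d > 0" using M N by (simp add: d_def)
    obtain t where t: "a < t" "t < a + d" "P (a + d) - P a = (a + d - a) * (1 - s t / 4) ^ (2 * n)"
      using MVT2[of a "a + d" P "\<lambda>t. (1 - s t / 4) ^ (2 * n)"] P d by auto
    have "d * (1 - s t / 4) ^ (2 * n) \<ge> m * d - 2 * (M * N\<^sup>2)"
    proof -
      have "P (a + d) - P a \<ge> m * (a + d) - m * a - 2 * (M * N\<^sup>2)"
        using Pm'[of "a + d"] Pm'[of a] by linarith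
      then show ?thesis using t(3) by (simp add: algebra_simps)
    qed
    moreover have "m * d \<ge> 1 / (9 * N\<^sup>2) * d" using m' d by (intro mult_right_mono) auto
    moreover have "1 / (9 * N\<^sup>2) * d - 2 * (M * N\<^sup>2) = d * (1 / (18 * N\<^sup>2))"
      using N by (simp add: d_def field_simps power2_eq_square power4_eq_xxxx)
    ultimately have "d * (1 / (18 * N\<^sup>2)) \<le> d * (1 - s t / 4) ^ (2 * n)" by linarith
    then have "1 / (18 * N\<^sup>2) \<le> (1 - s t / 4) ^ (2 * n)" using d by (simp only: mult_le_cancel_left_pos)
    also have "\<dots> \<le> exp (- s t / 4) ^ (2 * n)"
      using s[of t] exp_ge_add_one_self[of "- s t / 4"] by (intro power_mono) auto
    also have "\<dots> = exp (- (N * s t / 2))"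
      by (simp add: N_def exp_of_nat_mult[symmetric])
    finally have "ln (1 / (18 * N\<^sup>2)) \<le> ln (exp (- (N * s t / 2)))"
      using N by (subst ln_le_cancel_iff) auto
    then have "ln (1 / (18 * N\<^sup>2)) \<le> - (N * s t / 2)" by simp
    moreover have "ln (1 / (18 * N\<^sup>2)) = - (ln 18 + 2 * ln N)"
      using N by (simp add: ln_div ln_mult ln_realpow)
    ultimately have b: "N * s t \<le> 2 * (ln 18 + 2 * ln N)" by simp
    have "ln N \<le> N powr \<beta> / \<beta>" using N \<beta> by (rule ln_powr_bound)
    moreover have "ln 18 * 1 \<le> ln 18 * N powr \<beta>" using N \<beta> by (intro mult_left_mono ge_one_powr_ge_zero) auto
    ultimately have "2 * (ln 18 + 2 * ln N) \<le> L * N powr \<beta>"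
    proof -
      have "L * N powr \<beta> = 2 * (ln 18 * N powr \<beta>) + 4 * (N powr \<beta> / \<beta>)"
        by (simp add: L_def algebra_simps)
      moreover have "2 * (a + 2 * b) \<le> 2 * x + 4 * y" if "b \<le> y" "a * 1 \<le> x" for a b x y :: real
        using that by (simp add: distrib_left add_mono)
      ultimately show ?thesis
        using \<open>ln N \<le> N powr \<beta> / \<beta>\<close> \<open>ln 18 * 1 \<le> ln 18 * N powr \<beta>\<close> by (simp only:)
    qed
    with b have "N * s t \<le> L * N powr \<beta>" by simp
    then have "s t \<le> L * N powr (\<beta> - 1)" using N by (simp add: powr_diff field_simps)
    then have "s t powr \<gamma> \<le> (L * N powr (\<beta> - 1)) powr \<gamma>" using s[of t] \<gamma> by (intro powr_mono2) auto
    also have "\<dots> = L powr \<gamma> * N powr ((\<beta> - 1) * \<gamma>)" using L by (simp add: powr_mult powr_powr)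
    also have "(\<beta> - 1) * \<gamma> = - 2" using \<gamma> by (simp add: \<beta>_def field_simps)
    also have "N powr (- 2) = 1 / N\<^sup>2" using N by (simp add: powr_minus divide_inverse)
    finally have "potential \<gamma> (t *\<^sub>R \<xi>) \<le> L powr \<gamma> / N\<^sup>2" by (simp add: ps)
    also have "\<dots> \<le> R / N\<^sup>2" using R by (intro divide_right_mono) auto
    finally have "potential \<gamma> (t *\<^sub>R \<xi>) \<le> R / N\<^sup>2" .
    moreover have "t \<in> {a..a + R * N ^ 4}"
    proof -
      have "d \<le> R * N ^ 4" unfolding d_def using R N by (intro mult_right_mono) auto
      then show ?thesis using t by simp
    qed
    ultimately show ?thesis unfolding N_def by blast
  qed
  show ?thesis by (rule that[OF R(1) main])
qed

subsection \<open>Mean slopes and the effective Hamiltonian\<close>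

lemma coercive_attains_max:
  fixes f :: "real \<Rightarrow> real"
  assumes "continuous_on UNIV f" "\<And>x. \<bar>x - x0\<bar> > R \<Longrightarrow> f x \<le> f x0"
  obtains y where "\<And>x. f x \<le> f y"
proof -
  define R' where "R' = max R 0"
  have "continuous_on {x0 - R'..x0 + R'} f" using assms(1) continuous_on_subset by blast
  then obtain y where y: "y \<in> {x0 - R'..x0 + R'}" "\<And>x. x \<in> {x0 - R'..x0 + R'} \<Longrightarrow> f x \<le> f y"
    using continuous_attains_sup[of "{x0 - R'..x0 + R'}" f] by (auto simp: R'_def)
  have "f x \<le> f y" for x
  proof (cases "\<bar>x - x0\<bar> > R")
    case True
    have "f x0 \<le> f y" by (rule y(2)) (simp add: R'_def)
    then show ?thesis using assms(2)[OF True] by simp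
  next
    case False
    then show ?thesis by (intro y(2)) (auto simp: R'_def abs_le_iff)
  qed
  then show ?thesis by (rule that)
qed

lemma derivative_at_touching_max:
  fixes f :: "real \<Rightarrow> real"
  assumes "(f has_real_derivative D) (at y)" "\<forall>\<^sub>F z in nhds y. f z \<le> f y"
  shows "D = 0"
proof -
  obtain d where d: "d > 0" "\<And>z. dist z y < d \<Longrightarrow> f z \<le> f y"
    using assms(2) unfolding eventually_nhds_metric by blast
  show ?thesis
    by (rule DERIV_local_max[OF assms(1) d(1)]) (auto intro!: d(2) simp: dist_real_def abs_minus_commute)
qed

lemma C1_onI_real:
  fixes \<phi> :: "real \<Rightarrow> real"
  assumes "\<And>x. (\<phi> has_real_derivative D x) (at x)" "continuous_on UNIV D"
  shows "C1_on UNIV \<phi> D"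
  using assms unfolding C1_on_def by simp

lemma C1_onD_real:
  fixes \<phi> :: "real \<Rightarrow> real"
  assumes "C1_on UNIV \<phi> D" shows "(\<phi> has_real_derivative D x) (at x)"
  using assms unfolding C1_on_def by simp

lemma DERIV_continuous_on_UNIV:
  fixes f :: "real \<Rightarrow> real"
  assumes "\<And>x. (f has_real_derivative f' x) (at x)" shows "continuous_on UNIV f"
  using assms by (meson DERIV_isCont continuous_at_imp_continuous_on)

lemma classical_subsolution:
  fixes w :: "real \<Rightarrow> real"
  assumes "\<And>x. (w has_real_derivative w' x) (at x)" "\<And>x. F x (w' x) \<le> 0"
  shows "viscosity_subsolution UNIV F w"
  unfolding viscosity_subsolution_def
proof (intro conjI allI impI ballI)
  show "continuous_on UNIV w" using assms(1) by (rule DERIV_continuous_on_UNIV)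
  fix \<phi> D y
  assume "C1_on UNIV \<phi> D" and m: "\<forall>\<^sub>F z in nhds y. w z - \<phi> z \<le> w y - \<phi> y"
  then have "((\<lambda>z. w z - \<phi> z) has_real_derivative w' y - D y) (at y)"
    using assms(1) C1_onD_real by (intro DERIV_diff)
  from derivative_at_touching_max[OF this m] show "F y (D y) \<le> 0" using assms(2)[of y] by simp
qed

lemma classical_supersolution:
  fixes w :: "real \<Rightarrow> real"
  assumes "\<And>x. (w has_real_derivative w' x) (at x)" "\<And>x. F x (w' x) \<ge> 0"
  shows "viscosity_supersolution UNIV F w"
  unfolding viscosity_supersolution_def
proof (intro conjI allI impI ballI)
  show "continuous_on UNIV w" using assms(1) by (rule DERIV_continuous_on_UNIV)
  fix \<phi> D y
  assume "C1_on UNIV \<phi> D" and m: "\<forall>\<^sub>F z in nhds y. w z - \<phi> z \<ge> w y - \<phi> y"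
  then have "((\<lambda>z. \<phi> z - w z) has_real_derivative D y - w' y) (at y)"
    using assms(1) C1_onD_real by (intro DERIV_diff)
  moreover have "\<forall>\<^sub>F z in nhds y. \<phi> z - w z \<le> \<phi> y - w y"
    using m by (rule eventually_mono) simp
  ultimately have "D y - w' y = 0" by (rule derivative_at_touching_max)
  then show "F y (D y) \<ge> 0" using assms(2)[of y] by simp
qed

lemma bounded_Lipschitz_in_BUC_Lip:
  assumes "\<And>x. \<bar>w x\<bar> \<le> B" "\<And>x y. \<bar>w x - w y\<bar> \<le> L * \<bar>x - y\<bar>" "L \<ge> 0"
  shows "w \<in> BUC \<inter> Lip"
proof -
  have l: "L-lipschitz_on UNIV w" using assms by (intro lipschitz_onI) (auto simp: dist_real_def)
  have "bounded (range w)" using assms(1) by (auto simp: bounded_iff)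
  then show ?thesis using l lipschitz_on_uniformly_continuous[OF l] unfolding BUC_def Lip_def by auto
qed

lemma Lipschitz_of_derivative_bound:
  fixes f :: "real \<Rightarrow> real"
  assumes "\<And>x. (f has_real_derivative f' x) (at x)" "\<And>x. \<bar>f' x\<bar> \<le> L"
  shows "\<bar>f x - f y\<bar> \<le> L * \<bar>x - y\<bar>"
proof -
  have *: "\<bar>f x - f y\<bar> \<le> L * \<bar>x - y\<bar>" if xy: "x < y" for x y
  proof -
    obtain z where "f y - f x = (y - x) * f' z" using MVT2[OF xy] assms(1) by blast
    then have "\<bar>f x - f y\<bar> = \<bar>y - x\<bar> * \<bar>f' z\<bar>" by (metis abs_minus_commute abs_mult)
    also have "\<dots> \<le> \<bar>y - x\<bar> * L" using assms(2) by (intro mult_left_mono) auto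
    finally show ?thesis by (simp add: mult.commute abs_minus_commute)
  qed
  show ?thesis using *[of x y] *[of y x] by (cases x y rule: linorder_cases) (auto simp: abs_minus_commute)
qed

text \<open>Monotonicity, concavity and continuity of the mean slope \<open>s\<close> rest on this,
  applied to combinations of the \<open>S E\<close> whose derivative has a bound from below.\<close>

lemma mean_slope_ge:
  fixes f :: "real \<Rightarrow> real"
  assumes "\<And>t. (f has_real_derivative f' t) (at t)" "\<And>t. x \<le> f' t" "\<And>t. \<bar>f t - f 0 - m * t\<bar> \<le> M"
  shows "x \<le> m"
proof (rule bounded_diff_imp_le)
  fix t :: real assume t: "t > 0"
  obtain z where "f t - f 0 = (t - 0) * f' z" using MVT2[OF t] assms(1) by blast
  moreover have "t * x \<le> t * f' z" using t assms(2) by (intro mult_left_mono) auto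
  ultimately show "t * x \<le> t * m + M" using assms(3)[of t] by (simp add: mult.commute abs_le_iff)
qed

lemma sqrt_diff_ge:
  assumes "0 \<le> a" "a \<le> b" "b \<le> (c::real)"
  shows "(b - a) / (2 * sqrt c) \<le> sqrt b - sqrt a"
proof (cases "c = 0")
  case False
  then have c: "c > 0" using assms by linarith
  have "b - a = (sqrt b - sqrt a) * (sqrt b + sqrt a)"
    using assms by (simp add: algebra_simps flip: power2_eq_square)
  also have "\<dots> \<le> (sqrt b - sqrt a) * (2 * sqrt c)"
  proof (rule mult_left_mono)
    have "sqrt a \<le> sqrt c" "sqrt b \<le> sqrt c" using assms by auto
    then show "sqrt b + sqrt a \<le> 2 * sqrt c" by linarith
  qed (use assms in simp)
  finally show ?thesis using c by (simp add: divide_le_eq)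
qed (use assms in auto)

lemma sqrt_midpoint:
  assumes "0 \<le> a" "0 \<le> (b :: real)"
  shows "(sqrt a + sqrt b) / 2 \<le> sqrt ((a + b) / 2)"
proof (rule real_le_rsqrt)
  have "0 \<le> (sqrt a - sqrt b)\<^sup>2" by simp
  then have "2 * (sqrt a * sqrt b) \<le> a + b" using assms by (simp add: power2_diff)
  then show "((sqrt a + sqrt b) / 2)\<^sup>2 \<le> (a + b) / 2"
    using assms by (simp add: power_divide power2_sum)
qed

text \<open>The weight makes the difference of two bounded functions attain its maximum, at the
  price of an extra gradient of size at most \<open>\<eta>\<close>.\<close>

lemma perturbed_max:
  fixes w \<psi> :: "real \<Rightarrow> real"
  assumes "continuous_on UNIV w" "continuous_on UNIV \<psi>" "\<And>x. \<bar>w x\<bar> \<le> B" "\<And>x. \<bar>\<psi> x\<bar> \<le> B'" "\<eta> > 0"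
  obtains y where "\<And>x. w x - (\<psi> x + \<eta> * sqrt (1 + x\<^sup>2)) \<le> w y - (\<psi> y + \<eta> * sqrt (1 + y\<^sup>2))"
proof -
  have c: "continuous_on UNIV (\<lambda>x. w x - (\<psi> x + \<eta> * sqrt (1 + x\<^sup>2)))"
    by (intro continuous_intros assms)
  have *: "w x - (\<psi> x + \<eta> * sqrt (1 + x\<^sup>2)) \<le> w 0 - (\<psi> 0 + \<eta> * sqrt (1 + 0\<^sup>2))"
    if "\<bar>x - 0\<bar> > (2 * B + 2 * B' + \<eta>) / \<eta>" for x
  proof -
    have "2 * B + 2 * B' + \<eta> < \<eta> * \<bar>x\<bar>" using that assms(5) by (simp add: divide_less_eq mult.commute)
    moreover have "\<bar>x\<bar> \<le> sqrt (1 + x\<^sup>2)" by (rule real_le_rsqrt) simp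
    then have "\<eta> * \<bar>x\<bar> \<le> \<eta> * sqrt (1 + x\<^sup>2)" using assms(5) by (intro mult_left_mono) auto
    ultimately show ?thesis using assms(3)[of x] assms(3)[of 0] assms(4)[of x] assms(4)[of 0] by simp
  qed
  show ?thesis
    by (rule coercive_attains_max[OF c *]) (auto intro: that)
qed

lemma sqrt_weight:
  "((\<lambda>x. sqrt (1 + x\<^sup>2)) has_real_derivative x / sqrt (1 + x\<^sup>2)) (at x)"
  "continuous_on UNIV (\<lambda>x::real. x / sqrt (1 + x\<^sup>2))" "\<bar>x / sqrt (1 + x\<^sup>2)\<bar> \<le> 1"
proof -
  have p: "0 < 1 + x\<^sup>2" for x :: real by (simp add: add_pos_nonneg)
  have "((\<lambda>x. 1 + x\<^sup>2) has_real_derivative 2 * x) (at x)" by (auto intro!: derivative_eq_intros)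
  note d = this
  show "((\<lambda>x. sqrt (1 + x\<^sup>2)) has_real_derivative x / sqrt (1 + x\<^sup>2)) (at x)"
    by (rule DERIV_cong[OF DERIV_chain2[where g = "\<lambda>x. 1 + x\<^sup>2" and x = x,
            OF DERIV_real_sqrt[OF p[of x]] d]]) (simp add: inverse_eq_divide)
  show "continuous_on UNIV (\<lambda>x::real. x / sqrt (1 + x\<^sup>2))"
    by (intro continuous_intros ballI) (metis p less_irrefl real_sqrt_eq_zero_cancel_iff)
  have "\<bar>x\<bar> \<le> sqrt (1 + x\<^sup>2)" by (rule real_le_rsqrt) simp
  then show "\<bar>x / sqrt (1 + x\<^sup>2)\<bar> \<le> 1" using p[of x] by (simp add: divide_le_eq)
qed

lemma BUC_bounded: assumes "w \<in> BUC" obtains B where "\<And>x. \<bar>w x\<bar> \<le> B"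
  using assms by (auto simp: BUC_def bounded_iff)

lemma BUC_continuous: "w \<in> BUC \<Longrightarrow> continuous_on UNIV w"
  by (auto simp: BUC_def intro: uniformly_continuous_imp_continuous)

lemma ex_sign: obtains \<theta> :: real where "\<bar>\<theta>\<bar> = 1" "p = \<theta> * \<bar>p\<bar>"
  using that[of 1] that[of "-1"] by (cases "p \<ge> 0") auto

text \<open>\<open>S E\<close> is the action integral at energy \<open>E\<close> and \<open>s E\<close> its mean slope.\<close>

locale recurrent_potential =
  fixes V :: "real \<Rightarrow> real" and K C :: real and S :: "real \<Rightarrow> real \<Rightarrow> real" and s :: "real \<Rightarrow> real"
  assumes contV: "continuous_on UNIV V"
    and V_nonneg: "\<And>x. 0 \<le> V x" and V_le: "\<And>x. V x \<le> K"
    and S_deriv: "\<And>E x. E \<ge> 0 \<Longrightarrow> (S E has_real_derivative sqrt (2 * (E + V x))) (at x)"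
    and S_0: "\<And>E. S E 0 = 0"
    and disc: "\<And>E a b. E \<ge> 0 \<Longrightarrow> \<bar>S E b - S E a - s E * (b - a)\<bar> \<le> C"
    and recurrence: "\<And>\<delta>. \<delta> > 0 \<Longrightarrow> \<exists>d>0. \<forall>a. \<exists>t\<in>{a..a + d}. V t \<le> \<delta>"
begin

lemma K_nonneg: "0 \<le> K" using V_nonneg V_le order_trans by blast

lemma disc0: "E \<ge> 0 \<Longrightarrow> \<bar>S E x - s E * x\<bar> \<le> C"
  using disc[of E x 0] by (simp add: S_0)

lemma speed_le: "0 \<le> E \<Longrightarrow> sqrt (2 * (E + V x)) \<le> sqrt (2 * (E + K))"
  using V_le[of x] by simp

lemma S_continuous: "E \<ge> 0 \<Longrightarrow> continuous_on UNIV (S E)"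
  using S_deriv by (rule DERIV_continuous_on_UNIV)

lemma S_Lipschitz: "E \<ge> 0 \<Longrightarrow> \<bar>S E x - S E y\<bar> \<le> sqrt (2 * (E + K)) * \<bar>x - y\<bar>"
  by (rule Lipschitz_of_derivative_bound[OF S_deriv]) (auto simp: V_nonneg V_le)

lemma S_mono: "E \<ge> 0 \<Longrightarrow> x \<le> y \<Longrightarrow> S E x \<le> S E y"
  by (rule DERIV_nonneg_imp_nondecreasing) (use S_deriv V_nonneg in \<open>auto intro!: exI[of _ "sqrt _"]\<close>)

lemma s_ge: assumes "E \<ge> 0" shows "sqrt (2 * E) \<le> s E"
proof (rule mean_slope_ge[OF S_deriv[OF assms]])
  show "\<bar>S E t - S E 0 - s E * t\<bar> \<le> C" for t using disc[OF assms, of t 0] by simp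
qed (simp add: V_nonneg)

lemma s_nonneg: "E \<ge> 0 \<Longrightarrow> 0 \<le> s E"
  using s_ge[of E] real_sqrt_ge_zero[of "2 * E"] by linarith

lemma s_le: assumes "E \<ge> 0" shows "s E \<le> sqrt (2 * (E + K))"
proof -
  have "- sqrt (2 * (E + K)) \<le> - s E"
  proof (rule mean_slope_ge[OF DERIV_minus[OF S_deriv[OF assms]]])
    show "\<bar>- S E t - - S E 0 - - s E * t\<bar> \<le> C" for t using disc[OF assms, of t 0] by simp
  qed (use assms in \<open>simp add: V_le\<close>)
  then show ?thesis by simp
qed

text \<open>Subadditivity of the square root bounds the difference of momenta uniformly in x. The
  exponent 1/2 reflects the points where V is near 0.\<close>

lemma s_diff_le:
  assumes "0 \<le> E" "E \<le> E'" shows "s E' - s E \<le> sqrt (2 * (E' - E))"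
proof -
  have E': "0 \<le> E'" using assms by simp
  have "- sqrt (2 * (E' - E)) \<le> s E - s E'"
  proof (rule mean_slope_ge[OF DERIV_diff[OF S_deriv[OF assms(1)] S_deriv[OF E']]])
    fix t
    show "\<bar>S E t - S E' t - (S E 0 - S E' 0) - (s E - s E') * t\<bar> \<le> 2 * C"
      using disc0[OF assms(1), of t] disc0[OF E', of t] by (simp add: S_0 left_diff_distrib)
    have "sqrt (2 * (E' + V t)) = sqrt (2 * (E' - E) + 2 * (E + V t))" by simp
    also have "\<dots> \<le> sqrt (2 * (E' - E)) + sqrt (2 * (E + V t))"
      using assms V_nonneg[of t] by (intro sqrt_add_le_add_sqrt) auto
    finally show "- sqrt (2 * (E' - E)) \<le> sqrt (2 * (E + V t)) - sqrt (2 * (E' + V t))" by simp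
  qed
  then show ?thesis by simp
qed

text \<open>Quantitative strict monotonicity; read for the inverse of \<open>s\<close>, it is a
  local Lipschitz bound for the effective Hamiltonian.\<close>

lemma s_diff_ge:
  assumes "0 \<le> E" "E \<le> E'" shows "(E' - E) / sqrt (2 * (E' + K)) \<le> s E' - s E"
proof -
  have E': "0 \<le> E'" using assms by simp
  show ?thesis
  proof (rule mean_slope_ge[OF DERIV_diff[OF S_deriv[OF E'] S_deriv[OF assms(1)]]])
    fix t
    show "\<bar>S E' t - S E t - (S E' 0 - S E 0) - (s E' - s E) * t\<bar> \<le> 2 * C"
      using disc0[OF assms(1), of t] disc0[OF E', of t] by (simp add: S_0 left_diff_distrib)
    have "(2 * (E' + V t) - 2 * (E + V t)) / (2 * sqrt (2 * (E' + K))) \<le> sqrt (2 * (E' + V t)) - sqrt (2 * (E + V t))"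
      using assms V_nonneg[of t] V_le[of t] by (intro sqrt_diff_ge) auto
    moreover have "(2 * (E' + V t) - 2 * (E + V t)) / (2 * sqrt (2 * (E' + K))) = (E' - E) / sqrt (2 * (E' + K))"
    proof -
      have "2 * (E' + V t) - 2 * (E + V t) = 2 * (E' - E)" by simp
      then show ?thesis by (simp only:)
    qed
    ultimately show "(E' - E) / sqrt (2 * (E' + K)) \<le> sqrt (2 * (E' + V t)) - sqrt (2 * (E + V t))"
      by simp
  qed
qed

lemma s_mono: assumes "0 \<le> E" "E \<le> E'" shows "s E \<le> s E'"
proof -
  have "0 \<le> (E' - E) / sqrt (2 * (E' + K))" using assms K_nonneg by (intro divide_nonneg_nonneg) auto
  then show ?thesis using s_diff_ge[OF assms] by linarith
qed

lemma s_strict_mono: assumes "0 \<le> E" "E < E'" shows "s E < s E'"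
proof -
  have "0 < (E' - E) / sqrt (2 * (E' + K))" using assms K_nonneg by (intro divide_pos_pos) auto
  then show ?thesis using s_diff_ge[of E E'] assms by linarith
qed

lemma s_midpoint_concave:
  assumes "0 \<le> E" "0 \<le> E'" shows "(s E + s E') / 2 \<le> s ((E + E') / 2)"
proof -
  have m: "0 \<le> (E + E') / 2" using assms by simp
  have "0 \<le> s ((E + E') / 2) - (s E + s E') / 2"
  proof (rule mean_slope_ge[OF DERIV_diff[OF S_deriv[OF m]
          DERIV_cdivide[OF DERIV_add[OF S_deriv[OF assms(1)] S_deriv[OF assms(2)]], of 2]]])
    fix t
    show "\<bar>S ((E + E') / 2) t - (S E t + S E' t) / 2 - (S ((E + E') / 2) 0 - (S E 0 + S E' 0) / 2)
        - (s ((E + E') / 2) - (s E + s E') / 2) * t\<bar> \<le> 2 * C"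
      using disc0[OF assms(1), of t] disc0[OF assms(2), of t] disc0[OF m, of t]
      by (simp add: S_0 left_diff_distrib distrib_right add_divide_distrib)
    show "0 \<le> sqrt (2 * ((E + E') / 2 + V t)) - (sqrt (2 * (E + V t)) + sqrt (2 * (E' + V t))) / 2"
    proof -
      have "2 * ((E + E') / 2 + V t) = (2 * (E + V t) + 2 * (E' + V t)) / 2" by (simp add: field_simps)
      moreover have "(sqrt (2 * (E + V t)) + sqrt (2 * (E' + V t))) / 2 \<le> sqrt ((2 * (E + V t) + 2 * (E' + V t)) / 2)"
        using assms V_nonneg[of t] by (intro sqrt_midpoint) auto
      ultimately show ?thesis by (simp only: diff_ge_0_iff_ge)
    qed
  qed
  then show ?thesis by simp
qed

lemma s_continuous: "continuous_on {0..} s"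
proof (rule continuous_onI)
  fix E e :: real assume E: "E \<in> {0..}" and e: "e > 0"
  have "dist (s E') (s E) \<le> e" if E': "E' \<in> {0..}" "dist E' E < e\<^sup>2 / 2" for E'
  proof -
    have "\<bar>s E' - s E\<bar> \<le> sqrt (2 * \<bar>E' - E\<bar>)"
      using s_diff_le[of E E'] s_diff_le[of E' E] s_mono[of E E'] s_mono[of E' E] E E'
      by (cases "E \<le> E'") auto
    also have "\<dots> \<le> sqrt (e\<^sup>2)" using E'(2) by (intro real_sqrt_le_mono) (auto simp: dist_real_def)
    finally show ?thesis using e by (simp add: dist_real_def)
  qed
  moreover have "e\<^sup>2 / 2 > 0" using e by simp
  ultimately show "\<exists>d>0. \<forall>x'\<in>{0..}. dist x' E < d \<longrightarrow> dist (s x') (s E) \<le> e" by blast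
qed

text \<open>The choice is justified by the intermediate value theorem between 0 and
  \<open>p\<^sup>2 / 2\<close>, where \<open>s\<close> is already at least
  \<open>\<bar>p\<bar>\<close>.\<close>

definition Hb :: "real \<Rightarrow> real" where
  "Hb p = (if \<bar>p\<bar> \<le> s 0 then 0 else (SOME E. E \<ge> 0 \<and> s E = \<bar>p\<bar>))"

lemma Hb: "0 \<le> Hb p" "\<bar>p\<bar> \<le> s (Hb p)" "Hb p > 0 \<Longrightarrow> s (Hb p) = \<bar>p\<bar>"
proof -
  have *: "0 \<le> Hb p \<and> s (Hb p) = \<bar>p\<bar>" if "\<not> \<bar>p\<bar> \<le> s 0"
  proof -
    have "\<bar>p\<bar> = sqrt (2 * (p\<^sup>2 / 2))" by simp
    also have "\<dots> \<le> s (p\<^sup>2 / 2)" by (rule s_ge) simp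
    finally have "\<exists>E. 0 \<le> E \<and> E \<le> p\<^sup>2 / 2 \<and> s E = \<bar>p\<bar>"
      using that by (intro IVT') (auto intro: continuous_on_subset[OF s_continuous])
    then have "\<exists>E. 0 \<le> E \<and> s E = \<bar>p\<bar>" by blast
    from someI_ex[OF this] show ?thesis using that by (simp add: Hb_def)
  qed
  show "0 \<le> Hb p" "\<bar>p\<bar> \<le> s (Hb p)" "Hb p > 0 \<Longrightarrow> s (Hb p) = \<bar>p\<bar>"
    using * by (cases "\<bar>p\<bar> \<le> s 0"; simp add: Hb_def)+
qed

lemma Hb_le: assumes "0 \<le> E" "\<bar>q\<bar> \<le> s E" shows "Hb q \<le> E"
proof (rule ccontr)
  assume "\<not> Hb q \<le> E"
  then have E: "E < Hb q" "0 < Hb q" using assms by auto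
  then show False using s_strict_mono[OF assms(1) E(1)] Hb(3)[OF E(2)] assms by simp
qed

lemma Hb_le_square: "Hb p \<le> p\<^sup>2 / 2"
  using s_ge[of "p\<^sup>2 / 2"] by (intro Hb_le) auto

lemma Hb_ge_square: "p\<^sup>2 / 2 - K \<le> Hb p"
proof -
  have "\<bar>p\<bar> \<le> sqrt (2 * (Hb p + K))" using Hb(2)[of p] s_le[OF Hb(1), of p] by linarith
  then have "\<bar>p\<bar>\<^sup>2 \<le> (sqrt (2 * (Hb p + K)))\<^sup>2" by (intro power_mono) auto
  also have "\<dots> = 2 * (Hb p + K)" using K_nonneg Hb(1)[of p] by (intro real_sqrt_pow2) simp
  finally show ?thesis by simp
qed

text \<open>The inverse of \<open>s\<close> has slope at most the largest momentum
  \<open>sqrt (2 * (E + K))\<close> at the larger energy \<open>E\<close>. An increment linear plus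
  quadratic in \<open>q\<close> is what the comparison with cones asks of a Hamiltonian.\<close>

lemma Hb_increment: "Hb (p + q) \<le> Hb p + \<bar>q\<bar> * (\<bar>p\<bar> + \<bar>q\<bar> + sqrt (2 * K))"
proof (cases "Hb (p + q) \<le> Hb p")
  case True
  then show ?thesis using K_nonneg by (simp add: add_increasing2)
next
  case False
  then have l: "Hb p \<le> Hb (p + q)" "Hb (p + q) > 0" using Hb(1)[of p] by auto
  define A where "A = sqrt (2 * (Hb (p + q) + K))"
  have A: "A > 0" using l K_nonneg by (simp add: A_def)
  have "(Hb (p + q) - Hb p) / A \<le> s (Hb (p + q)) - s (Hb p)"
    unfolding A_def by (rule s_diff_ge[OF Hb(1) l(1)])
  also have "\<dots> \<le> \<bar>q\<bar>" using Hb(3)[OF l(2)] Hb(2)[of p] by linarith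
  finally have "Hb (p + q) - Hb p \<le> \<bar>q\<bar> * A" using A by (simp add: divide_le_eq)
  also have "\<dots> \<le> \<bar>q\<bar> * (\<bar>p\<bar> + \<bar>q\<bar> + sqrt (2 * K))"
  proof (rule mult_left_mono)
    have "A \<le> sqrt ((p + q)\<^sup>2 + 2 * K)" unfolding A_def
      using Hb_le_square[of "p + q"] by (intro real_sqrt_le_mono) simp
    also have "\<dots> \<le> sqrt ((p + q)\<^sup>2) + sqrt (2 * K)" using K_nonneg by (intro sqrt_add_le_add_sqrt) auto
    finally show "A \<le> \<bar>p\<bar> + \<bar>q\<bar> + sqrt (2 * K)" by (simp add: abs_triangle_ineq order_trans)
  qed simp
  finally show ?thesis by simp
qed

end

section \<open>Correctors and the value of the cell problem\<close>

context recurrent_potential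
begin

definition H :: "real \<Rightarrow> real \<Rightarrow> real" where
  "H x p = 1 / 2 * \<bar>p\<bar>\<^sup>2 - V x"

text \<open>Below the critical slope, a corrector is a minimum of distance-like functions
  with vertices in the set \<open>V \<le> \<delta>\<close>; its convex kinks sit in that set.\<close>

lemma flat_corrector:
  assumes p: "\<bar>p\<bar> < s 0" and \<delta>: "\<delta> > 0"
  obtains w where "w \<in> BUC \<inter> Lip"
    "viscosity_supersolution UNIV (\<lambda>x q. H x (p + q) - (0 - \<delta>)) w"
    "viscosity_subsolution UNIV (\<lambda>x q. H x (p + q) - (0 + \<delta>)) w"
proof -
  define A where "A = {z. V z \<le> \<delta>}"
  have clA: "closed A" unfolding A_def using contV by (intro closed_Collect_le) auto
  obtain d where d: "d > 0" "\<And>a. \<exists>t\<in>{a..a + d}. t \<in> A"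
    using recurrence[OF \<delta>] by (auto simp: A_def)
  define L where "L = sqrt (2 * K)"
  have SL: "\<bar>S 0 x - S 0 y\<bar> \<le> L * \<bar>x - y\<bar>" for x y using S_Lipschitz[of 0 x y] by (simp add: L_def)
  have L: "L \<ge> 0" using K_nonneg by (simp add: L_def)
  have C: "C \<ge> 0" using disc0[of 0 0] by (simp add: S_0)
  have disc': "\<bar>S 0 x - S 0 z\<bar> \<ge> s 0 * \<bar>x - z\<bar> - C" for x z
  proof -
    have "\<bar>s 0 * (x - z)\<bar> = s 0 * \<bar>x - z\<bar>" using s_nonneg[of 0] by (simp add: abs_mult)
    then show ?thesis using disc[of 0 x z] by linarith
  qed
  define g where "g x z = p * z + \<bar>S 0 x - S 0 z\<bar>" for x z
  \<comment> \<open>Since \<open>\<bar>p\<bar> < s 0\<close>, the discrepancy makes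
    \<open>g x\<close> grow linearly in the distance to the vertex; hence minima over
    \<open>A\<close> exist and \<open>w\<close> is bounded below.\<close>
  have glow: "g x z \<ge> p * x + (s 0 - \<bar>p\<bar>) * \<bar>x - z\<bar> - C" for x z
  proof -
    have "p * (x - z) \<le> \<bar>p\<bar> * \<bar>x - z\<bar>" by (metis abs_ge_self abs_mult)
    then show ?thesis using disc'[of x z] by (simp add: g_def algebra_simps)
  qed
  have "\<exists>z\<in>A. \<forall>z'\<in>A. g x z \<le> g x z'" for x
  proof -
    obtain z1 where z1: "z1 \<in> A" "z1 \<in> {x..x + d}" using d(2)[of x] by blast
    \<comment> \<open>Outside this window \<open>g x\<close> exceeds its value at the vertex
      \<open>z1\<close>, which recurrence places within \<open>d\<close> of
      \<open>x\<close>.\<close>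
    define r where "r = max d ((g x z1 - p * x + C) / (s 0 - \<bar>p\<bar>))"
    have "compact (A \<inter> {x - r..x + r})" by (rule closed_Int_compact[OF clA compact_Icc])
    moreover have z1r: "z1 \<in> A \<inter> {x - r..x + r}" using z1 d(1) by (auto simp: r_def)
    moreover have "continuous_on (A \<inter> {x - r..x + r}) (g x)" unfolding g_def
      by (intro continuous_intros continuous_on_subset[OF S_continuous]) auto
    ultimately obtain z where z: "z \<in> A \<inter> {x - r..x + r}" "\<And>z'. z' \<in> A \<inter> {x - r..x + r} \<Longrightarrow> g x z \<le> g x z'"
      using continuous_attains_inf[of "A \<inter> {x - r..x + r}" "g x"] by blast
    have "g x z \<le> g x z'" if "z' \<in> A" for z'
    proof (cases "z' \<in> {x - r..x + r}")
      case True
      then show ?thesis using z that by blast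
    next
      case False
      then have "\<bar>x - z'\<bar> > r" by auto
      then have "(g x z1 - p * x + C) / (s 0 - \<bar>p\<bar>) < \<bar>x - z'\<bar>" by (simp add: r_def)
      then have "g x z1 - p * x + C < \<bar>x - z'\<bar> * (s 0 - \<bar>p\<bar>)" using p by (simp add: divide_less_eq)
      then have "g x z1 < g x z'" using glow[of x z'] by (simp add: mult.commute)
      then show ?thesis using z(2)[OF z1r] by simp
    qed
    then show ?thesis using z by blast
  qed
  then obtain zs where zs: "\<And>x. zs x \<in> A" "\<And>x z. z \<in> A \<Longrightarrow> g x (zs x) \<le> g x z" by metis
  define Z where "Z x = g x (zs x)" for x
  have ZS: "Z x - Z y \<le> \<bar>S 0 x - S 0 y\<bar>" for x y
  proof -
    have "Z x \<le> g x (zs y)" unfolding Z_def by (rule zs(2)[OF zs(1)])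
    then show ?thesis unfolding Z_def g_def by linarith
  qed
  have Zlow: "Z x - p * x \<ge> - C" for x
  proof -
    have "0 \<le> (s 0 - \<bar>p\<bar>) * \<bar>x - zs x\<bar>" using p by simp
    then show ?thesis using glow[of x "zs x"] by (simp add: Z_def)
  qed
  have Zup: "Z x - p * x \<le> (\<bar>p\<bar> + L) * d" for x
  proof -
    obtain z1 where z1: "z1 \<in> A" "z1 \<in> {x..x + d}" using d(2)[of x] by blast
    have "p * (z1 - x) \<le> \<bar>p\<bar> * \<bar>z1 - x\<bar>" by (metis abs_ge_self abs_mult)
    also have "\<dots> \<le> \<bar>p\<bar> * d" using z1 by (intro mult_left_mono) auto
    finally have 1: "p * (z1 - x) \<le> \<bar>p\<bar> * d" .
    have "\<bar>S 0 x - S 0 z1\<bar> \<le> L * \<bar>x - z1\<bar>" by (rule SL)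
    also have "\<dots> \<le> L * d" using z1 L by (intro mult_left_mono) auto
    finally have "\<bar>S 0 x - S 0 z1\<bar> \<le> L * d" .
    then show ?thesis using 1 zs(2)[OF z1(1), of x] by (simp add: Z_def g_def algebra_simps)
  qed
  have ZL: "\<bar>Z x - Z y\<bar> \<le> L * \<bar>x - y\<bar>" for x y
    using ZS[of x y] ZS[of y x] SL[of x y] by (simp add: abs_minus_commute)
  define w where "w x = Z x - p * x" for x
  have wL: "\<bar>w x - w y\<bar> \<le> (L + \<bar>p\<bar>) * \<bar>x - y\<bar>" for x y
  proof -
    have "\<bar>w x - w y\<bar> \<le> \<bar>Z x - Z y\<bar> + \<bar>p * (x - y)\<bar>" unfolding w_def by (simp add: algebra_simps abs_if)
    also have "\<dots> \<le> L * \<bar>x - y\<bar> + \<bar>p\<bar> * \<bar>x - y\<bar>" using ZL[of x y] by (simp add: abs_mult)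
    finally show ?thesis by (simp add: distrib_right)
  qed
  have w1: "w \<in> BUC \<inter> Lip"
  proof (rule bounded_Lipschitz_in_BUC_Lip[OF _ wL])
    show "\<bar>w x\<bar> \<le> max C ((\<bar>p\<bar> + L) * d)" for x using Zlow[of x] Zup[of x] by (auto simp: w_def abs_le_iff)
  qed (use L in simp)
  have cw: "continuous_on UNIV w"
    using w1 by (auto simp: BUC_def intro: uniformly_continuous_imp_continuous)
  have sup: "viscosity_supersolution UNIV (\<lambda>x q. H x (p + q) - (0 - \<delta>)) w"
    unfolding viscosity_supersolution_def
  proof (intro conjI allI impI ballI cw)
    fix \<phi> D y assume \<phi>: "C1_on UNIV \<phi> D" and m: "\<forall>\<^sub>F z in nhds y. w z - \<phi> z \<ge> w y - \<phi> y"
    show "0 \<le> H y (p + D y) - (0 - \<delta>)"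
    \<comment> \<open>At a vertex nothing is asked of the gradient, because V is at most
      \<open>\<delta>\<close> there. Elsewhere the branch with the vertex frozen at
      \<open>zs y\<close> is differentiable at \<open>y\<close>, lies above \<open>w\<close> and
      meets it at \<open>y\<close>, so it determines the gradient of any test function touching
      \<open>w\<close> from below.\<close>
    proof (cases "zs y = y")
      case True
      then have "V y \<le> \<delta>" using zs(1)[of y] by (simp add: A_def)
      moreover have "0 \<le> 1 / 2 * \<bar>p + D y\<bar>\<^sup>2" by simp
      ultimately show ?thesis unfolding H_def by linarith
    next
      case False
      define \<sigma> :: real where "\<sigma> = (if y > zs y then 1 else -1)"
      have near: "\<forall>\<^sub>F z in nhds y. \<bar>S 0 z - S 0 (zs y)\<bar> = \<sigma> * (S 0 z - S 0 (zs y))"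
      proof (cases "y > zs y")
        case True
        then have "\<forall>\<^sub>F z in nhds y. z \<in> {zs y<..}" by (intro eventually_nhds_in_open) auto
        then show ?thesis by (rule eventually_mono) (use True S_mono[of 0 "zs y"] in \<open>auto simp: \<sigma>_def\<close>)
      next
        case F: False
        then have "y < zs y" using False by simp
        then have "\<forall>\<^sub>F z in nhds y. z \<in> {..<zs y}" by (intro eventually_nhds_in_open) auto
        then show ?thesis by (rule eventually_mono) (use F S_mono[of 0 _ "zs y"] in \<open>auto simp: \<sigma>_def\<close>)
      qed
      define f where "f z = \<phi> z + p * z - \<sigma> * S 0 z" for z
      have "(f has_real_derivative D y + p - \<sigma> * sqrt (2 * (0 + V y))) (at y)"
        unfolding f_def using C1_onD_real[OF \<phi>, of y] S_deriv[of 0 y]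
        by (auto intro!: derivative_eq_intros)
      moreover have "\<forall>\<^sub>F z in nhds y. f z \<le> f y"
        using m near
      proof eventually_elim
        case (elim z)
        have "w z \<le> g z (zs y) - p * z" unfolding w_def Z_def using zs(2)[OF zs(1), of z y] by simp
        moreover have "w y = g y (zs y) - p * y" by (simp add: w_def Z_def)
        moreover have "\<bar>S 0 y - S 0 (zs y)\<bar> = \<sigma> * (S 0 y - S 0 (zs y))"
          using eventually_nhds_x_imp_x[OF near] .
        ultimately show ?case using elim by (simp add: f_def g_def algebra_simps)
      qed
      ultimately have "D y + p - \<sigma> * sqrt (2 * (0 + V y)) = 0" by (rule derivative_at_touching_max)
      then have "p + D y = \<sigma> * sqrt (2 * V y)" by simp
      then have "\<bar>p + D y\<bar>\<^sup>2 = 2 * V y" using V_nonneg[of y] by (simp add: \<sigma>_def)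
      then show ?thesis using \<delta> by (simp add: H_def)
    qed
  qed
  have sub: "viscosity_subsolution UNIV (\<lambda>x q. H x (p + q) - (0 + \<delta>)) w"
    unfolding viscosity_subsolution_def
  proof (intro conjI allI impI ballI cw)
    fix \<phi> D y assume \<phi>: "C1_on UNIV \<phi> D" and m: "\<forall>\<^sub>F z in nhds y. w z - \<phi> z \<le> w y - \<phi> y"
    define v where "v = sqrt (2 * (0 + V y))"
    obtain r where r: "r > 0" "\<And>z. dist z y < r \<Longrightarrow> w z - \<phi> z \<le> w y - \<phi> y"
      using m unfolding eventually_nhds_metric by blast
    define f1 where "f1 z = \<phi> z + p * z + S 0 z" for z
    define f2 where "f2 z = \<phi> z + p * z - S 0 z" for z
    have d1: "(f1 has_real_derivative D y + p + v) (at y)"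
      unfolding f1_def v_def using C1_onD_real[OF \<phi>, of y] S_deriv[of 0 y]
      by (auto intro!: derivative_eq_intros)
    have d2: "(f2 has_real_derivative D y + p - v) (at y)"
      unfolding f2_def v_def using C1_onD_real[OF \<phi>, of y] S_deriv[of 0 y]
      by (auto intro!: derivative_eq_intros)
    \<comment> \<open>Both one-sided bounds come from \<open>ZS\<close>: \<open>Z\<close> varies no
      faster than the action, so a test function touching from above has
      \<open>\<bar>p + D y\<bar>\<close> at most \<open>v\<close>.\<close>
    have "D y + p + v \<ge> 0"
    proof (rule ccontr)
      assume "\<not> D y + p + v \<ge> 0"
      then obtain e where e: "e > 0" "\<And>h. 0 < h \<Longrightarrow> h < e \<Longrightarrow> f1 (y + h) < f1 y"
        using DERIV_neg_dec_right[OF d1] by auto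
      define h where "h = min e r / 2"
      have h: "0 < h" "h < e" "h < r" using e r by (auto simp: h_def)
      have "w (y + h) - \<phi> (y + h) \<le> w y - \<phi> y" using h by (intro r(2)) (simp add: dist_real_def)
      moreover have "w y - w (y + h) - p * h \<le> S 0 (y + h) - S 0 y"
        using ZS[of y "y + h"] S_mono[of 0 y "y + h"] h by (simp add: w_def algebra_simps)
      ultimately show False using e(2)[OF h(1,2)] by (simp add: f1_def algebra_simps)
    qed
    moreover have "D y + p - v \<le> 0"
    proof (rule ccontr)
      assume "\<not> D y + p - v \<le> 0"
      then obtain e where e: "e > 0" "\<And>h. 0 < h \<Longrightarrow> h < e \<Longrightarrow> f2 (y - h) < f2 y"
        using DERIV_pos_inc_left[OF d2] by auto
      define h where "h = min e r / 2"
      have h: "0 < h" "h < e" "h < r" using e r by (auto simp: h_def)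
      have "w (y - h) - \<phi> (y - h) \<le> w y - \<phi> y" using h by (intro r(2)) (simp add: dist_real_def)
      moreover have "w y - w (y - h) + p * h \<le> S 0 y - S 0 (y - h)"
        using ZS[of y "y - h"] S_mono[of 0 "y - h" y] h by (simp add: w_def algebra_simps)
      ultimately show False using e(2)[OF h(1,2)] by (simp add: f2_def algebra_simps)
    qed
    ultimately have "\<bar>p + D y\<bar> \<le> v" by linarith
    then have "\<bar>p + D y\<bar>\<^sup>2 \<le> v\<^sup>2" by (intro power_mono) auto
    also have "v\<^sup>2 = 2 * V y" using V_nonneg[of y] by (simp add: v_def)
    finally show "H y (p + D y) - (0 + \<delta>) \<le> 0" using \<delta> by (simp add: H_def)
  qed
  show ?thesis by (rule that[OF w1 sup sub])
qed

text \<open>Boundedness is the discrepancy estimate. For \<open>\<bar>\<theta>\<bar> = 1\<close> the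
  function solves the cell problem at level \<open>E\<close> exactly; for smaller
  \<open>\<bar>\<theta>\<bar>\<close> it is a subsolution, which bounds cell values from above on
  the flat part.\<close>

lemma action_corrector:
  assumes E: "E \<ge> 0" and p: "p = \<theta> * s E" and \<theta>: "\<bar>\<theta>\<bar> \<le> 1"
  shows "((\<lambda>x. \<theta> * S E x - p * x) has_real_derivative \<theta> * sqrt (2 * (E + V x)) - p) (at x)"
    "\<bar>\<theta> * S E x - p * x\<bar> \<le> C"
    "continuous_on UNIV (\<lambda>x. \<theta> * sqrt (2 * (E + V x)) - p)"
    "(\<lambda>x. \<theta> * S E x - p * x) \<in> BUC \<inter> Lip"
proof -
  show d: "((\<lambda>x. \<theta> * S E x - p * x) has_real_derivative \<theta> * sqrt (2 * (E + V x)) - p) (at x)" for x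
    by (auto intro!: derivative_eq_intros S_deriv[OF E])
  show b: "\<bar>\<theta> * S E x - p * x\<bar> \<le> C" for x
  proof -
    have "\<bar>\<theta> * S E x - p * x\<bar> = \<bar>\<theta>\<bar> * \<bar>S E x - s E * x\<bar>"
      by (simp add: p abs_mult[symmetric] algebra_simps)
    also have "\<dots> \<le> 1 * C" using \<theta> disc0[OF E, of x] by (intro mult_mono) auto
    finally show ?thesis by simp
  qed
  show "continuous_on UNIV (\<lambda>x. \<theta> * sqrt (2 * (E + V x)) - p)"
    by (intro continuous_intros contV)
  have bd: "\<bar>\<theta> * sqrt (2 * (E + V x)) - p\<bar> \<le> sqrt (2 * (E + K)) + \<bar>p\<bar>" for x
  proof -
    have "\<bar>\<theta> * sqrt (2 * (E + V x))\<bar> \<le> 1 * sqrt (2 * (E + K))"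
      unfolding abs_mult using \<theta> speed_le[OF E, of x] E V_nonneg[of x] by (intro mult_mono) auto
    then show ?thesis by linarith
  qed
  show "(\<lambda>x. \<theta> * S E x - p * x) \<in> BUC \<inter> Lip"
    by (rule bounded_Lipschitz_in_BUC_Lip[OF b Lipschitz_of_derivative_bound[OF d bd]])
       (use E K_nonneg in simp)
qed

text \<open>The action corrector is of class C1 and serves as the test function itself; the weight,
  with gradient at most \<open>\<eta>\<close>, provides a point of contact.\<close>

lemma subsolution_vs_action:
  assumes E: "E \<ge> 0" and p: "p = \<theta> * s E" and \<theta>: "\<bar>\<theta>\<bar> \<le> 1" and \<eta>: "\<eta> > 0"
    and w: "w \<in> BUC" and sub: "viscosity_subsolution UNIV (\<lambda>x q. H x (p + q) - c) w"
  obtains y t where "\<bar>t\<bar> \<le> 1" "H y (\<theta> * sqrt (2 * (E + V y)) + \<eta> * t) \<le> c"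
proof -
  obtain B where B: "\<And>x. \<bar>w x\<bar> \<le> B" using BUC_bounded[OF w] by blast
  define \<psi> where "\<psi> x = \<theta> * S E x - p * x" for x
  note ac = action_corrector[OF E p \<theta>, folded \<psi>_def]
  have c\<psi>: "continuous_on UNIV \<psi>" using ac(1) by (rule DERIV_continuous_on_UNIV)
  obtain y where y: "\<And>x. w x - (\<psi> x + \<eta> * sqrt (1 + x\<^sup>2)) \<le> w y - (\<psi> y + \<eta> * sqrt (1 + y\<^sup>2))"
    using perturbed_max[OF BUC_continuous[OF w] c\<psi> B ac(2) \<eta>] by blast
  define \<phi> where "\<phi> x = \<psi> x + \<eta> * sqrt (1 + x\<^sup>2)" for x
  define D where "D x = (\<theta> * sqrt (2 * (E + V x)) - p) + \<eta> * (x / sqrt (1 + x\<^sup>2))" for x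
  have "C1_on UNIV \<phi> D"
  proof (rule C1_onI_real)
    show "(\<phi> has_real_derivative D x) (at x)" for x unfolding \<phi>_def D_def
      by (intro DERIV_add DERIV_cmult ac(1) sqrt_weight(1))
    show "continuous_on UNIV D" unfolding D_def
      by (intro continuous_on_add continuous_on_mult_left ac(3) sqrt_weight(2))
  qed
  then have "H y (p + D y) - c \<le> 0"
    using sub y unfolding viscosity_subsolution_def \<phi>_def by (simp add: always_eventually)
  then have "H y (\<theta> * sqrt (2 * (E + V y)) + \<eta> * (y / sqrt (1 + y\<^sup>2))) \<le> c" by (simp add: D_def)
  with sqrt_weight(3) show ?thesis by (rule that)
qed

lemma supersolution_vs_action:
  assumes E: "E \<ge> 0" and p: "p = \<theta> * s E" and \<theta>: "\<bar>\<theta>\<bar> \<le> 1" and \<eta>: "\<eta> > 0"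
    and w: "w \<in> BUC" and super: "viscosity_supersolution UNIV (\<lambda>x q. H x (p + q) - c) w"
  obtains y t where "\<bar>t\<bar> \<le> 1" "H y (\<theta> * sqrt (2 * (E + V y)) + \<eta> * t) \<ge> c"
proof -
  obtain B where B: "\<And>x. \<bar>w x\<bar> \<le> B" using BUC_bounded[OF w] by blast
  define \<psi> where "\<psi> x = \<theta> * S E x - p * x" for x
  note ac = action_corrector[OF E p \<theta>, folded \<psi>_def]
  have c\<psi>: "continuous_on UNIV (\<lambda>x. - \<psi> x)"
    using DERIV_continuous_on_UNIV[OF ac(1)] by (intro continuous_intros)
  have cw: "continuous_on UNIV (\<lambda>x. - w x)" using BUC_continuous[OF w] by (intro continuous_intros)
  obtain y where y: "\<And>x. - w x - (- \<psi> x + \<eta> * sqrt (1 + x\<^sup>2)) \<le> - w y - (- \<psi> y + \<eta> * sqrt (1 + y\<^sup>2))"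
    using perturbed_max[OF cw c\<psi>, of B C \<eta>] B ac(2) \<eta> by auto
  define \<phi> where "\<phi> x = \<psi> x - \<eta> * sqrt (1 + x\<^sup>2)" for x
  define D where "D x = (\<theta> * sqrt (2 * (E + V x)) - p) - \<eta> * (x / sqrt (1 + x\<^sup>2))" for x
  have "C1_on UNIV \<phi> D"
  proof (rule C1_onI_real)
    show "(\<phi> has_real_derivative D x) (at x)" for x unfolding \<phi>_def D_def
      by (intro DERIV_diff DERIV_cmult ac(1) sqrt_weight(1))
    show "continuous_on UNIV D" unfolding D_def
      by (intro continuous_on_diff continuous_on_mult_left ac(3) sqrt_weight(2))
  qed
  moreover have "w x - \<phi> x \<ge> w y - \<phi> y" for x using y[of x] by (simp add: \<phi>_def)
  ultimately have "H y (p + D y) - c \<ge> 0"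
    using super unfolding viscosity_supersolution_def by (simp add: always_eventually)
  then have "H y (\<theta> * sqrt (2 * (E + V y)) + \<eta> * - (y / sqrt (1 + y\<^sup>2))) \<ge> c" by (simp add: D_def)
  moreover have "\<bar>- (y / sqrt (1 + y\<^sup>2))\<bar> \<le> 1" using sqrt_weight(3)[of y] by simp
  ultimately show ?thesis using that by blast
qed


text \<open>The estimate from below requires \<open>\<bar>\<theta>\<bar> = 1\<close>, for otherwise
  \<open>\<theta>\<^sup>2 * (E + V y) - V y\<close> may fall below \<open>E\<close> by a fixed
  amount.\<close>

lemma H_perturbed:
  assumes "E \<ge> 0" "\<bar>t\<bar> \<le> 1" "\<eta> \<ge> 0" "\<bar>\<theta>\<bar> \<le> 1"
  shows "H y (\<theta> * sqrt (2 * (E + V y)) + \<eta> * t) \<le> E + \<eta> * sqrt (2 * (E + K)) + \<eta>\<^sup>2"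
    "\<bar>\<theta>\<bar> = 1 \<Longrightarrow> E - \<eta> * sqrt (2 * (E + K)) \<le> H y (\<theta> * sqrt (2 * (E + V y)) + \<eta> * t)"
proof -
  define v where "v = sqrt (2 * (E + V y))"
  have v: "v \<ge> 0" "v\<^sup>2 = 2 * (E + V y)" "v \<le> sqrt (2 * (E + K))"
    using assms V_nonneg[of y] speed_le[OF assms(1), of y] by (auto simp: v_def)
  have e: "H y (\<theta> * v + \<eta> * t) = \<theta>\<^sup>2 * (E + V y) - V y + (\<theta> * t) * (\<eta> * v) + (\<eta> * t)\<^sup>2 / 2"
    unfolding H_def by (simp add: power2_sum power_mult_distrib v(2) algebra_simps)
  have \<theta>t: "\<bar>\<theta> * t\<bar> \<le> 1" unfolding abs_mult using assms by (intro mult_le_one) auto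
  have \<eta>v: "\<eta> * v \<ge> 0" "\<eta> * v \<le> \<eta> * sqrt (2 * (E + K))" using v assms by (auto intro: mult_left_mono)
  have "\<bar>(\<theta> * t) * (\<eta> * v)\<bar> \<le> 1 * (\<eta> * v)"
    unfolding abs_mult[of "\<theta> * t"] using \<theta>t \<eta>v by (intro mult_mono) auto
  then have b: "\<bar>(\<theta> * t) * (\<eta> * v)\<bar> \<le> \<eta> * sqrt (2 * (E + K))" using \<eta>v by linarith
  have "\<theta>\<^sup>2 * (E + V y) \<le> E + V y"
    using assms V_nonneg[of y] by (intro mult_left_le_one_le) (auto simp: abs_square_le_1)
  moreover have "(\<eta> * t)\<^sup>2 \<le> \<eta>\<^sup>2" unfolding power_mult_distrib
    using assms by (intro mult_left_le) (auto simp: abs_square_le_1)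
  moreover have "0 \<le> \<eta>\<^sup>2" by simp
  ultimately show "H y (\<theta> * sqrt (2 * (E + V y)) + \<eta> * t) \<le> E + \<eta> * sqrt (2 * (E + K)) + \<eta>\<^sup>2"
    using b unfolding v_def[symmetric] e by linarith
  assume "\<bar>\<theta>\<bar> = 1"
  then have "\<theta>\<^sup>2 = 1" by (metis one_power2 power2_abs)
  then show "E - \<eta> * sqrt (2 * (E + K)) \<le> H y (\<theta> * sqrt (2 * (E + V y)) + \<eta> * t)"
    using b zero_le_power2[of "\<eta> * t"] unfolding v_def[symmetric] e \<open>\<theta>\<^sup>2 = 1\<close> mult_1 by linarith
qed

text \<open>Isolates the condition under \<open>THE\<close> in the effective Hamiltonian, so that
  existence and uniqueness can be treated separately.\<close>

definition cell_value :: "real \<Rightarrow> real \<Rightarrow> bool" where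
  "cell_value p c \<longleftrightarrow> (\<forall>\<delta>>0. \<exists>w \<in> BUC \<inter> Lip.
        viscosity_supersolution UNIV (\<lambda>x q. H x (p + q) - (c - \<delta>)) w \<and>
        viscosity_subsolution UNIV (\<lambda>x q. H x (p + q) - (c + \<delta>)) w)"

lemma cell_value_Hb: "cell_value p (Hb p)"
  unfolding cell_value_def
proof (intro allI impI)
  fix \<delta> :: real assume \<delta>: "\<delta> > 0"
  show "\<exists>w \<in> BUC \<inter> Lip.
        viscosity_supersolution UNIV (\<lambda>x q. H x (p + q) - (Hb p - \<delta>)) w \<and>
        viscosity_subsolution UNIV (\<lambda>x q. H x (p + q) - (Hb p + \<delta>)) w"
  proof (cases "\<bar>p\<bar> < s 0")
    case True
    then have "Hb p = 0" by (simp add: Hb_def)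
    then show ?thesis using flat_corrector[OF True \<delta>] by metis
  next
    case False
    obtain \<theta> where \<theta>: "\<bar>\<theta>\<bar> = 1" "p = \<theta> * \<bar>p\<bar>" by (rule ex_sign)
    \<comment> \<open>The borderline \<open>\<bar>p\<bar> = s 0\<close> belongs to this case, with
      energy 0.\<close>
    have sp: "s (Hb p) = \<bar>p\<bar>"
      using Hb(1,2,3)[of p] False by (cases "Hb p = 0") auto
    have p: "p = \<theta> * s (Hb p)" "\<bar>\<theta>\<bar> \<le> 1" using \<theta> sp by auto
    note ac = action_corrector[OF Hb(1) p]
    have e: "H x (p + (\<theta> * sqrt (2 * (Hb p + V x)) - p)) = Hb p" for x
    proof -
      have "\<theta>\<^sup>2 = 1" using \<theta>(1) by (metis one_power2 power2_abs)
      then show ?thesis using Hb(1)[of p] V_nonneg[of x] by (simp add: H_def power_mult_distrib field_simps)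
    qed
    show ?thesis
    proof (intro bexI conjI)
      show "(\<lambda>x. \<theta> * S (Hb p) x - p * x) \<in> BUC \<inter> Lip" by (rule ac(4))
      show "viscosity_supersolution UNIV (\<lambda>x q. H x (p + q) - (Hb p - \<delta>)) (\<lambda>x. \<theta> * S (Hb p) x - p * x)"
        by (rule classical_supersolution[OF ac(1)]) (use e \<delta> in simp)
      show "viscosity_subsolution UNIV (\<lambda>x q. H x (p + q) - (Hb p + \<delta>)) (\<lambda>x. \<theta> * S (Hb p) x - p * x)"
        by (rule classical_subsolution[OF ac(1)]) (use e \<delta> in simp)
    qed
  qed
qed

text \<open>Near a point where V is almost 0, \<open>H\<close> exceeds a negative level for every
  gradient, while a steep parabola touches a bounded subsolution from above there.\<close>

lemma cell_value_nonneg: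
  assumes "cell_value p c" shows "c \<ge> 0"
proof (rule ccontr)
  assume c: "\<not> c \<ge> 0"
  define c' where "c' = c / 2"
  have c': "c' < 0" "c + (- c / 2) = c'" using c by (auto simp: c'_def)
  have "- c / 2 > 0" using c by simp
  with assms obtain w where w: "w \<in> BUC"
    and sub: "viscosity_subsolution UNIV (\<lambda>x q. H x (p + q) - (c + (- c / 2))) w"
    unfolding cell_value_def by blast
  obtain B where B: "\<And>x. \<bar>w x\<bar> \<le> B" using BUC_bounded[OF w] by blast
  obtain x0 where x0: "V x0 \<le> - c' / 2" using recurrence[of "- c' / 2"] c' by auto
  have "\<forall>\<^sub>F x in nhds x0. V x < - c'"
  proof -
    have "isCont V x0" using contV by (simp add: continuous_on_eq_continuous_at)
    then have "(V \<longlongrightarrow> V x0) (nhds x0)" by (simp add: isCont_def tendsto_at_iff_tendsto_nhds)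
    then show ?thesis by (rule order_tendstoD) (use x0 c' in simp)
  qed
  then obtain r where r: "r > 0" "\<And>x. dist x x0 < r \<Longrightarrow> V x < - c'"
    unfolding eventually_nhds_metric by blast
  \<comment> \<open>Then \<open>N * r\<^sup>2 = 2 * B + 1\<close> exceeds the oscillation of
    \<open>w\<close>, so the maximum lies within \<open>r\<close> of \<open>x0\<close>.\<close>
  define N where "N = (2 * B + 1) / r\<^sup>2"
  have B0: "B \<ge> 0" using B[of 0] by linarith
  have N: "N > 0" using B0 r by (simp add: N_def)
  have far: "w x - N * (x - x0)\<^sup>2 < w x0" if "\<bar>x - x0\<bar> \<ge> r" for x
  proof -
    have "r\<^sup>2 \<le> (x - x0)\<^sup>2" using that r(1) by (metis abs_le_square_iff abs_of_pos)
    then have "N * r\<^sup>2 \<le> N * (x - x0)\<^sup>2" using N by (intro mult_left_mono) auto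
    moreover have "N * r\<^sup>2 = 2 * B + 1" using r(1) by (simp add: N_def)
    ultimately show ?thesis using B[of x] B[of x0] by linarith
  qed
  have cf: "continuous_on UNIV (\<lambda>x. w x - N * (x - x0)\<^sup>2)"
    by (intro continuous_intros BUC_continuous[OF w])
  obtain y where y: "\<And>x. w x - N * (x - x0)\<^sup>2 \<le> w y - N * (y - x0)\<^sup>2"
    by (rule coercive_attains_max[OF cf, where ?x0.0 = x0 and R = r]) (use far less_imp_le in auto)
  have "\<bar>y - x0\<bar> < r" using far[of y] y[of x0] by (cases "\<bar>y - x0\<bar> < r") auto
  then have Vy: "V y < - c'" by (intro r(2)) (simp add: dist_real_def)
  have C1: "C1_on UNIV (\<lambda>x. N * (x - x0)\<^sup>2) (\<lambda>x. 2 * N * (x - x0))"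
    by (rule C1_onI_real) (auto intro!: derivative_eq_intros continuous_intros)
  have "H y (p + D y) - c' \<le> 0"
    if "C1_on UNIV \<phi> D" "\<forall>\<^sub>F z in nhds y. w z - \<phi> z \<le> w y - \<phi> y" for \<phi> D y
    using sub that unfolding viscosity_subsolution_def c'(2) by blast
  from this[OF C1 always_eventually] y have "H y (p + 2 * N * (y - x0)) - c' \<le> 0" by blast
  moreover have "0 \<le> 1 / 2 * \<bar>p + 2 * N * (y - x0)\<bar>\<^sup>2" by simp
  ultimately show False using Vy unfolding H_def by linarith
qed

text \<open>From above, the action is a subsolution for any
  \<open>\<bar>\<theta>\<bar> \<le> 1\<close>, which covers the flat part. From below, a value under
  \<open>Hb p\<close> forces \<open>Hb p > 0\<close> by \<open>cell_value_nonneg\<close>, and then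
  the action is an exact solution with \<open>\<theta>\<close> a sign.\<close>

lemma cell_value_unique:
  assumes c: "cell_value p c" shows "c = Hb p"
proof (rule antisym)
  define E where "E = Hb p"
  define A where "A = sqrt (2 * (E + K))"
  have E: "E \<ge> 0" using Hb(1) by (simp add: E_def)
  have A: "A \<ge> 0" using E K_nonneg by (simp add: A_def)
  show "c \<le> Hb p"
  proof (rule ccontr)
    assume "\<not> c \<le> Hb p"
    then have cE: "c > E" by (simp add: E_def)
    define \<delta> where "\<delta> = (c - E) / 2"
    have \<delta>: "\<delta> > 0" using cE by (simp add: \<delta>_def)
    define \<eta> where "\<eta> = min 1 (\<delta> / (2 * (A + 1)))"
    have \<eta>: "0 < \<eta>" "\<eta> \<le> 1" using \<delta> A by (auto simp: \<eta>_def)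
    have \<eta>A: "\<eta> * (A + 1) \<le> \<delta> / 2"
    proof -
      have "\<eta> * (A + 1) \<le> \<delta> / (2 * (A + 1)) * (A + 1)" using A by (intro mult_right_mono) (auto simp: \<eta>_def)
      also have "\<delta> / (2 * (A + 1)) * (A + 1) = \<delta> / 2" using A by (simp add: field_simps)
      finally show ?thesis .
    qed
    \<comment> \<open>If \<open>s E = 0\<close> then \<open>p = 0\<close>, and the convention for
      division by 0 gives a suitable value.\<close>
    define \<theta> where "\<theta> = p / s E"
    have sE: "\<bar>p\<bar> \<le> s E" using Hb(2) by (simp add: E_def)
    have p: "p = \<theta> * s E" "\<bar>\<theta>\<bar> \<le> 1"
      using sE s_nonneg[OF E] by (auto simp: \<theta>_def divide_le_eq)
    obtain w where w: "w \<in> BUC" and sup: "viscosity_supersolution UNIV (\<lambda>x q. H x (p + q) - (c - \<delta>)) w"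
      using c \<delta> unfolding cell_value_def by blast
    obtain y t where yt: "\<bar>t\<bar> \<le> 1" "H y (\<theta> * sqrt (2 * (E + V y)) + \<eta> * t) \<ge> c - \<delta>"
      using supersolution_vs_action[OF E p \<eta>(1) w sup] by blast
    have "c - \<delta> \<le> E + \<eta> * A + \<eta>\<^sup>2"
      using H_perturbed(1)[OF E yt(1) less_imp_le[OF \<eta>(1)] p(2), of y] yt(2) by (simp add: A_def)
    also have "\<eta>\<^sup>2 \<le> \<eta>" using \<eta> by (simp add: power2_eq_square mult_left_le)
    finally have "c - \<delta> \<le> E + \<eta> * (A + 1)" by (simp add: algebra_simps)
    then have "c - \<delta> \<le> E + \<delta> / 2" using \<eta>A by simp
    then show False using cE by (simp add: \<delta>_def field_simps)
  qed
  show "Hb p \<le> c"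
  proof (rule ccontr)
    assume "\<not> Hb p \<le> c"
    then have cE: "c < E" by (simp add: E_def)
    with cell_value_nonneg[OF c] have Ep: "E > 0" by simp
    define \<delta> where "\<delta> = (E - c) / 2"
    have \<delta>: "\<delta> > 0" using cE by (simp add: \<delta>_def)
    define \<eta> where "\<eta> = \<delta> / 2 / (A + 1)"
    have \<eta>: "0 < \<eta>" using \<delta> A by (auto simp: \<eta>_def)
    have "A + 1 \<noteq> 0" using A by simp
    from nonzero_eq_divide_eq[OF this, of \<eta> "\<delta> / 2"]
    have \<eta>A: "\<eta> * (A + 1) = \<delta> / 2" using \<eta>_def by blast
    obtain \<theta> where \<theta>: "\<bar>\<theta>\<bar> = 1" "p = \<theta> * \<bar>p\<bar>" by (rule ex_sign)
    have p: "p = \<theta> * s E" "\<bar>\<theta>\<bar> \<le> 1" using \<theta> Hb(3)[of p] Ep by (auto simp: E_def)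
    obtain w where w: "w \<in> BUC" and sub: "viscosity_subsolution UNIV (\<lambda>x q. H x (p + q) - (c + \<delta>)) w"
      using c \<delta> unfolding cell_value_def by blast
    obtain y t where yt: "\<bar>t\<bar> \<le> 1" "H y (\<theta> * sqrt (2 * (E + V y)) + \<eta> * t) \<le> c + \<delta>"
      using subsolution_vs_action[OF E p \<eta>(1) w sub] by blast
    have "E - \<eta> * A \<le> c + \<delta>"
      using H_perturbed(2)[OF E yt(1) less_imp_le[OF \<eta>] p(2) \<theta>(1), of y] yt(2) by (simp add: A_def)
    moreover have "\<eta> * A \<le> \<delta> / 2" using \<eta>A \<eta> by (simp add: algebra_simps)
    ultimately have "E - \<delta> / 2 \<le> c + \<delta>" by simp
    then show False using cE by (simp add: \<delta>_def field_simps)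
  qed
qed

lemma effective_hamiltonian_eq: "effective_hamiltonian H p = Hb p"
  unfolding effective_hamiltonian_def cell_value_def[symmetric]
  using cell_value_Hb cell_value_unique by (rule the_equality)

end

subsection \<open>Comparison arguments for evolution equations\<close>

abbreviation evolution :: "(real \<Rightarrow> real \<Rightarrow> real) \<Rightarrow> real \<times> real \<Rightarrow> real \<times> real \<Rightarrow> real" where
  "evolution H \<equiv> \<lambda>(x, t) (p, q). q + H x p"

lemma C1_on_pair:
  fixes \<phi> :: "real \<times> real \<Rightarrow> real"
  assumes "\<And>z. (\<phi> has_derivative (\<lambda>h. fst h * px z + snd h * pt z)) (at z)"
    "continuous_on UNIV px" "continuous_on UNIV pt"
  shows "C1_on \<Omega> \<phi> (\<lambda>z. (px z, pt z))"
  unfolding C1_on_def gderiv_def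
  using assms(1) continuous_on_Pair[OF assms(2,3)]
  by (auto simp: inner_prod_def intro: continuous_on_subset)

lemma subsolution_test:
  assumes "viscosity_subsolution (UNIV \<times> {0<..}) (evolution H) u"
    and \<phi>: "\<And>z. (\<phi> has_derivative (\<lambda>h. fst h * px z + snd h * pt z)) (at z)"
      "continuous_on UNIV px" "continuous_on UNIV pt"
    and t: "t > 0" and m: "\<forall>\<^sub>F z in nhds (x, t). u z - \<phi> z \<le> u (x, t) - \<phi> (x, t)"
  shows "pt (x, t) + H x (px (x, t)) \<le> 0"
proof -
  have "(x, t) \<in> UNIV \<times> {0<..}" using t by simp
  with assms(1) C1_on_pair[OF \<phi>, of "UNIV \<times> {0<..}"] m
  have "evolution H (x, t) (px (x, t), pt (x, t)) \<le> 0"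
    unfolding viscosity_subsolution_def by blast
  then show ?thesis by simp
qed

lemma supersolution_test:
  assumes "viscosity_supersolution (UNIV \<times> {0<..}) (evolution H) u"
    and \<phi>: "\<And>z. (\<phi> has_derivative (\<lambda>h. fst h * px z + snd h * pt z)) (at z)"
      "continuous_on UNIV px" "continuous_on UNIV pt"
    and t: "t > 0" and m: "\<forall>\<^sub>F z in nhds (x, t). u z - \<phi> z \<ge> u (x, t) - \<phi> (x, t)"
  shows "pt (x, t) + H x (px (x, t)) \<ge> 0"
proof -
  have "(x, t) \<in> UNIV \<times> {0<..}" using t by simp
  with assms(1) C1_on_pair[OF \<phi>, of "UNIV \<times> {0<..}"] m
  have "evolution H (x, t) (px (x, t), pt (x, t)) \<ge> 0"
    unfolding viscosity_supersolution_def by blast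
  then show ?thesis by simp
qed

text \<open>Squaring removes the kink, so this is an admissible C1 barrier in time.\<close>

lemma DERIV_max_square:
  "((\<lambda>s. (max 0 (s - b))\<^sup>2) has_real_derivative 2 * max 0 (t - b)) (at (t::real))"
proof -
  have 0: "((\<lambda>s. (max 0 s)\<^sup>2) has_real_derivative 2 * max 0 s) (at s)" for s :: real
  proof (cases s "0 :: real" rule: linorder_cases)
    case less
    have "((\<lambda>s::real. 0::real) has_real_derivative 0) (at s)" by simp
    then have "((\<lambda>s. (max 0 s)\<^sup>2) has_real_derivative 0) (at s)"
      by (rule has_field_derivative_transform_within_open[where S = "{..<0}"]) (use less in auto)
    then show ?thesis using less by simp
  next
    case greater
    have "((\<lambda>s::real. s\<^sup>2) has_real_derivative 2 * s) (at s)" by (auto intro!: derivative_eq_intros)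
    then have "((\<lambda>s. (max 0 s)\<^sup>2) has_real_derivative 2 * s) (at s)"
      by (rule has_field_derivative_transform_within_open[where S = "{0<..}"]) (use greater in auto)
    then show ?thesis using greater by simp
  next
    case equal
    have "((\<lambda>h. (max 0 h)\<^sup>2 / h) \<longlongrightarrow> 0) (at (0::real))"
    proof (rule tendsto_rabs_zero_cancel, rule tendsto_sandwich[OF always_eventually always_eventually tendsto_const])
      show "((\<lambda>h. \<bar>h\<bar>) \<longlongrightarrow> 0) (at (0::real))" by (intro tendsto_eq_intros) auto
      show "\<forall>h::real. \<bar>(max 0 h)\<^sup>2 / h\<bar> \<le> \<bar>h\<bar>"
        by (auto simp: max_def power2_eq_square)
    qed auto
    then show ?thesis using equal by (simp add: DERIV_def)
  qed
  have "((\<lambda>s. s - b) has_real_derivative 1) (at t)" by (auto intro!: derivative_eq_intros)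
  from DERIV_chain2[where f = "\<lambda>s. (max 0 s)\<^sup>2" and g = "\<lambda>s. s - b" and x = t, OF 0 this]
  show ?thesis by simp
qed

lemma has_derivative_snd_comp:
  fixes f :: "real \<Rightarrow> real"
  assumes "(f has_real_derivative D) (at (snd z))"
  shows "((\<lambda>z. f (snd z)) has_derivative (\<lambda>h. snd h * D)) (at (z :: real \<times> real))"
proof -
  have "(f has_derivative (\<lambda>h. h * D)) (at (snd z))"
    using assms by (simp add: has_field_derivative_def mult_commute_abs)
  from has_derivative_compose[OF has_derivative_snd[OF has_derivative_ident] this]
  show ?thesis by simp
qed

text \<open>Penalising the distance to the curve turns the subsolution into a subsolution of an
  ordinary differential inequality; the term \<open>N max(0, t - b)\<^sup>2\<close> keeps the maximum away from the
  final time.\<close>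

lemma subsolution_along_curve:
  fixes u :: "real \<times> real \<Rightarrow> real" and g \<Phi> :: "real \<Rightarrow> real"
  assumes contu: "continuous_on (UNIV \<times> {0..}) u"
    and sub: "viscosity_subsolution (UNIV \<times> {0<..}) (evolution H) u"
    and ab: "0 \<le> a" "a < b"
    and g: "\<And>t. (g has_real_derivative g' t) (at t)" "continuous_on UNIV g'"
    and \<Phi>: "\<And>t. (\<Phi> has_real_derivative \<Phi>' t) (at t)" "continuous_on UNIV \<Phi>'"
    and c: "continuous_on UNIV c" "\<And>x t q. q * g' t - H x q \<le> c (x, t)" "\<And>t. c (g t, t) \<le> \<Phi>' t"
  shows "u (g b, b) - u (g a, a) \<le> \<Phi> b - \<Phi> a"
proof (rule ccontr)
  assume neg: "\<not> ?thesis"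
  define \<theta> where "\<theta> = u (g b, b) - u (g a, a) - (\<Phi> b - \<Phi> a)"
  have \<theta>: "\<theta> > 0" using neg by (simp add: \<theta>_def)
  define \<eta> where "\<eta> = \<theta> / 4 / (b - a)"
  have \<eta>: "\<eta> > 0" using \<theta> ab by (simp add: \<eta>_def)
  have \<eta>ab: "\<eta> * (b - a) = \<theta> / 4"
    using \<eta>_def nonzero_eq_divide_eq[of "b - a" \<eta> "\<theta> / 4"] ab by simp
  \<comment> \<open>Coordinates relative to the curve: displacement and time. Time runs past
    \<open>b\<close>, where the equation still holds, so that the maximum can be kept off the
    boundary.\<close>
  define Q where "Q = {-1..1::real} \<times> {a..b + 1}"
  have Q: "compact Q" unfolding Q_def by (intro compact_Times) auto
  have cg: "continuous_on UNIV g" using g(1) by (rule DERIV_continuous_on_UNIV)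
  have c\<Phi>: "continuous_on UNIV \<Phi>" using \<Phi>(1) by (rule DERIV_continuous_on_UNIV)
  have cg2: "continuous_on A (\<lambda>z. g (snd z))" for A :: "(real \<times> real) set"
    by (rule continuous_on_compose2[OF cg]) (auto intro!: continuous_intros)
  have c\<Phi>2: "continuous_on A (\<lambda>z. \<Phi> (snd z))" for A :: "(real \<times> real) set"
    by (rule continuous_on_compose2[OF c\<Phi>]) (auto intro!: continuous_intros)
  define U where "U z = u (g (snd z) + fst z, snd z)" for z
  define Cc where "Cc z = c (g (snd z) + fst z, snd z)" for z
  have cU: "continuous_on Q U" unfolding U_def
    by (rule continuous_on_compose2[OF contu]) (use ab in \<open>auto simp: Q_def intro!: continuous_intros cg2\<close>)
  have cC: "continuous_on Q Cc" unfolding Cc_def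
    by (rule continuous_on_compose2[OF c(1)]) (auto intro!: continuous_intros cg2)
  have "uniformly_continuous_on Q U" by (rule compact_uniformly_continuous[OF cU Q])
  then obtain \<rho>1 where \<rho>1: "\<rho>1 > 0" "\<And>z z'. z \<in> Q \<Longrightarrow> z' \<in> Q \<Longrightarrow> dist z' z < \<rho>1 \<Longrightarrow> dist (U z') (U z) < \<theta> / 4"
    using \<theta> unfolding uniformly_continuous_on_def by (metis divide_pos_pos zero_less_numeral)
  have "uniformly_continuous_on Q Cc" by (rule compact_uniformly_continuous[OF cC Q])
  then obtain \<rho>2 where \<rho>2: "\<rho>2 > 0" "\<And>z z'. z \<in> Q \<Longrightarrow> z' \<in> Q \<Longrightarrow> dist z' z < \<rho>2 \<Longrightarrow> dist (Cc z') (Cc z) < \<eta> / 2"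
    using \<eta> unfolding uniformly_continuous_on_def by (metis divide_pos_pos zero_less_numeral)
  define \<rho> where "\<rho> = min 1 (min \<rho>1 \<rho>2)"
  have \<rho>: "0 < \<rho>" "\<rho> \<le> 1" "\<rho> \<le> \<rho>1" "\<rho> \<le> \<rho>2" using \<rho>1 \<rho>2 by (auto simp: \<rho>_def)
  obtain M where "\<forall>y\<in>U ` Q. norm y \<le> M"
    using compact_imp_bounded[OF compact_continuous_image[OF cU Q]] unfolding bounded_iff ..
  then have M: "\<And>z. z \<in> Q \<Longrightarrow> \<bar>U z\<bar> \<le> M" by simp
  obtain M' where "\<forall>y\<in>(\<lambda>z. \<Phi> (snd z)) ` Q. norm y \<le> M'"
    using compact_imp_bounded[OF compact_continuous_image[OF c\<Phi>2 Q]] unfolding bounded_iff ..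
  then have M': "\<And>z. z \<in> Q \<Longrightarrow> \<bar>\<Phi> (snd z)\<bar> \<le> M'" by simp
  have b0: "(0, b) \<in> Q" "(0, a) \<in> Q" using ab by (auto simp: Q_def)
  have MM: "M \<ge> 0" "M' \<ge> 0" using M[OF b0(1)] M'[OF b0(1)] by linarith+
  \<comment> \<open>At time \<open>b + 1\<close> the barrier equals \<open>N\<close>, more than
    \<open>U\<close> and \<open>\<Phi>\<close> can compensate.\<close>
  define N where "N = 2 * M + 2 * M' + 1"
  have N: "N > 0" using MM by (simp add: N_def)
  define B where "B = 2 * M + 2 * M' + \<theta> / 4"
  have B: "B > 0" using MM \<theta> by (simp add: B_def)
  \<comment> \<open>Comparison with the point \<open>(0, b)\<close> gives
    \<open>r\<^sup>2 \<le> B * \<alpha>\<close>; this choice makes the displacement smaller than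
    \<open>\<rho>\<close>, within the moduli of continuity fixed above.\<close>
  define \<alpha> where "\<alpha> = \<rho>\<^sup>2 / (2 * B)"
  have \<alpha>: "\<alpha> > 0" using \<rho> B by (simp add: \<alpha>_def)
  define \<phi> where "\<phi> z = \<Phi> (snd z) + \<eta> * snd z + N * (max 0 (snd z - b))\<^sup>2 + (fst z - g (snd z))\<^sup>2 / \<alpha>" for z
  define W where "W z = U z - \<phi> (g (snd z) + fst z, snd z)" for z
  have cW: "continuous_on Q W" unfolding W_def \<phi>_def
    by (auto intro!: continuous_intros cU c\<Phi>2 cg2 simp: \<alpha>[THEN less_imp_neq, THEN not_sym])
  obtain r t where rt: "(r, t) \<in> Q" and mx: "\<And>z. z \<in> Q \<Longrightarrow> W z \<le> W (r, t)"
    using continuous_attains_sup[OF Q _ cW] b0 by (metis empty_iff surj_pair)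
  have Wrt: "W (r, t) = U (r, t) - (\<Phi> t + \<eta> * t + N * (max 0 (t - b))\<^sup>2 + r\<^sup>2 / \<alpha>)"
    by (simp add: W_def \<phi>_def)
  have Wb: "W (0, b) = U (0, b) - (\<Phi> b + \<eta> * b)" by (simp add: W_def \<phi>_def)
  have le: "W (0, b) \<le> W (r, t)" by (rule mx[OF b0(1)])
  have tab: "a \<le> t" "t \<le> b + 1" using rt by (auto simp: Q_def)
  have pos: "0 \<le> N * (max 0 (t - b))\<^sup>2" "0 \<le> r\<^sup>2 / \<alpha>" using N \<alpha> by auto
  have bd: "\<bar>U (r, t)\<bar> \<le> M" "\<bar>U (0, b)\<bar> \<le> M" "\<bar>\<Phi> t\<bar> \<le> M'" "\<bar>\<Phi> b\<bar> \<le> M'"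
    using M[OF rt] M[OF b0(1)] M'[OF rt] M'[OF b0(1)] by auto
  have "\<eta> * (b - t) \<le> \<eta> * (b - a)" using \<eta> tab by (intro mult_left_mono) auto
  then have \<eta>t: "\<eta> * b - \<eta> * t \<le> \<theta> / 4" using \<eta>ab by (simp add: right_diff_distrib)
  have "r\<^sup>2 / \<alpha> \<le> B"
    using le pos bd \<eta>t unfolding Wrt Wb B_def by linarith
  then have "r\<^sup>2 \<le> B * \<alpha>" using \<alpha> by (simp add: divide_le_eq)
  also have "\<dots> = \<rho>\<^sup>2 / 2" using B by (simp add: \<alpha>_def)
  also have "\<dots> < \<rho>\<^sup>2" using \<rho> by simp
  finally have r: "\<bar>r\<bar> < \<rho>" using \<rho>(1) by (metis abs_of_pos power2_abs power2_less_imp_less less_imp_le)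
  \<comment> \<open>At the initial time the assumed excess \<open>\<theta>\<close> would face only
    \<open>\<theta> / 4\<close> from the displacement and \<open>\<theta> / 4\<close> from the term
    in \<open>\<eta>\<close>.\<close>
  have ta: "t \<noteq> a"
  proof
    assume t: "t = a"
    have "dist (r, a) (0, a) < \<rho>1" using r \<rho> by (simp add: dist_prod_def dist_real_def)
    from \<rho>1(2)[OF b0(2) _ this] rt t have "\<bar>U (r, t) - U (0, a)\<bar> < \<theta> / 4" unfolding dist_real_def by blast
    then have "U (r, a) < U (0, a) + \<theta> / 4" unfolding t by linarith
    moreover have "U (0, b) = U (0, a) + \<theta> + (\<Phi> b - \<Phi> a)" by (simp add: U_def \<theta>_def)
    moreover have "\<eta> * b - \<eta> * a \<le> \<theta> / 4" using \<eta>t t by simp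
    ultimately show False using le[unfolded t] Wrt[unfolded t] Wb pos[unfolded t] \<theta> t by linarith
  qed
  have tb: "t \<noteq> b + 1"
  proof
    assume t: "t = b + 1"
    have "N * (max 0 (t - b))\<^sup>2 = N" using t by simp
    moreover have "\<eta> * b - \<eta> * t \<le> 0" using \<eta> t by (simp add: distrib_left)
    ultimately show False using le pos(2) bd unfolding Wrt Wb N_def by linarith
  qed
  have t: "a < t" "t < b + 1" using ta tb tab by auto
  define x where "x = g t + r"
  define px where "px z = 2 * (fst z - g (snd z)) / \<alpha>" for z
  \<comment> \<open>The penalty moves with the curve; this yields the term
    \<open>px z * g' (snd z)\<close>, paired with the Hamiltonian in the hypothesis on
    \<open>c\<close>.\<close>
  define pt where "pt z = \<Phi>' (snd z) + \<eta> + N * (2 * max 0 (snd z - b)) - px z * g' (snd z)" for z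
  have D: "(\<phi> has_derivative (\<lambda>h. fst h * px z + snd h * pt z)) (at z)" for z
  proof -
    have "((\<lambda>z. (fst z - g (snd z))\<^sup>2) has_derivative
       (\<lambda>h. 2 * (fst z - g (snd z)) * (fst h - snd h * g' (snd z)))) (at z)"
      by (auto intro!: derivative_eq_intros has_derivative_snd_comp[OF g(1)] simp: field_simps)
    from bounded_linear.has_derivative[OF bounded_linear_divide this, of \<alpha>]
    have "((\<lambda>z. (fst z - g (snd z))\<^sup>2 / \<alpha>) has_derivative
       (\<lambda>h. 2 * (fst z - g (snd z)) * (fst h - snd h * g' (snd z)) / \<alpha>)) (at z)" .
    moreover have "((\<lambda>z. \<eta> * snd z) has_derivative (\<lambda>h. \<eta> * snd h)) (at z)"
      by (auto intro!: derivative_eq_intros)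
    ultimately have "(\<phi> has_derivative (\<lambda>h. snd h * \<Phi>' (snd z) + \<eta> * snd h + N * (snd h * (2 * max 0 (snd z - b)))
       + 2 * (fst z - g (snd z)) * (fst h - snd h * g' (snd z)) / \<alpha>)) (at z)"
      unfolding \<phi>_def[abs_def]
      by (intro has_derivative_add has_derivative_mult_right has_derivative_snd_comp[OF \<Phi>(1)]
          has_derivative_snd_comp[OF DERIV_max_square]) (auto intro!: derivative_eq_intros)
    moreover have "(\<lambda>h. snd h * \<Phi>' (snd z) + \<eta> * snd h + N * (snd h * (2 * max 0 (snd z - b)))
       + 2 * (fst z - g (snd z)) * (fst h - snd h * g' (snd z)) / \<alpha>) = (\<lambda>h. fst h * px z + snd h * pt z)"
      by (rule ext) (simp add: px_def pt_def algebra_simps add_divide_distrib diff_divide_distrib)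
    ultimately show ?thesis by simp
  qed
  have cpx: "continuous_on UNIV px" unfolding px_def
    by (auto intro!: continuous_intros cg2 simp: \<alpha>[THEN less_imp_neq, THEN not_sym])
  have cpt: "continuous_on UNIV pt" unfolding pt_def
    by (intro continuous_intros cpx continuous_on_compose2[OF \<Phi>(2)] continuous_on_compose2[OF g(2)]) auto
  have mloc: "\<forall>\<^sub>F z in nhds (x, t). u z - \<phi> z \<le> u (x, t) - \<phi> (x, t)"
  proof -
    define O' where "O' = {z :: real \<times> real. a < snd z \<and> snd z < b + 1 \<and> \<bar>fst z - g (snd z)\<bar> < 1}"
    have "open O'" unfolding O'_def
      by (intro open_Collect_conj open_Collect_less continuous_intros cg2)
    moreover have "(x, t) \<in> O'" using t r \<rho> by (simp add: O'_def x_def)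
    ultimately have "\<forall>\<^sub>F z in nhds (x, t). z \<in> O'" by (rule eventually_nhds_in_open)
    then show ?thesis
    proof (rule eventually_mono)
      fix z assume z: "z \<in> O'"
      then have "(fst z - g (snd z), snd z) \<in> Q" by (auto simp: O'_def Q_def abs_less_iff)
      from mx[OF this] show "u z - \<phi> z \<le> u (x, t) - \<phi> (x, t)" by (simp add: W_def U_def x_def)
    qed
  qed
  have t0: "t > 0" using t ab by simp
  from subsolution_test[OF sub D cpx cpt t0 mloc]
  have 1: "pt (x, t) + H x (px (x, t)) \<le> 0" .
  have 2: "px (x, t) * g' t - H x (px (x, t)) \<le> c (x, t)" by (rule c(2))
  have "dist (r, t) (0, t) < \<rho>2" using r \<rho> by (simp add: dist_prod_def dist_real_def)
  moreover have "(0, t) \<in> Q" using tab by (simp add: Q_def)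
  ultimately have "\<bar>Cc (r, t) - Cc (0, t)\<bar> < \<eta> / 2" using \<rho>2(2)[OF _ rt] unfolding dist_real_def by blast
  then have "Cc (r, t) < Cc (0, t) + \<eta> / 2" by linarith
  then have 3: "c (x, t) < \<Phi>' t + \<eta> / 2" using c(3)[of t] by (simp add: Cc_def x_def)
  have 4: "pt (x, t) \<ge> \<Phi>' t + \<eta> - px (x, t) * g' t" using N by (simp add: pt_def)
  show False using 1 2 3 4 \<eta> by linarith
qed

text \<open>Supersolutions alone may come down from infinity in finite time, so a lower growth
  bound is required; the penalisation \<open>\<beta> e\<^sup>c\<^sup>t (1 + x\<^sup>2)\<close> exploits it.\<close>

lemma supersolution_above_classical:
  fixes u w :: "real \<times> real \<Rightarrow> real"
  assumes contu: "continuous_on (UNIV \<times> {0..}) u"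
    and sup: "viscosity_supersolution (UNIV \<times> {0<..}) (evolution H) u"
    and w: "\<And>z. (w has_derivative (\<lambda>h. fst h * wx z + snd h * wt z)) (at z)"
      "continuous_on UNIV wx" "continuous_on UNIV wt"
    and eq: "\<And>z. wt z + H (fst z) (wx z) \<le> 0" and P: "\<And>z. \<bar>wx z\<bar> \<le> P"
    and Hinc: "\<And>x p q. \<bar>p\<bar> \<le> P \<Longrightarrow> H x (p + q) \<le> H x p + B * (\<bar>q\<bar> + q\<^sup>2)" and B: "B \<ge> 0"
    and wm: "\<And>z. w z \<le> m"
    and growth: "\<And>\<beta>. \<beta> > 0 \<Longrightarrow> \<exists>A. \<forall>x. \<forall>t\<in>{0..2}. u (x, t) \<ge> - A - \<beta> * x\<^sup>2"
    and init: "\<And>x. w (x, 0) \<le> u (x, 0)"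
  shows "w (0, 1) \<le> u (0, 1)"
proof (rule ccontr)
  assume neg: "\<not> ?thesis"
  define \<theta> where "\<theta> = w (0, 1) - u (0, 1)"
  have \<theta>: "\<theta> > 0" using neg by (simp add: \<theta>_def)
  \<comment> \<open>The growth rate of the penalty dominates the cost
    \<open>B * (\<bar>q\<bar> + q\<^sup>2)\<close> of its gradient; the extra 1 makes the inequality
    strict.\<close>
  define c where "c = 2 * B + 1"
  have c: "c > 0" using B by (simp add: c_def)
  \<comment> \<open>The first bound controls the square of the gradient of the penalty up to time 2;
    the second keeps the penalty at (0,1) at most half the assumed gap.\<close>
  define \<beta> where "\<beta> = min (exp (- (c * 2)) / 4) (\<theta> / (2 * exp c))"
  have \<beta>: "\<beta> > 0" using \<theta> by (simp add: \<beta>_def)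
  have \<beta>1: "\<beta> * exp c \<le> \<theta> / 2"
  proof -
    have "\<beta> * exp c \<le> \<theta> / (2 * exp c) * exp c" by (intro mult_right_mono) (auto simp: \<beta>_def)
    then show ?thesis by simp
  qed
  have \<beta>2: "4 * (\<beta> * exp (c * t)) \<le> 1" if "t \<le> 2" for t
  proof -
    have "\<beta> * exp (c * t) \<le> exp (- (c * 2)) / 4 * exp (c * 2)"
      using that c \<beta> by (intro mult_mono) (auto simp: \<beta>_def)
    also have "\<dots> = 1 / 4" by (simp add: exp_minus)
    finally show ?thesis by simp
  qed
  \<comment> \<open>Half of the quadratic penalty absorbs the growth of \<open>u\<close>; the other
    half confines the minimum.\<close>
  have "\<beta> / 2 > 0" using \<beta> by simp
  from growth[OF this] obtain A where "\<forall>x. \<forall>t\<in>{0..2}. u (x, t) \<ge> - A - \<beta> / 2 * x\<^sup>2" ..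
  then have A: "\<And>x t. t \<in> {0..2} \<Longrightarrow> u (x, t) \<ge> - A - \<beta> / 2 * x\<^sup>2" by blast
  \<comment> \<open>Large enough to make the difference positive at time 2, through the barrier, and
    at \<open>\<bar>x\<bar> = R\<close>, through the remaining quadratic.\<close>
  define N where "N = \<bar>A\<bar> + \<bar>m\<bar> + 1"
  have N: "N > 0" by (simp add: N_def)
  define R where "R = sqrt (2 * N / \<beta>)"
  have R: "R > 0" "\<beta> / 2 * R\<^sup>2 = N" using N \<beta> by (auto simp: R_def)
  define e where "e z = \<beta> * exp (c * snd z) * (1 + (fst z)\<^sup>2)" for z :: "real \<times> real"
  define \<phi> where "\<phi> z = w z - e z - N * (max 0 (snd z - 1))\<^sup>2" for z
  have low: "u (x, t) - \<phi> (x, t) \<ge> - A - m + \<beta> / 2 * x\<^sup>2 + N * (max 0 (t - 1))\<^sup>2" if t: "t \<in> {0..2}" for x t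
  proof -
    have "\<beta> * 1 * (1 + x\<^sup>2) \<le> e (x, t)" unfolding e_def using \<beta> c t
      by (intro mult_mono) auto
    moreover have "\<beta> * 1 * (1 + x\<^sup>2) = \<beta> + 2 * (\<beta> / 2 * x\<^sup>2)" by (simp add: distrib_left)
    ultimately have "e (x, t) \<ge> 2 * (\<beta> / 2 * x\<^sup>2)" using \<beta> by linarith
    then show ?thesis using A[OF t, of x] wm[of "(x, t)"] unfolding \<phi>_def by simp
  qed
  define Q where "Q = {-R..R} \<times> {0..2::real}"
  have Q: "compact Q" unfolding Q_def by (intro compact_Times) auto
  have cw: "continuous_on Q w"
    using w(1) by (meson continuous_at_imp_continuous_on has_derivative_continuous)
  have cf: "continuous_on Q (\<lambda>z. u z - \<phi> z)" unfolding \<phi>_def e_def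
    by (intro continuous_intros cw continuous_on_subset[OF contu]) (auto simp: Q_def)
  have q01: "(0, 1) \<in> Q" using R by (simp add: Q_def)
  obtain y t where yt: "(y, t) \<in> Q" and mn: "\<And>z. z \<in> Q \<Longrightarrow> u (y, t) - \<phi> (y, t) \<le> u z - \<phi> z"
    using continuous_attains_inf[OF Q _ cf] q01 by (metis empty_iff surj_pair)
  have "u (0, 1) - \<phi> (0, 1) < 0" using \<beta>1 \<theta> unfolding \<phi>_def e_def \<theta>_def by simp
  then have negv: "u (y, t) - \<phi> (y, t) < 0" using mn[OF q01] by linarith
  have t02: "t \<in> {0..2}" using yt by (simp add: Q_def)
  have t0: "t \<noteq> 0"
  proof
    assume "t = 0"
    moreover have "\<beta> * (1 + y\<^sup>2) > 0" using \<beta> by (simp add: add_pos_nonneg)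
    ultimately show False using negv init[of y] by (simp add: \<phi>_def e_def)
  qed
  have t2: "t \<noteq> 2"
  proof
    assume t: "t = 2"
    have "0 \<le> \<beta> / 2 * y\<^sup>2" using \<beta> by simp
    then show False using low[OF t02, of y] negv t by (simp add: N_def)
  qed
  have yR: "\<bar>y\<bar> < R"
  proof (rule ccontr)
    assume "\<not> \<bar>y\<bar> < R"
    then have "\<bar>y\<bar> = R" using yt by (auto simp: Q_def)
    then have "\<beta> / 2 * y\<^sup>2 = N" using R(2) by (metis power2_abs)
    moreover have "0 \<le> N * (max 0 (t - 1))\<^sup>2" using N by simp
    ultimately show False using low[OF t02, of y] negv unfolding N_def by linarith
  qed
  define q where "q z = - (2 * \<beta> * exp (c * snd z) * fst z)" for z :: "real \<times> real"
  define px where "px z = wx z + q z" for z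
  define pt where "pt z = wt z - c * e z - N * (2 * max 0 (snd z - 1))" for z
  have D: "(\<phi> has_derivative (\<lambda>h. fst h * px z + snd h * pt z)) (at z)" for z
  proof -
    have "(\<phi> has_derivative (\<lambda>h. (fst h * wx z + snd h * wt z)
      - (\<beta> * (exp (c * snd z) * (c * snd h)) * (1 + (fst z)\<^sup>2) + \<beta> * exp (c * snd z) * (2 * fst z * fst h))
      - N * (snd h * (2 * max 0 (snd z - 1))))) (at z)"
    proof -
      have "(e has_derivative (\<lambda>h. \<beta> * (exp (c * snd z) * (c * snd h)) * (1 + (fst z)\<^sup>2)
          + \<beta> * exp (c * snd z) * (2 * fst z * fst h))) (at z)"
        unfolding e_def[abs_def] by (auto intro!: derivative_eq_intros simp: field_simps)
      then show ?thesis unfolding \<phi>_def[abs_def]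
        by (intro has_derivative_diff has_derivative_mult_right w(1) has_derivative_snd_comp[OF DERIV_max_square])
    qed
    moreover have "(\<lambda>h. (fst h * wx z + snd h * wt z)
      - (\<beta> * (exp (c * snd z) * (c * snd h)) * (1 + (fst z)\<^sup>2) + \<beta> * exp (c * snd z) * (2 * fst z * fst h))
      - N * (snd h * (2 * max 0 (snd z - 1)))) = (\<lambda>h. fst h * px z + snd h * pt z)"
      by (rule ext) (simp add: px_def pt_def q_def e_def algebra_simps)
    ultimately show ?thesis by simp
  qed
  have cpx: "continuous_on UNIV px" unfolding px_def q_def by (intro continuous_intros w(2))
  have cpt: "continuous_on UNIV pt" unfolding pt_def e_def by (intro continuous_intros w(3))
  have mloc: "\<forall>\<^sub>F z in nhds (y, t). u z - \<phi> z \<ge> u (y, t) - \<phi> (y, t)"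
  proof -
    have "open ({-R<..<R} \<times> {0<..<2::real})" by (intro open_Times) auto
    moreover have "(y, t) \<in> {-R<..<R} \<times> {0<..<2}" using t02 t0 t2 yR by auto
    ultimately have "\<forall>\<^sub>F z in nhds (y, t). z \<in> {-R<..<R} \<times> {0<..<2}" by (rule eventually_nhds_in_open)
    then show ?thesis by (rule eventually_mono) (auto intro!: mn simp: Q_def)
  qed
  have tp: "t > 0" using t02 t0 by simp
  from supersolution_test[OF sup D cpx cpt tp mloc]
  have 1: "pt (y, t) + H y (px (y, t)) \<ge> 0" .
  have 2: "H y (px (y, t)) \<le> H y (wx (y, t)) + B * (\<bar>q (y, t)\<bar> + (q (y, t))\<^sup>2)"
    unfolding px_def by (rule Hinc[OF P])
  define E where "E = \<beta> * exp (c * t)"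
  have E: "E > 0" "4 * E \<le> 1" using \<beta> \<beta>2 t02 by (auto simp: E_def)
  have qE: "\<bar>q (y, t)\<bar> = 2 * E * \<bar>y\<bar>" using \<beta> by (simp add: q_def E_def abs_mult)
  have "2 * \<bar>y\<bar> \<le> 1 + y\<^sup>2" using zero_le_power2[of "\<bar>y\<bar> - 1"] by (simp add: power2_diff)
  then have "E * (2 * \<bar>y\<bar>) \<le> E * (1 + y\<^sup>2)" using E by (intro mult_left_mono) auto
  moreover have "(q (y, t))\<^sup>2 \<le> E * (1 + y\<^sup>2)"
  proof -
    have "(q (y, t))\<^sup>2 = (4 * E) * (E * y\<^sup>2)"
    proof -
      have "(q (y, t))\<^sup>2 = (2 * E * \<bar>y\<bar>)\<^sup>2" unfolding qE[symmetric] by simp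
      then show ?thesis by (simp add: power_mult_distrib power2_eq_square)
    qed
    also have "\<dots> \<le> 1 * (E * y\<^sup>2)" using E by (intro mult_right_mono) auto
    also have "\<dots> \<le> E * (1 + y\<^sup>2)" using E by (simp add: distrib_left)
    finally show ?thesis .
  qed
  ultimately have "\<bar>q (y, t)\<bar> + (q (y, t))\<^sup>2 \<le> 2 * (E * (1 + y\<^sup>2))" unfolding qE by simp
  then have "B * (\<bar>q (y, t)\<bar> + (q (y, t))\<^sup>2) \<le> B * (2 * (E * (1 + y\<^sup>2)))" using B by (rule mult_left_mono)
  moreover have "c * e (y, t) = B * (2 * (E * (1 + y\<^sup>2))) + E * (1 + y\<^sup>2)"
    by (simp add: e_def E_def c_def algebra_simps)
  moreover have "E * (1 + y\<^sup>2) > 0" using E by (simp add: add_pos_nonneg)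
  moreover have "N * (2 * max 0 (t - 1)) \<ge> 0" using N by simp
  ultimately show False using 1 2 eq[of "(y, t)"] unfolding pt_def by simp
qed

subsection \<open>Lower bounds for solutions\<close>

lemma mean_value_between:
  fixes f :: "real \<Rightarrow> real"
  assumes "\<And>x. (f has_real_derivative f' x) (at x)"
  obtains z where "\<bar>z - a\<bar> \<le> \<bar>b - a\<bar>" "f b - f a = (b - a) * f' z"
proof (cases a b rule: linorder_cases)
  case less
  then obtain z where "a < z" "z < b" "f b - f a = (b - a) * f' z" using MVT2[OF less] assms by blast
  then show ?thesis using that[of z] by simp
next
  case equal
  then show ?thesis using that[of a] by simp
next
  case greater
  then obtain z where z: "b < z" "z < a" "f a - f b = (a - b) * f' z" using MVT2[OF greater] assms by blast
  then have "f b - f a = (b - a) * f' z" by (simp add: algebra_simps)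
  then show ?thesis using that[of z] z by simp
qed

text \<open>The term \<open>\<kappa> E\<^sup>2\<close> makes the maximiser
  unique and continuous, hence the maximum of class \<open>C\<^sup>1\<close> by Danskin's theorem.\<close>

locale energy_family =
  fixes G g :: "real \<Rightarrow> real \<Rightarrow> real" and M \<kappa> P :: real
  assumes M: "M \<ge> 0" and \<kappa>: "\<kappa> > 0"
    and G_deriv: "\<And>E y. E \<in> {0..M} \<Longrightarrow> (G E has_real_derivative g E y) (at y)"
    and g_cont: "continuous_on ({0..M} \<times> UNIV) (\<lambda>z. g (fst z) (snd z))"
    and g_bound: "\<And>E y. E \<in> {0..M} \<Longrightarrow> \<bar>g E y\<bar> \<le> P"
    and G_0: "\<And>E. G E 0 = 0"
    and G_nonneg: "\<And>E y. E \<in> {0..M} \<Longrightarrow> 0 \<le> G E y"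
    and G_concave: "\<And>E E' y. E \<in> {0..M} \<Longrightarrow> E' \<in> {0..M} \<Longrightarrow> (G E y + G E' y) / 2 \<le> G ((E + E') / 2) y"
    and G_cont: "\<And>y. continuous_on {0..M} (\<lambda>E. G E y)"
begin

text \<open>\<open>snd z\<close> is the time remaining until the vertex of the cone. Without the
  term in \<open>\<kappa>\<close> the maximum over \<open>E\<close> would be an envelope of
  separated functions of position and time.\<close>

definition \<Phi> :: "real \<times> real \<Rightarrow> real \<Rightarrow> real" where
  "\<Phi> z E = G E (fst z) - E * snd z - \<kappa> * E\<^sup>2"

definition Es :: "real \<times> real \<Rightarrow> real" where
  "Es z = (SOME E. E \<in> {0..M} \<and> (\<forall>E'\<in>{0..M}. \<Phi> z E' \<le> \<Phi> z E))"

definition A :: "real \<times> real \<Rightarrow> real" where "A z = \<Phi> z (Es z)"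

lemma Es: "Es z \<in> {0..M}" "E \<in> {0..M} \<Longrightarrow> \<Phi> z E \<le> A z"
proof -
  have "continuous_on {0..M} (\<Phi> z)" unfolding \<Phi>_def by (intro continuous_intros G_cont)
  then have "\<exists>E\<in>{0..M}. \<forall>E'\<in>{0..M}. \<Phi> z E' \<le> \<Phi> z E"
    using M by (intro continuous_attains_sup) auto
  then have "\<exists>E. E \<in> {0..M} \<and> (\<forall>E'\<in>{0..M}. \<Phi> z E' \<le> \<Phi> z E)" by blast
  from someI_ex[OF this, folded Es_def] show "Es z \<in> {0..M}" "E \<in> {0..M} \<Longrightarrow> \<Phi> z E \<le> A z"
    by (auto simp: A_def)
qed

text \<open>At the midpoint of \<open>E\<close> and the maximiser, concavity of \<open>G\<close> and
  the parallelogram identity for squares give a gain quadratic in the distance, yet the value there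
  cannot exceed the maximum.\<close>

lemma strong_maximum:
  assumes E: "E \<in> {0..M}" shows "\<kappa> * (Es z - E)\<^sup>2 / 2 \<le> A z - \<Phi> z E"
proof -
  define m where "m = (Es z + E) / 2"
  have "m \<in> {0..M}" using E Es(1)[of z] by (auto simp: m_def)
  then have 1: "\<Phi> z m \<le> A z" by (rule Es(2))
  have 2: "(G (Es z) (fst z) + G E (fst z)) / 2 \<le> G m (fst z)"
    unfolding m_def using Es(1) E by (intro G_concave)
  have "\<Phi> z m = G m (fst z) - (G (Es z) (fst z) + G E (fst z)) / 2 + (\<Phi> z (Es z) + \<Phi> z E) / 2
     + \<kappa> * (Es z - E)\<^sup>2 / 4"
    unfolding \<Phi>_def m_def by (simp add: field_simps power2_eq_square)
  then have "(A z + \<Phi> z E) / 2 + \<kappa> * (Es z - E)\<^sup>2 / 4 \<le> A z" using 1 2 unfolding A_def by linarith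
  then show ?thesis by (simp add: field_simps)
qed

lemma G_Lipschitz: "E \<in> {0..M} \<Longrightarrow> \<bar>G E y - G E y'\<bar> \<le> P * \<bar>y - y'\<bar>"
  by (rule Lipschitz_of_derivative_bound[OF G_deriv g_bound])

text \<open>Add the quadratic gaps of the two problems, each at the other's maximiser; what remains
  is a mixed difference, small with the displacement in position and time.\<close>

lemma Es_modulus: "\<kappa> * (Es z - Es z')\<^sup>2 \<le> 2 * P * \<bar>fst z - fst z'\<bar> + M * \<bar>snd z - snd z'\<bar>"
proof -
  define E where "E = Es z"
  define E' where "E' = Es z'"
  have EE: "E \<in> {0..M}" "E' \<in> {0..M}" using Es(1) by (auto simp: E_def E'_def)
  have 1: "\<kappa> * (E - E')\<^sup>2 / 2 \<le> \<Phi> z E - \<Phi> z E'"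
    using strong_maximum[OF EE(2), of z] by (simp add: E_def A_def)
  have 2: "\<kappa> * (E - E')\<^sup>2 / 2 \<le> \<Phi> z' E' - \<Phi> z' E"
    using strong_maximum[OF EE(1), of z'] by (simp add: E'_def A_def power2_commute)
  have 3: "(\<Phi> z E - \<Phi> z E') + (\<Phi> z' E' - \<Phi> z' E) = (G E (fst z) - G E (fst z'))
     - (G E' (fst z) - G E' (fst z')) - (E - E') * (snd z - snd z')"
    by (simp add: \<Phi>_def algebra_simps)
  have 4: "\<bar>G E (fst z) - G E (fst z')\<bar> \<le> P * \<bar>fst z - fst z'\<bar>"
    "\<bar>G E' (fst z) - G E' (fst z')\<bar> \<le> P * \<bar>fst z - fst z'\<bar>"
    using EE by (auto intro: G_Lipschitz)
  have "\<bar>(E - E') * (snd z - snd z')\<bar> \<le> M * \<bar>snd z - snd z'\<bar>"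
    unfolding abs_mult using EE by (intro mult_right_mono) auto
  then show ?thesis using 1 2 3 4 unfolding E_def[symmetric] E'_def[symmetric] by linarith
qed

lemma Es_continuous: "continuous_on UNIV Es"
proof (rule continuous_at_imp_continuous_on, rule ballI)
  fix z :: "real \<times> real"
  have "((\<lambda>z'. sqrt ((2 * P * \<bar>fst z' - fst z\<bar> + M * \<bar>snd z' - snd z\<bar>) / \<kappa>)) \<longlongrightarrow>
     sqrt ((2 * P * \<bar>fst z - fst z\<bar> + M * \<bar>snd z - snd z\<bar>) / \<kappa>)) (at z)"
    using \<kappa> by (intro tendsto_intros) auto
  then have lim: "((\<lambda>z'. sqrt ((2 * P * \<bar>fst z' - fst z\<bar> + M * \<bar>snd z' - snd z\<bar>) / \<kappa>)) \<longlongrightarrow> 0) (at z)"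
    by simp
  have "((\<lambda>z'. Es z' - Es z) \<longlongrightarrow> 0) (at z)"
  proof (rule Lim_null_comparison[OF always_eventually lim], rule allI)
    fix z'
    have "(Es z' - Es z)\<^sup>2 \<le> (2 * P * \<bar>fst z' - fst z\<bar> + M * \<bar>snd z' - snd z\<bar>) / \<kappa>"
      using Es_modulus[of z' z] \<kappa> by (simp add: le_divide_eq mult.commute)
    then show "norm (Es z' - Es z) \<le> sqrt ((2 * P * \<bar>fst z' - fst z\<bar> + M * \<bar>snd z' - snd z\<bar>) / \<kappa>)"
      using real_sqrt_le_mono by fastforce
  qed
  then show "isCont Es z" by (simp add: isCont_def LIM_zero_iff)
qed

text \<open>The increment is squeezed between two differences at frozen energy: the old maximiser is
  admissible at the new point, the new one at the old point. Continuity of \<open>Es\<close> and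
  \<open>g\<close> gives both the same linear part.\<close>

lemma A_derivative:
  "(A has_derivative (\<lambda>h. fst h * g (Es z) (fst z) + snd h * - Es z)) (at z)"
  unfolding has_derivative_at_alt
proof (intro conjI allI impI)
  show "bounded_linear (\<lambda>h. fst h * g (Es z) (fst z) + snd h * - Es z)"
    by (intro bounded_linear_add bounded_linear_mult_const bounded_linear_fst bounded_linear_snd)
  fix e :: real assume e: "e > 0"
  define E0 where "E0 = Es z"
  define y0 where "y0 = fst z"
  have E0: "E0 \<in> {0..M}" using Es(1) by (simp add: E0_def)
  have "e / 2 > 0" using e by simp
  with g_cont obtain d1 where d1: "d1 > 0"
    "\<And>x. x \<in> {0..M} \<times> UNIV \<Longrightarrow> dist x (E0, y0) < d1 \<Longrightarrow> dist (g (fst x) (snd x)) (g E0 y0) < e / 2"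
    unfolding continuous_on_iff using E0 by (metis SigmaI UNIV_I fst_conv snd_conv)
  have "min (d1 / 2) (e / 2) > 0" using d1 e by simp
  moreover have "isCont Es z"
    using Es_continuous continuous_on_eq_continuous_at[OF open_UNIV, of Es] by blast
  ultimately obtain d2 where d2: "d2 > 0" "\<And>x. dist x z < d2 \<Longrightarrow> dist (Es x) E0 < min (d1 / 2) (e / 2)"
    unfolding continuous_at_eps_delta E0_def by blast
  define d where "d = min d2 (d1 / 2)"
  have d: "d > 0" using d1 d2 by (simp add: d_def)
  have near: "\<bar>g E x - g E0 y0\<bar> \<le> e / 2" if "E \<in> {0..M}" "\<bar>E - E0\<bar> < d1 / 2" "\<bar>x - y0\<bar> < d1 / 2" for E x
  proof -
    have "dist (E, x) (E0, y0) \<le> \<bar>E - E0\<bar> + \<bar>x - y0\<bar>"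
      unfolding dist_prod_def dist_real_def using sqrt_sum_squares_le_sum_abs by simp
    then have "dist (E, x) (E0, y0) < d1" using that by linarith
    from d1(2)[OF _ this] that(1) show ?thesis by (simp add: dist_real_def)
  qed
  have "norm (A z' - A z - (fst (z' - z) * g (Es z) (fst z) + snd (z' - z) * - Es z)) \<le> e * norm (z' - z)"
    if z': "norm (z' - z) < d" for z'
  proof -
    define E where "E = Es z'"
    define \<Delta>y where "\<Delta>y = fst z' - y0"
    define \<Delta>T where "\<Delta>T = snd z' - snd z"
    have E: "E \<in> {0..M}" using Es(1) by (simp add: E_def)
    have dn: "\<bar>\<Delta>y\<bar> \<le> norm (z' - z)" "\<bar>\<Delta>T\<bar> \<le> norm (z' - z)"
      using dist_fst_le[of z' z] dist_snd_le[of z' z]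
      unfolding \<Delta>y_def \<Delta>T_def y0_def dist_norm real_norm_def by auto
    have EE: "\<bar>E - E0\<bar> < d1 / 2" "\<bar>E - E0\<bar> < e / 2"
      using d2(2)[of z'] z' by (auto simp: dist_norm d_def E_def)
    have yd: "\<bar>\<Delta>y\<bar> < d1 / 2" using dn(1) z' unfolding d_def by linarith
    obtain x1 where x1: "\<bar>x1 - y0\<bar> \<le> \<bar>fst z' - y0\<bar>" "G E0 (fst z') - G E0 y0 = (fst z' - y0) * g E0 x1"
      using mean_value_between[OF G_deriv[OF E0]] by metis
    obtain x2 where x2: "\<bar>x2 - y0\<bar> \<le> \<bar>fst z' - y0\<bar>" "G E (fst z') - G E y0 = (fst z' - y0) * g E x2"
      using mean_value_between[OF G_deriv[OF E]] by metis
    have n1: "\<bar>g E0 x1 - g E0 y0\<bar> \<le> e / 2" using x1(1) yd d1(1) by (intro near E0) (auto simp: \<Delta>y_def)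
    have n2: "\<bar>g E x2 - g E0 y0\<bar> \<le> e / 2" using x2(1) yd EE by (intro near E) (auto simp: \<Delta>y_def)
    define X where "X = A z' - A z - (fst (z' - z) * g (Es z) (fst z) + snd (z' - z) * - Es z)"
    have L: "fst (z' - z) * g (Es z) (fst z) + snd (z' - z) * - Es z = \<Delta>y * g E0 y0 - \<Delta>T * E0"
      by (simp add: \<Delta>y_def \<Delta>T_def y0_def E0_def)
    have "\<Phi> z' E0 \<le> A z'" by (rule Es(2)[OF E0])
    moreover have "\<Phi> z' E0 - A z = \<Delta>y * g E0 x1 - \<Delta>T * E0"
      using x1(2) by (simp add: A_def \<Phi>_def E0_def[symmetric] y0_def[symmetric] \<Delta>y_def \<Delta>T_def algebra_simps)
    ultimately have lo: "X \<ge> \<Delta>y * (g E0 x1 - g E0 y0)" unfolding X_def L by (simp add: algebra_simps)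
    have "\<Phi> z E \<le> A z" by (rule Es(2)[OF E])
    moreover have "A z' - \<Phi> z E = \<Delta>y * g E x2 - \<Delta>T * E"
      using x2(2) by (simp add: A_def \<Phi>_def E_def[symmetric] y0_def[symmetric] \<Delta>y_def \<Delta>T_def algebra_simps)
    ultimately have up: "X \<le> \<Delta>y * (g E x2 - g E0 y0) - \<Delta>T * (E - E0)"
      unfolding X_def L by (simp add: algebra_simps)
    define n where "n = norm (z' - z)"
    have n0: "n \<ge> 0" by (simp add: n_def)
    have b1: "\<bar>\<Delta>y * (g E0 x1 - g E0 y0)\<bar> \<le> n * (e / 2)"
      unfolding abs_mult n_def using dn n1 e by (intro mult_mono) auto
    have b2: "\<bar>\<Delta>y * (g E x2 - g E0 y0)\<bar> \<le> n * (e / 2)"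
      unfolding abs_mult n_def using dn n2 e by (intro mult_mono) auto
    have b3: "\<bar>\<Delta>T * (E - E0)\<bar> \<le> n * (e / 2)"
      unfolding abs_mult n_def using dn EE e by (intro mult_mono) auto
    have b4: "0 \<le> n * (e / 2)" using n0 e by simp
    have "\<bar>X\<bar> \<le> n * (e / 2) + n * (e / 2)" using lo up b1 b2 b3 b4 by linarith
    also have "\<dots> = e * n" by (simp add: field_simps)
    finally show ?thesis by (simp add: X_def n_def)
  qed
  with d show "\<exists>d>0. \<forall>y. norm (y - z) < d \<longrightarrow>
     norm (A y - A z - (fst (y - z) * g (Es z) (fst z) + snd (y - z) * - Es z)) \<le> e * norm (y - z)"
    by blast
qed

lemma A_gradient_continuous: "continuous_on UNIV (\<lambda>z. g (Es z) (fst z))"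
  by (rule continuous_on_compose2[OF g_cont, where f = "\<lambda>z. (Es z, fst z)", simplified])
     (use Es(1) in \<open>auto intro!: continuous_intros Es_continuous\<close>)

lemma A_nonneg: "0 \<le> A z"
  using Es(2)[of 0 z] G_nonneg[of 0 "fst z"] M by (simp add: \<Phi>_def)

lemma A_origin: "A (0, 0) = 0"
proof (rule antisym)
  show "A (0, 0) \<le> 0" using \<kappa> by (simp add: A_def \<Phi>_def G_0)
qed (rule A_nonneg)

text \<open>\<open>m - A (y, 1 - t)\<close> is of class C1 with time derivative \<open>- Es\<close>
  and space derivative \<open>- g\<close>, hence a classical subsolution by \<open>HE\<close>; since
  \<open>A\<close> vanishes at the origin, its value at (0,1) is \<open>m\<close>.\<close>

lemma supersolution_lower_bound:
  fixes u :: "real \<times> real \<Rightarrow> real"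
  assumes contu: "continuous_on (UNIV \<times> {0..}) u"
    and sup: "viscosity_supersolution (UNIV \<times> {0<..}) (evolution H) u"
    and HE: "\<And>E y. E \<in> {0..M} \<Longrightarrow> H y (- g E y) \<le> E"
    and Hinc: "\<And>x p q. \<bar>p\<bar> \<le> P \<Longrightarrow> H x (p + q) \<le> H x p + B * (\<bar>q\<bar> + q\<^sup>2)" and B: "B \<ge> 0"
    and growth: "\<And>\<beta>. \<beta> > 0 \<Longrightarrow> \<exists>A. \<forall>x. \<forall>t\<in>{0..2}. u (x, t) \<ge> - A - \<beta> * x\<^sup>2"
    and init: "\<And>y. m \<le> u (y, 0) + A (y, 1)"
  shows "m \<le> u (0, 1)"
proof -
  define w where "w z = m - A (fst z, 1 - snd z)" for z
  define wx where "wx z = - g (Es (fst z, 1 - snd z)) (fst z)" for z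
  define wt where "wt z = - Es (fst z, 1 - snd z)" for z
  have "w (0, 1) \<le> u (0, 1)"
  proof (rule supersolution_above_classical[OF contu sup _ _ _ _ _ Hinc B _ growth])
    fix z :: "real \<times> real"
    have "((\<lambda>z. (fst z, 1 - snd z)) has_derivative (\<lambda>h. (fst h, - snd h))) (at z)"
      by (auto intro!: derivative_eq_intros)
    from has_derivative_compose[OF this A_derivative]
    have "((\<lambda>z. A (fst z, 1 - snd z)) has_derivative
       (\<lambda>h. fst h * g (Es (fst z, 1 - snd z)) (fst z) + - snd h * - Es (fst z, 1 - snd z))) (at z)"
      by simp
    from has_derivative_diff[OF has_derivative_const this, of m]
    show "(w has_derivative (\<lambda>h. fst h * wx z + snd h * wt z)) (at z)"
      unfolding w_def[abs_def] wx_def wt_def by (simp add: algebra_simps)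
    show "wt z + H (fst z) (wx z) \<le> 0"
      using HE[OF Es(1)[of "(fst z, 1 - snd z)"], of "fst z"] by (simp add: wt_def wx_def)
    show "\<bar>wx z\<bar> \<le> P" using g_bound[OF Es(1)] by (simp add: wx_def)
    show "w z \<le> m" using A_nonneg by (simp add: w_def)
  next
    have c: "continuous_on UNIV (\<lambda>z :: real \<times> real. (fst z, 1 - snd z))" by (intro continuous_intros)
    show "continuous_on UNIV wx" unfolding wx_def
      using continuous_on_compose2[OF A_gradient_continuous c] by (intro continuous_on_minus) simp
    show "continuous_on UNIV wt" unfolding wt_def
      using continuous_on_compose2[OF Es_continuous c] by (intro continuous_on_minus) simp
    show "w (x, 0) \<le> u (x, 0)" for x using init[of x] by (simp add: w_def)
  qed
  then show ?thesis by (simp add: w_def A_origin)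
qed

end

section \<open>Straight segments and the growth of subsolutions\<close>

lemma subsolution_line:
  fixes u :: "real \<times> real \<Rightarrow> real"
  assumes contu: "continuous_on (UNIV \<times> {0..}) u"
    and sub: "viscosity_subsolution (UNIV \<times> {0<..}) (evolution H) u"
    and ab: "0 \<le> a" "a < b"
    and L: "\<And>x q. q * ((y - x0) / (b - a)) - H x q \<le> L"
  shows "u (y, b) - u (x0, a) \<le> L * (b - a)"
proof -
  define v where "v = (y - x0) / (b - a)"
  have vab: "v * (b - a) = y - x0" using nonzero_eq_divide_eq[of "b - a" v "y - x0"] ab v_def by simp
  have "u (x0 + v * (b - a), b) - u (x0 + v * (a - a), a) \<le> L * b - L * a"
  proof (rule subsolution_along_curve[OF contu sub ab, where g = "\<lambda>t. x0 + v * (t - a)" and g' = "\<lambda>t. v"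
        and \<Phi> = "\<lambda>t. L * t" and \<Phi>' = "\<lambda>t. L" and c = "\<lambda>z. L"])
    show "q * v - H x q \<le> L" for x q using L by (simp add: v_def)
  qed (auto intro!: derivative_eq_intros continuous_intros)
  moreover have "x0 + v * (b - a) = y" "x0 + v * (a - a) = x0" using vab by simp_all
  moreover have "L * b - L * a = L * (b - a)" by (simp add: right_diff_distrib)
  ultimately show ?thesis by (simp only:)
qed

lemma quadratic_Fenchel: "q * v - q\<^sup>2 / 2 \<le> v\<^sup>2 / (2 :: real)"
  using zero_le_power2[of "q - v"] by (simp add: power2_diff algebra_simps)

text \<open>The segment costs its kinetic energy plus at most \<open>K\<close> per unit time, by the
  quadratic lower bound for the Hamiltonian.\<close>

lemma subsolution_line_quadratic:
  fixes u :: "real \<times> real \<Rightarrow> real"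
  assumes contu: "continuous_on (UNIV \<times> {0..}) u"
    and sub: "viscosity_subsolution (UNIV \<times> {0<..}) (evolution H) u"
    and ab: "0 \<le> a" "a < b"
    and H: "\<And>x q. q\<^sup>2 / 2 - K \<le> H x q"
  shows "u (y, b) \<le> u (x0, a) + (y - x0)\<^sup>2 / (2 * (b - a)) + K * (b - a)"
proof -
  define v where "v = (y - x0) / (b - a)"
  have "u (y, b) - u (x0, a) \<le> (v\<^sup>2 / 2 + K) * (b - a)"
  proof (rule subsolution_line[OF contu sub ab])
    fix x q
    show "q * ((y - x0) / (b - a)) - H x q \<le> v\<^sup>2 / 2 + K"
      using H[of q x] quadratic_Fenchel[of q v] unfolding v_def by linarith
  qed
  also have "(v\<^sup>2 / 2 + K) * (b - a) = (y - x0)\<^sup>2 / (2 * (b - a)) + K * (b - a)"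
  proof -
    define h where "h = b - a"
    have h: "h \<noteq> 0" using ab by (simp add: h_def)
    then have "v * h = y - x0" using nonzero_eq_divide_eq[of h v "y - x0"] v_def h_def by simp
    moreover have "(v\<^sup>2 / 2 + K) * h = (v * h)\<^sup>2 / (2 * h) + K * h"
      using h by (simp add: power2_eq_square field_simps)
    ultimately show ?thesis by (simp add: h_def)
  qed
  finally show ?thesis by simp
qed

text \<open>A subsolution on all later times bounds earlier values from below: this is what makes the
  growth condition in the comparison principle automatic.\<close>

lemma subsolution_growth:
  fixes u :: "real \<times> real \<Rightarrow> real"
  assumes contu: "continuous_on (UNIV \<times> {0..}) u"
    and sub: "viscosity_subsolution (UNIV \<times> {0<..}) (evolution H) u"
    and H: "\<And>x q. q\<^sup>2 / 2 - K \<le> H x q" and K: "K \<ge> 0" and \<beta>: "\<beta> > 0"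
  shows "\<exists>A. \<forall>x. \<forall>t\<in>{0..2}. u (x, t) \<ge> - A - \<beta> * x\<^sup>2"
proof (intro exI allI ballI)
  fix x t :: real assume t: "t \<in> {0..2}"
  \<comment> \<open>At least \<open>1 / \<beta>\<close> of time is left, so the segment from
    \<open>(x, t)\<close> to \<open>(0, T)\<close> has quadratic cost with coefficient at most
    \<open>\<beta>\<close>.\<close>
  define T where "T = 3 + 1 / \<beta>"
  have Tt: "T - t \<ge> 1 / \<beta>" "T - t \<le> T" using t by (auto simp: T_def)
  moreover have "1 / \<beta> > 0" using \<beta> by simp
  ultimately have "T - t > 0" by linarith
  note Tt = Tt this
  have "u (0, T) \<le> u (x, t) + (0 - x)\<^sup>2 / (2 * (T - t)) + K * (T - t)"
    using t Tt by (intro subsolution_line_quadratic[OF contu sub _ _ H]) auto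
  moreover have "(0 - x)\<^sup>2 / (2 * (T - t)) \<le> \<beta> * x\<^sup>2"
  proof -
    have "1 \<le> \<beta> * (T - t)" using Tt(1) \<beta> by (simp add: divide_le_eq mult.commute)
    then have "x\<^sup>2 * 1 \<le> x\<^sup>2 * (\<beta> * (T - t))" by (rule mult_left_mono) simp
    also have "\<dots> \<le> x\<^sup>2 * (\<beta> * (2 * (T - t)))" using \<beta> Tt by (intro mult_left_mono) auto
    finally show ?thesis using Tt by (simp add: divide_le_eq mult_ac)
  qed
  moreover have "K * (T - t) \<le> K * T" using K Tt by (intro mult_left_mono) auto
  ultimately show "u (x, t) \<ge> - (- u (0, T) + K * T) - \<beta> * x\<^sup>2" by linarith
qed

section \<open>Smoothing the vertex of the cone\<close>

lemma smooth_sign: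
  fixes \<eta> :: real assumes \<eta>: "\<eta> > 0"
  shows "((\<lambda>x. sqrt (\<eta>\<^sup>2 + x\<^sup>2) - \<eta>) has_real_derivative x / sqrt (\<eta>\<^sup>2 + x\<^sup>2)) (at x)"
    "continuous_on UNIV (\<lambda>x. x / sqrt (\<eta>\<^sup>2 + x\<^sup>2))" "\<bar>x / sqrt (\<eta>\<^sup>2 + x\<^sup>2)\<bar> \<le> 1"
    "x \<ge> 0 \<Longrightarrow> x / sqrt (\<eta>\<^sup>2 + x\<^sup>2) \<ge> 0" "x \<le> 0 \<Longrightarrow> x / sqrt (\<eta>\<^sup>2 + x\<^sup>2) \<le> 0"
    "\<bar>x\<bar> \<le> sqrt (\<eta>\<^sup>2 + x\<^sup>2)"
proof -
  have p: "0 < \<eta>\<^sup>2 + x\<^sup>2" for x :: real using \<eta> by (simp add: add_pos_nonneg)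
  have sp: "0 < sqrt (\<eta>\<^sup>2 + x\<^sup>2)" for x :: real using p by simp
  have d: "((\<lambda>x. \<eta>\<^sup>2 + x\<^sup>2) has_real_derivative 2 * x) (at x)" by (auto intro!: derivative_eq_intros)
  have "((\<lambda>x. sqrt (\<eta>\<^sup>2 + x\<^sup>2)) has_real_derivative x / sqrt (\<eta>\<^sup>2 + x\<^sup>2)) (at x)"
    by (rule DERIV_cong[OF DERIV_chain2[where g = "\<lambda>x. \<eta>\<^sup>2 + x\<^sup>2" and x = x,
            OF DERIV_real_sqrt[OF p[of x]] d]]) (simp add: inverse_eq_divide)
  from DERIV_diff[OF this DERIV_const[of \<eta>]]
  show "((\<lambda>x. sqrt (\<eta>\<^sup>2 + x\<^sup>2) - \<eta>) has_real_derivative x / sqrt (\<eta>\<^sup>2 + x\<^sup>2)) (at x)" by simp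
  show "continuous_on UNIV (\<lambda>x. x / sqrt (\<eta>\<^sup>2 + x\<^sup>2))"
    by (intro continuous_intros ballI) (metis sp less_irrefl)
  show le: "\<bar>x\<bar> \<le> sqrt (\<eta>\<^sup>2 + x\<^sup>2)" by (rule real_le_rsqrt) simp
  then show "\<bar>x / sqrt (\<eta>\<^sup>2 + x\<^sup>2)\<bar> \<le> 1" using sp[of x] by (simp add: divide_le_eq)
  show "x \<ge> 0 \<Longrightarrow> x / sqrt (\<eta>\<^sup>2 + x\<^sup>2) \<ge> 0" using sp[of x] by simp
  show "x \<le> 0 \<Longrightarrow> x / sqrt (\<eta>\<^sup>2 + x\<^sup>2) \<le> 0" using sp[of x] by (simp add: divide_nonpos_pos)
qed

lemma nonneg_of_derivative_sign:
  fixes f :: "real \<Rightarrow> real"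
  assumes "\<And>x. (f has_real_derivative f' x) (at x)" "f 0 = 0"
    "\<And>x. x \<ge> 0 \<Longrightarrow> f' x \<ge> 0" "\<And>x. x \<le> 0 \<Longrightarrow> f' x \<le> 0"
  shows "f y \<ge> 0"
proof (cases y "0 :: real" rule: linorder_cases)
  case less
  obtain z where z: "y < z" "z < 0" "f 0 - f y = (0 - y) * f' z" using MVT2[OF less] assms(1) by blast
  have "(0 - y) * f' z \<le> 0" using z assms(4)[of z] less by (intro mult_nonneg_nonpos) auto
  then show ?thesis using z assms(2) by simp
next
  case greater
  obtain z where z: "0 < z" "z < y" "f y - f 0 = (y - 0) * f' z" using MVT2[OF greater] assms(1) by blast
  have "(y - 0) * f' z \<ge> 0" using z assms(3)[of z] greater by (intro mult_nonneg_nonneg) auto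
  then show ?thesis using z assms(2) by simp
qed (use assms in simp)

text \<open>A family of slopes \<open>r E\<close>, to be smoothed at the vertex of the cone \<open>\<bar>R E\<bar>\<close>.\<close>

locale slope_family =
  fixes r R :: "real \<Rightarrow> real \<Rightarrow> real" and M P :: real
  assumes M: "M \<ge> 0"
    and r_cont: "continuous_on ({0..M} \<times> UNIV) (\<lambda>z. r (fst z) (snd z))"
    and r_bound: "\<And>E y. E \<in> {0..M} \<Longrightarrow> 0 \<le> r E y \<and> r E y \<le> P"
    and r_concave: "\<And>E E' y. E \<in> {0..M} \<Longrightarrow> E' \<in> {0..M} \<Longrightarrow> (r E y + r E' y) / 2 \<le> r ((E + E') / 2) y"
    and r_holder: "\<And>E E' y. E \<in> {0..M} \<Longrightarrow> E' \<in> {0..M} \<Longrightarrow> \<bar>r E y - r E' y\<bar> \<le> sqrt (2 * \<bar>E - E'\<bar>)"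
    and R_deriv: "\<And>E y. E \<in> {0..M} \<Longrightarrow> (R E has_real_derivative r E y) (at y)"
    and R_0: "\<And>E. R E 0 = 0"
begin

text \<open>Multiplying the slopes by a smoothed sign rounds the vertex, preserves concavity in the
  energy, and lowers the height by at most \<open>\<eta> * P\<close>.\<close>

lemma smoothed_family:
  assumes \<eta>: "\<eta> > 0" and \<kappa>: "\<kappa> > 0"
  obtains G where "energy_family G (\<lambda>E y. y / sqrt (\<eta>\<^sup>2 + y\<^sup>2) * r E y) M \<kappa> P"
    "\<And>E y. E \<in> {0..M} \<Longrightarrow> \<bar>R E y\<bar> - \<eta> * P \<le> G E y"
proof -
  define \<zeta> where "\<zeta> y = y / sqrt (\<eta>\<^sup>2 + y\<^sup>2)" for y
  note \<zeta> = smooth_sign[OF \<eta>, folded \<zeta>_def]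
  define X where "X y = sqrt (\<eta>\<^sup>2 + y\<^sup>2) - \<eta>" for y
  have X: "(X has_real_derivative \<zeta> y) (at y)" for y unfolding X_def[abs_def] by (rule \<zeta>(1))
  have X0: "X 0 = 0" using \<eta> by (simp add: X_def)
  have rc: "continuous_on UNIV (r E)" if "E \<in> {0..M}" for E
  proof -
    have "continuous_on UNIV (\<lambda>y. (\<lambda>z. r (fst z) (snd z)) (E, y))"
      by (rule continuous_on_compose2[OF r_cont]) (use that in \<open>auto intro!: continuous_intros\<close>)
    then show ?thesis by simp
  qed
  have "\<exists>F. (\<forall>y. (F has_real_derivative \<zeta> y * r E y) (at y)) \<and> F 0 = 0" if E: "E \<in> {0..M}" for E
  proof -
    have "continuous_on UNIV (\<lambda>y. \<zeta> y * r E y)" using rc[OF E] \<zeta>(2) by (intro continuous_intros)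
    then obtain F where F: "\<And>y. (F has_real_derivative \<zeta> y * r E y) (at y)" using ex_antiderivative by blast
    have "((\<lambda>y. F y - F 0) has_real_derivative \<zeta> y * r E y) (at y)" for y
      using DERIV_diff[OF F DERIV_const[of "F 0"]] by simp
    then show ?thesis by (intro exI[of _ "\<lambda>y. F y - F 0"]) simp
  qed
  then obtain G0 where G0: "\<And>E y. E \<in> {0..M} \<Longrightarrow> (G0 E has_real_derivative \<zeta> y * r E y) (at y)"
    "\<And>E. E \<in> {0..M} \<Longrightarrow> G0 E 0 = 0" by metis
  \<comment> \<open>The zero function outside the range makes \<open>G E 0 = 0\<close> hold for all
    \<open>E\<close>, as the locale requires.\<close>
  define G where "G E = (if E \<in> {0..M} then G0 E else (\<lambda>_. 0))" for E
  have G: "(G E has_real_derivative \<zeta> y * r E y) (at y)" if "E \<in> {0..M}" for E y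
    using G0(1)[OF that] that unfolding G_def by (simp only: if_True)
  have G00: "G E 0 = 0" for E using G0(2) by (simp add: G_def)
  have ef: "energy_family G (\<lambda>E y. \<zeta> y * r E y) M \<kappa> P"
  proof
    show "M \<ge> 0" by (rule M)
    show "\<kappa> > 0" by (rule \<kappa>)
    show "G E 0 = 0" for E by (rule G00)
    have "continuous_on ({0..M} \<times> UNIV) (\<lambda>z. \<zeta> (snd z))"
      by (rule continuous_on_compose2[OF \<zeta>(2)]) (auto intro!: continuous_intros)
    then show "continuous_on ({0..M} \<times> UNIV) (\<lambda>z. \<zeta> (snd z) * r (fst z) (snd z))"
      by (intro continuous_on_mult r_cont)
    fix E y assume E: "E \<in> {0..M}"
    show "(G E has_real_derivative \<zeta> y * r E y) (at y)" by (rule G[OF E])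
    have "\<bar>\<zeta> y\<bar> * \<bar>r E y\<bar> \<le> 1 * P" using r_bound[OF E, of y] \<zeta>(3) by (intro mult_mono) auto
    then show "\<bar>\<zeta> y * r E y\<bar> \<le> P" by (simp add: abs_mult)
    show "0 \<le> G E y"
      by (rule nonneg_of_derivative_sign[OF G[OF E] G00])
         (use r_bound[OF E] \<zeta>(4,5) in \<open>auto intro: mult_nonneg_nonneg mult_nonpos_nonneg\<close>)
    fix E' assume E': "E' \<in> {0..M}"
    have m: "(E + E') / 2 \<in> {0..M}" using E E' by auto
    have "0 \<le> G ((E + E') / 2) y - (G E y + G E' y) / 2"
    proof (rule nonneg_of_derivative_sign[OF DERIV_diff[OF G[OF m] DERIV_cdivide[OF DERIV_add[OF G[OF E] G[OF E']]]]])
      have e: "\<zeta> x * r ((E + E') / 2) x - (\<zeta> x * r E x + \<zeta> x * r E' x) / 2 =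
        \<zeta> x * (r ((E + E') / 2) x - (r E x + r E' x) / 2)" for x by (simp add: algebra_simps add_divide_distrib)
      have p: "0 \<le> r ((E + E') / 2) x - (r E x + r E' x) / 2" for x using r_concave[OF E E', of x] by simp
      show "x \<ge> 0 \<Longrightarrow> 0 \<le> \<zeta> x * r ((E + E') / 2) x - (\<zeta> x * r E x + \<zeta> x * r E' x) / 2" for x
        unfolding e using p \<zeta>(4) by (intro mult_nonneg_nonneg)
      show "x \<le> 0 \<Longrightarrow> \<zeta> x * r ((E + E') / 2) x - (\<zeta> x * r E x + \<zeta> x * r E' x) / 2 \<le> 0" for x
        unfolding e using p \<zeta>(5) by (intro mult_nonpos_nonneg)
    qed (simp add: G00)
    then show "(G E y + G E' y) / 2 \<le> G ((E + E') / 2) y" by simp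
  next
    fix y
    show "continuous_on {0..M} (\<lambda>E. G E y)"
    proof (rule continuous_onI)
      fix E e :: real assume E: "E \<in> {0..M}" and e: "e > 0"
      define d where "d = (e / (\<bar>y\<bar> + 1))\<^sup>2 / 2"
      have d: "d > 0" using e by (simp add: d_def)
      have "dist (G E' y) (G E y) \<le> e" if E': "E' \<in> {0..M}" "dist E' E < d" for E'
      proof -
        have bd: "\<bar>\<zeta> x * r E' x - \<zeta> x * r E x\<bar> \<le> e / (\<bar>y\<bar> + 1)" for x
        proof -
          have "\<bar>\<zeta> x * r E' x - \<zeta> x * r E x\<bar> = \<bar>\<zeta> x\<bar> * \<bar>r E' x - r E x\<bar>"
            by (simp add: abs_mult[symmetric] right_diff_distrib)
          also have "\<dots> \<le> 1 * sqrt (2 * \<bar>E' - E\<bar>)"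
            using \<zeta>(3) r_holder[OF E'(1) E] by (intro mult_mono) auto
          also have "\<dots> \<le> sqrt ((e / (\<bar>y\<bar> + 1))\<^sup>2)"
            using E'(2) by (simp only: mult_1, intro real_sqrt_le_mono) (simp add: dist_real_def d_def)
          also have "\<dots> = e / (\<bar>y\<bar> + 1)" using e by simp
          finally show ?thesis .
        qed
        have "\<bar>(G E' y - G E y) - (G E' 0 - G E 0)\<bar> \<le> e / (\<bar>y\<bar> + 1) * \<bar>y - 0\<bar>"
          by (rule Lipschitz_of_derivative_bound[OF DERIV_diff[OF G[OF E'(1)] G[OF E]] bd])
        also have "\<dots> \<le> e" using e by (simp add: divide_le_eq field_simps)
        finally show ?thesis by (simp add: G00 dist_real_def)
      qed
      with d show "\<exists>d>0. \<forall>x'\<in>{0..M}. dist x' E < d \<longrightarrow> dist (G x' y) (G E y) \<le> e" by blast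
    qed
  qed
  have low: "\<bar>R E y\<bar> - \<eta> * P \<le> G E y" if E: "E \<in> {0..M}" for E y
  proof -
    have rb: "0 \<le> r E x" "r E x \<le> P" for x using r_bound[OF E] by auto
    have P0: "P \<ge> 0" using rb[of 0] by linarith
    have c1: "\<zeta> x \<le> 1" "- 1 \<le> \<zeta> x" for x using \<zeta>(3)[of x] by auto
    have Rmono: "R E x \<le> R E x'" if "x \<le> x'" for x x'
    proof (rule DERIV_nonneg_imp_nondecreasing[OF that])
      show "\<exists>d. (R E has_real_derivative d) (at z) \<and> 0 \<le> d" for z
        using R_deriv[OF E, of z] rb(1)[of z] by blast
    qed
    have Xb: "\<bar>y\<bar> - X y \<le> \<eta>" using \<zeta>(6)[of y] by (simp add: X_def)
    have XP: "P * (\<bar>y\<bar> - X y) \<le> \<eta> * P" using mult_left_mono[OF Xb P0] by (simp add: mult.commute)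
    show ?thesis
    proof (cases "y \<ge> 0")
      case True
      \<comment> \<open>The correction \<open>P * (x - X x)\<close> has derivative
        \<open>P * (1 - \<zeta> x)\<close>, which outweighs the lost slope
        \<open>(1 - \<zeta> x) * r E x\<close> and totals at most \<open>\<eta> * P\<close>.\<close>
      have "(\<lambda>x. G E x - R E x + P * (x - X x)) 0 \<le> (\<lambda>x. G E x - R E x + P * (x - X x)) y"
      proof (rule DERIV_nonneg_imp_nondecreasing[OF True])
        fix x
        have "((\<lambda>x. G E x - R E x + P * (x - X x)) has_real_derivative \<zeta> x * r E x - r E x + P * (1 - \<zeta> x)) (at x)"
          by (auto intro!: derivative_eq_intros G[OF E] R_deriv[OF E] X)
        moreover have "\<zeta> x * r E x - r E x + P * (1 - \<zeta> x) = (1 - \<zeta> x) * (P - r E x)" by (simp add: algebra_simps)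
        moreover have "0 \<le> (1 - \<zeta> x) * (P - r E x)" using c1 rb by (intro mult_nonneg_nonneg) auto
        ultimately show "\<exists>d. ((\<lambda>x. G E x - R E x + P * (x - X x)) has_real_derivative d) (at x) \<and> 0 \<le> d" by auto
      qed
      moreover have "R E y \<ge> 0"
      proof -
        have "R E 0 \<le> R E y" using True by (rule Rmono)
        then show ?thesis by (simp add: R_0)
      qed
      ultimately show ?thesis using XP True by (simp add: G00 R_0 X0)
    next
      case False
      then have y: "y \<le> 0" by simp
      have "(\<lambda>x. G E x + R E x + P * (- x - X x)) y \<ge> (\<lambda>x. G E x + R E x + P * (- x - X x)) 0"
      proof (rule DERIV_nonpos_imp_nonincreasing[OF y])
        fix x
        have "((\<lambda>x. G E x + R E x + P * (- x - X x)) has_real_derivative \<zeta> x * r E x + r E x + P * (- 1 - \<zeta> x)) (at x)"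
          by (auto intro!: derivative_eq_intros G[OF E] R_deriv[OF E] X)
        moreover have "\<zeta> x * r E x + r E x + P * (- 1 - \<zeta> x) = - ((1 + \<zeta> x) * (P - r E x))" by (simp add: algebra_simps)
        moreover have "0 \<le> (1 + \<zeta> x) * (P - r E x)" using c1[of x] rb by (intro mult_nonneg_nonneg) auto
        ultimately show "\<exists>d. ((\<lambda>x. G E x + R E x + P * (- x - X x)) has_real_derivative d) (at x) \<and> d \<le> 0" by auto
      qed
      moreover have "R E y \<le> 0"
      proof -
        have "R E y \<le> R E 0" using y by (rule Rmono)
        then show ?thesis by (simp add: R_0)
      qed
      ultimately show ?thesis using XP y by (simp add: G00 R_0 X0)
    qed
  qed
  show ?thesis by (rule that[OF ef[unfolded \<zeta>_def] low])
qed

text \<open>Smoothing costs \<open>\<eta> * P\<close> and the penalty in the energy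
  \<open>\<kappa> * M\<^sup>2\<close>, each made at most \<open>e / 2\<close>. \<open>HE\<close> is
  stated for all \<open>\<bar>\<theta>\<bar> \<le> 1\<close> because the smoothed sign takes
  intermediate values.\<close>

lemma solution_lower_bound:
  fixes u :: "real \<times> real \<Rightarrow> real"
  assumes contu: "continuous_on (UNIV \<times> {0..}) u"
    and sub: "viscosity_subsolution (UNIV \<times> {0<..}) (evolution H) u"
    and sup: "viscosity_supersolution (UNIV \<times> {0<..}) (evolution H) u"
    and H: "\<And>x q. q\<^sup>2 / 2 - K \<le> H x q" and K: "K \<ge> 0"
    and HE: "\<And>E y \<theta>. E \<in> {0..M} \<Longrightarrow> \<bar>\<theta>\<bar> \<le> 1 \<Longrightarrow> H y (\<theta> * r E y) \<le> E"
    and Hinc: "\<And>x p q. \<bar>p\<bar> \<le> P \<Longrightarrow> H x (p + q) \<le> H x p + B * (\<bar>q\<bar> + q\<^sup>2)" and B: "B \<ge> 0"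
    and init: "\<And>y. \<exists>E\<in>{0..M}. m \<le> u (y, 0) + \<bar>R E y\<bar> - E"
  shows "m \<le> u (0, 1)"
proof (rule field_le_epsilon)
  fix e :: real assume e: "e > 0"
  have P: "P \<ge> 0" using r_bound[of 0 0] M by auto
  define \<eta> where "\<eta> = e / 2 / (P + 1)"
  have "P + 1 \<noteq> 0" using P by simp
  then have "\<eta> * (P + 1) = e / 2" using nonzero_eq_divide_eq[of "P + 1" \<eta> "e / 2"] \<eta>_def by simp
  moreover have \<eta>: "\<eta> > 0" using e P by (simp add: \<eta>_def)
  ultimately have "\<eta> * P \<le> e / 2" by (simp add: distrib_left)
  note \<eta> = \<eta> this
  define \<kappa> where "\<kappa> = e / 2 / (M\<^sup>2 + 1)"
  have M1: "M\<^sup>2 + 1 > 0" by (simp add: add_nonneg_pos)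
  then have "\<kappa> * (M\<^sup>2 + 1) = e / 2" using nonzero_eq_divide_eq[of "M\<^sup>2 + 1" \<kappa> "e / 2"] \<kappa>_def by simp
  moreover have \<kappa>0: "\<kappa> > 0" using e M1 by (simp add: \<kappa>_def)
  ultimately have \<kappa>M: "\<kappa> * M\<^sup>2 \<le> e / 2" by (simp add: distrib_left)
  obtain G where ef: "energy_family G (\<lambda>E y. y / sqrt (\<eta>\<^sup>2 + y\<^sup>2) * r E y) M \<kappa> P"
    and low: "\<And>E y. E \<in> {0..M} \<Longrightarrow> \<bar>R E y\<bar> - \<eta> * P \<le> G E y"
    using smoothed_family[OF \<eta>(1) \<kappa>0] by blast
  interpret energy_family G "\<lambda>E y. y / sqrt (\<eta>\<^sup>2 + y\<^sup>2) * r E y" M \<kappa> P by (rule ef)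
  have "m - e \<le> u (0, 1)"
  proof (rule supersolution_lower_bound[OF contu sup _ Hinc B])
    show "H y (- (y / sqrt (\<eta>\<^sup>2 + y\<^sup>2) * r E y)) \<le> E" if "E \<in> {0..M}" for E y
      using HE[OF that, of "- (y / sqrt (\<eta>\<^sup>2 + y\<^sup>2))" y] smooth_sign(3)[OF \<eta>(1), of y] by simp
    show "\<exists>A. \<forall>x. \<forall>t\<in>{0..2}. u (x, t) \<ge> - A - \<beta> * x\<^sup>2" if "\<beta> > 0" for \<beta>
      by (rule subsolution_growth[OF contu sub H K that])
    fix y
    obtain E where E: "E \<in> {0..M}" "m \<le> u (y, 0) + \<bar>R E y\<bar> - E" using init by blast
    have "\<Phi> (y, 1) E \<le> A (y, 1)" by (rule Es(2)[OF E(1)])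
    moreover have "\<kappa> * E\<^sup>2 \<le> \<kappa> * M\<^sup>2" using E \<kappa>0 by (intro mult_left_mono power_mono) auto
    ultimately show "m - e \<le> u (y, 0) + A (y, 1)"
      using E(2) low[OF E(1), of y] \<eta>(2) \<kappa>M unfolding \<Phi>_def fst_conv snd_conv by linarith
  qed
  then show "m \<le> u (0, 1) + e" by simp
qed

end

subsection \<open>Upper bounds along trajectories\<close>

context recurrent_potential
begin

lemma Hb_solution_lower_bound:
  fixes u :: "real \<times> real \<Rightarrow> real"
  assumes contu: "continuous_on (UNIV \<times> {0..}) u"
    and sub: "viscosity_subsolution (UNIV \<times> {0<..}) (evolution (\<lambda>x. Hb)) u"
    and sup: "viscosity_supersolution (UNIV \<times> {0<..}) (evolution (\<lambda>x. Hb)) u"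
    and M: "M \<ge> 0" and init: "\<And>y. \<exists>E\<in>{0..M}. m \<le> u (y, 0) + s E * \<bar>y\<bar> - E"
  shows "m \<le> u (0, 1)"
proof -
  define P where "P = sqrt (2 * (M + K))"
  have P: "P \<ge> 0" using M K_nonneg by (simp add: P_def)
  interpret slope_family "\<lambda>E y. s E" "\<lambda>E y. s E * y" M P
  proof
    show "M \<ge> 0" by (rule M)
    show "continuous_on ({0..M} \<times> UNIV) (\<lambda>z :: real \<times> real. s (fst z))"
      by (rule continuous_on_compose2[OF s_continuous]) (auto intro!: continuous_intros)
    fix E y :: real assume E: "E \<in> {0..M}"
    have "s E \<le> sqrt (2 * (E + K))" using E by (intro s_le) auto
    also have "\<dots> \<le> P" using E by (simp add: P_def)
    finally show "0 \<le> s E \<and> s E \<le> P" using s_nonneg E by simp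
    show "((\<lambda>y. s E * y) has_real_derivative s E) (at y)" by (auto intro!: derivative_eq_intros)
    fix E' :: real assume E': "E' \<in> {0..M}"
    show "(s E + s E') / 2 \<le> s ((E + E') / 2)" using E E' by (intro s_midpoint_concave) auto
    show "\<bar>s E - s E'\<bar> \<le> sqrt (2 * \<bar>E - E'\<bar>)"
      using s_diff_le[of E E'] s_diff_le[of E' E] s_mono[of E E'] s_mono[of E' E] E E'
      by (cases "E \<le> E'") auto
  qed simp
  show ?thesis
  proof (rule solution_lower_bound[OF contu sub sup Hb_ge_square K_nonneg])
    show "Hb (\<theta> * s E) \<le> E" if "E \<in> {0..M}" "\<bar>\<theta>\<bar> \<le> 1" for E \<theta>
      using that s_nonneg[of E] by (intro Hb_le) (auto simp: abs_mult mult_left_le_one_le)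

    show "0 \<le> P + sqrt (2 * K) + 1" using P K_nonneg by simp
    show "Hb (p + q) \<le> Hb p + (P + sqrt (2 * K) + 1) * (\<bar>q\<bar> + q\<^sup>2)" if "\<bar>p\<bar> \<le> P" for p q
    proof -
      have "Hb (p + q) \<le> Hb p + \<bar>q\<bar> * (\<bar>p\<bar> + \<bar>q\<bar> + sqrt (2 * K))" by (rule Hb_increment)
      also have "\<bar>q\<bar> * (\<bar>p\<bar> + \<bar>q\<bar> + sqrt (2 * K)) \<le> \<bar>q\<bar> * ((P + sqrt (2 * K)) + \<bar>q\<bar>)"
        using that by (intro mult_left_mono) auto
      also have "\<dots> = (P + sqrt (2 * K)) * \<bar>q\<bar> + q\<^sup>2" by (simp add: algebra_simps power2_eq_square)
      also have "\<dots> \<le> (P + sqrt (2 * K) + 1) * (\<bar>q\<bar> + q\<^sup>2)"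
      proof -
        have "0 \<le> (P + sqrt (2 * K)) * q\<^sup>2" using P K_nonneg by simp
        then show ?thesis by (simp add: algebra_simps)
      qed
      finally show ?thesis by simp
    qed
    show "\<exists>E\<in>{0..M}. m \<le> u (y, 0) + \<bar>s E * y\<bar> - E" for y
      using init[of y] s_nonneg by (auto simp: abs_mult)
  qed
qed

text \<open>The cones use the action \<open>S E\<close> itself; passing from
  \<open>\<bar>S E y\<bar>\<close> to \<open>s E * \<bar>y\<bar>\<close> costs \<open>C\<close> and
  makes the hypothesis comparable with the effective problem.\<close>

lemma H_solution_lower_bound:
  fixes u :: "real \<times> real \<Rightarrow> real"
  assumes contu: "continuous_on (UNIV \<times> {0..}) u"
    and sub: "viscosity_subsolution (UNIV \<times> {0<..}) (evolution H) u"
    and sup: "viscosity_supersolution (UNIV \<times> {0<..}) (evolution H) u"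
    and M: "M \<ge> 0" and init: "\<And>y. \<exists>E\<in>{0..M}. m \<le> u (y, 0) + s E * \<bar>y\<bar> - E - C"
  shows "m \<le> u (0, 1)"
proof -
  define P where "P = sqrt (2 * (M + K))"
  have P: "P \<ge> 0" using M K_nonneg by (simp add: P_def)
  interpret slope_family "\<lambda>E y. sqrt (2 * (E + V y))" S M P
  proof
    show "M \<ge> 0" by (rule M)
    show "S E 0 = 0" for E by (rule S_0)
    have "continuous_on ({0..M} \<times> UNIV) (\<lambda>z :: real \<times> real. V (snd z))"
      by (rule continuous_on_compose2[OF contV]) (auto intro!: continuous_intros)
    then show "continuous_on ({0..M} \<times> UNIV) (\<lambda>z. sqrt (2 * (fst z + V (snd z))))"
      by (intro continuous_intros)
    fix E y :: real assume E: "E \<in> {0..M}"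
    have "E + V y \<le> M + K" using E V_le[of y] by auto
    then show "0 \<le> sqrt (2 * (E + V y)) \<and> sqrt (2 * (E + V y)) \<le> P"
      using E V_nonneg[of y] by (simp add: P_def)
    show "(S E has_real_derivative sqrt (2 * (E + V y))) (at y)" using E by (intro S_deriv) auto
    fix E' :: real assume E': "E' \<in> {0..M}"
    have "2 * ((E + E') / 2 + V y) = (2 * (E + V y) + 2 * (E' + V y)) / 2" by (simp add: field_simps)
    moreover have "(sqrt (2 * (E + V y)) + sqrt (2 * (E' + V y))) / 2 \<le> sqrt ((2 * (E + V y) + 2 * (E' + V y)) / 2)"
      using E E' V_nonneg[of y] by (intro sqrt_midpoint) auto
    ultimately show "(sqrt (2 * (E + V y)) + sqrt (2 * (E' + V y))) / 2 \<le> sqrt (2 * ((E + E') / 2 + V y))"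
      by (simp only:)
    have *: "\<bar>sqrt (2 * (a + V y)) - sqrt (2 * (b + V y))\<bar> \<le> sqrt (2 * \<bar>a - b\<bar>)"
      if "0 \<le> a" "a \<le> b" for a b
    proof -
      have "2 * (b + V y) = 2 * (b - a) + 2 * (a + V y)" by simp
      then have "sqrt (2 * (b + V y)) \<le> sqrt (2 * (b - a)) + sqrt (2 * (a + V y))"
        using that V_nonneg[of y] by (simp only:) (intro sqrt_add_le_add_sqrt; simp)
      moreover have "sqrt (2 * (a + V y)) \<le> sqrt (2 * (b + V y))" using that by simp
      moreover have "\<bar>a - b\<bar> = b - a" using that by simp
      ultimately show ?thesis by simp
    qed
    show "\<bar>sqrt (2 * (E + V y)) - sqrt (2 * (E' + V y))\<bar> \<le> sqrt (2 * \<bar>E - E'\<bar>)"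
      using *[of E E'] *[of E' E] E E' by (cases "E \<le> E'") (auto simp: abs_minus_commute)
  qed
  show ?thesis
  proof (rule solution_lower_bound[OF contu sub sup _ K_nonneg])
    show "q\<^sup>2 / 2 - K \<le> H x q" for x q using V_le[of x] by (simp add: H_def)
    show "H y (\<theta> * sqrt (2 * (E + V y))) \<le> E" if "E \<in> {0..M}" "\<bar>\<theta>\<bar> \<le> 1" for E y \<theta>
    proof -
      have "0 \<le> E + V y" using that V_nonneg[of y] by simp
      then have "\<bar>\<theta> * sqrt (2 * (E + V y))\<bar>\<^sup>2 = 2 * (\<theta>\<^sup>2 * (E + V y))"
        by (simp add: power_mult_distrib abs_mult)
      moreover have "\<theta>\<^sup>2 * (E + V y) \<le> E + V y"
        using that V_nonneg[of y] by (intro mult_left_le_one_le) (auto simp: abs_square_le_1)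
      ultimately show ?thesis by (simp add: H_def)
    qed
    show "0 \<le> P + 1" using P by simp
    show "H x (p + q) \<le> H x p + (P + 1) * (\<bar>q\<bar> + q\<^sup>2)" if "\<bar>p\<bar> \<le> P" for x p q
    proof -
      have "H x (p + q) = H x p + (p * q + q\<^sup>2 / 2)" by (simp add: H_def power2_sum field_simps)
      moreover have "p * q \<le> P * \<bar>q\<bar>"
      proof -
        have "p * q \<le> \<bar>p\<bar> * \<bar>q\<bar>" by (metis abs_ge_self abs_mult)
        also have "\<dots> \<le> P * \<bar>q\<bar>" using that by (rule mult_right_mono) simp
        finally show ?thesis .
      qed
      moreover have "(P + 1) * (\<bar>q\<bar> + q\<^sup>2) = P * \<bar>q\<bar> + q\<^sup>2 / 2 + (P * q\<^sup>2 + \<bar>q\<bar> + q\<^sup>2 / 2)"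
        by (simp add: algebra_simps)
      moreover have "0 \<le> P * q\<^sup>2 + \<bar>q\<bar> + q\<^sup>2 / 2" using P by simp
      ultimately show ?thesis by linarith
    qed
    fix y
    obtain E where E: "E \<in> {0..M}" "m \<le> u (y, 0) + s E * \<bar>y\<bar> - E - C" using init by blast
    have "\<bar>s E * y\<bar> = s E * \<bar>y\<bar>" using s_nonneg[of E] E by (simp add: abs_mult)
    then have "s E * \<bar>y\<bar> - C \<le> \<bar>S E y\<bar>" using disc0[of E y] E by auto
    then show "\<exists>E\<in>{0..M}. m \<le> u (y, 0) + \<bar>S E y\<bar> - E" using E by (intro bexI[of _ E]) auto
  qed
qed

text \<open>On the segment of velocity -y the Lagrangian is at most the maximum of
  \<open>s E * \<bar>y\<bar> - E\<close>, since \<open>\<bar>q\<bar> \<le> s (Hb q)\<close> lets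
  \<open>Hb q\<close> play the role of \<open>E\<close>. Above \<open>M\<close> this expression is
  at most 0, whereas \<open>E = 0\<close> already makes the maximum nonnegative.\<close>

lemma Hb_subsolution_upper_bound:
  fixes u :: "real \<times> real \<Rightarrow> real"
  assumes contu: "continuous_on (UNIV \<times> {0..}) u"
    and sub: "viscosity_subsolution (UNIV \<times> {0<..}) (evolution (\<lambda>x. Hb)) u"
    and y: "\<bar>y\<bar> \<le> R" and M: "M \<ge> 4 * R\<^sup>2 + K"
  shows "\<exists>E\<in>{0..M}. u (0, 1) \<le> u (y, 0) + s E * \<bar>y\<bar> - E"
proof -
  have M0: "M \<ge> 0" using M K_nonneg zero_le_power2[of R] by linarith
  have "continuous_on {0..M} (\<lambda>E. s E * \<bar>y\<bar> - E)"
    by (intro continuous_intros continuous_on_subset[OF s_continuous]) auto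
  then obtain E0 where E0: "E0 \<in> {0..M}" "\<And>E. E \<in> {0..M} \<Longrightarrow> s E * \<bar>y\<bar> - E \<le> s E0 * \<bar>y\<bar> - E0"
    using continuous_attains_sup[of "{0..M}" "\<lambda>E. s E * \<bar>y\<bar> - E"] M0 by auto
  define L where "L = s E0 * \<bar>y\<bar> - E0"
  have L0: "0 \<le> L"
  proof -
    have "0 \<le> s 0 * \<bar>y\<bar> - 0" using s_nonneg[of 0] by simp
    also have "\<dots> \<le> L" unfolding L_def using M0 by (intro E0(2)) simp
    finally show ?thesis .
  qed
  have "u (0, 1) - u (y, 0) \<le> L * (1 - 0)"
  proof (rule subsolution_line[OF contu sub])
    fix q
    have "q * ((0 - y) / (1 - 0)) \<le> \<bar>q\<bar> * \<bar>y\<bar>" by (simp add: abs_mult[symmetric] abs_le_D2 del: abs_mult)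
    also have "\<dots> \<le> s (Hb q) * \<bar>y\<bar>" using Hb(2) by (rule mult_right_mono) simp
    finally have 1: "q * ((0 - y) / (1 - 0)) - Hb q \<le> s (Hb q) * \<bar>y\<bar> - Hb q" by simp
    show "q * ((0 - y) / (1 - 0)) - Hb q \<le> L"
    proof (cases "Hb q \<le> M")
      case True
      then show ?thesis using 1 E0(2)[of "Hb q"] Hb(1)[of q] unfolding L_def by simp
    next
      case False
      define E where "E = Hb q"
      have E: "E \<ge> 4 * R\<^sup>2 + K" "E \<ge> 0" using False M Hb(1) by (auto simp: E_def)
      have "s E * \<bar>y\<bar> \<le> sqrt (2 * (E + K)) * \<bar>R\<bar>"
        using s_le[OF E(2)] s_nonneg[OF E(2)] y E(2) K_nonneg by (intro mult_mono) auto
      also have "\<dots> = sqrt (2 * (E + K) * R\<^sup>2)" by (simp add: real_sqrt_mult)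
      also have "\<dots> \<le> sqrt (E\<^sup>2)"
      proof (rule real_sqrt_le_mono)
        have "(2 * (E + K)) * R\<^sup>2 \<le> (4 * E) * R\<^sup>2"
        proof (rule mult_right_mono)
          have "K \<le> E" using E(1) zero_le_power2[of R] by linarith
          then show "2 * (E + K) \<le> 4 * E" by simp
        qed simp
        also have "\<dots> = (4 * R\<^sup>2) * E" by simp
        also have "\<dots> \<le> E * E" using E K_nonneg by (intro mult_right_mono) auto
        finally show "2 * (E + K) * R\<^sup>2 \<le> E\<^sup>2" by (simp add: power2_eq_square)
      qed
      also have "\<dots> = E" using E by simp
      finally show ?thesis using 1 L0 by (simp add: E_def)
    qed
  qed auto
  then show ?thesis using E0(1) unfolding L_def by (intro bexI[of _ E0]) auto
qed

section \<open>Trajectories of positive energy, and waiting near a zero of the potential\<close>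

lemma H_ge_square: "q\<^sup>2 / 2 - K \<le> H x q"
  using V_le[of x] by (simp add: H_def)

text \<open>The signed travel time from 0 to x at energy \<open>E\<close>; only for
  \<open>E > 0\<close> is the speed guaranteed to stay away from 0.\<close>

definition F :: "real \<Rightarrow> real \<Rightarrow> real" where
  "F E = (SOME f. (\<forall>x. (f has_real_derivative 1 / sqrt (2 * (E + V x))) (at x)) \<and> f 0 = 0)"

lemma F: assumes E: "E > 0"
  shows "(F E has_real_derivative 1 / sqrt (2 * (E + V x))) (at x)" "F E 0 = 0"
proof -
  have p: "0 < E + V x" for x using E V_nonneg[of x] by simp
  have "0 < sqrt (2 * (E + V x))" for x using p[of x] by simp
  then have "sqrt (2 * (E + V x)) \<noteq> 0" for x by (metis less_irrefl)
  then have "continuous_on UNIV (\<lambda>x. 1 / sqrt (2 * (E + V x)))"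
    by (intro continuous_intros contV ballI)
  then obtain f where f: "\<And>x. (f has_real_derivative 1 / sqrt (2 * (E + V x))) (at x)"
    using ex_antiderivative by blast
  have "\<forall>x. ((\<lambda>x. f x - f 0) has_real_derivative 1 / sqrt (2 * (E + V x))) (at x)"
    using DERIV_diff[OF f DERIV_const[of "f 0"]] by simp
  then have "\<exists>f. (\<forall>x. (f has_real_derivative 1 / sqrt (2 * (E + V x))) (at x)) \<and> f 0 = 0"
    by (intro exI[of _ "\<lambda>x. f x - f 0"]) simp
  from someI_ex[OF this, folded F_def]
  show "(F E has_real_derivative 1 / sqrt (2 * (E + V x))) (at x)" "F E 0 = 0" by auto
qed

lemma speed_pos: "E > 0 \<Longrightarrow> 0 < sqrt (2 * (E + V x))"
  using V_nonneg[of x] by simp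

lemma F_expanding:
  assumes E: "E > 0" and xy: "x \<le> y"
  shows "(y - x) / sqrt (2 * (E + K)) \<le> F E y - F E x"
proof (cases "x = y")
  case False
  then obtain z where z: "F E y - F E x = (y - x) * (1 / sqrt (2 * (E + V z)))"
    using MVT2[of x y "F E"] F(1)[OF E] xy by force
  have "1 / sqrt (2 * (E + K)) \<le> 1 / sqrt (2 * (E + V z))"
    using speed_pos[OF E, of z] V_le[of z] by (intro divide_left_mono mult_pos_pos) (auto intro: less_le_trans)
  then have "(y - x) * (1 / sqrt (2 * (E + K))) \<le> F E y - F E x" unfolding z
    using xy by (intro mult_left_mono) auto
  then show ?thesis by simp
qed simp

text \<open>The trajectories of energy \<open>E\<close> are read off from the inverse of the travel time \<open>F E\<close>.\<close>

lemma F_inverse: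
  assumes E: "E > 0"
  obtains X where "\<And>x. X (F E x) = x" "\<And>c. F E (X c) = c"
    "\<And>c. (X has_real_derivative sqrt (2 * (E + V (X c)))) (at c)"
proof -
  define L where "L = sqrt (2 * (E + K))"
  have L: "L > 0" using E K_nonneg by (simp add: L_def)
  have ex: "y - x \<le> L * (F E y - F E x)" if "x \<le> y" for x y
  proof -
    have "(y - x) / L \<le> F E y - F E x" using F_expanding[OF E that] unfolding L_def .
    then show ?thesis using L by (simp add: pos_divide_le_eq mult.commute)
  qed
  have cF: "continuous_on UNIV (F E)" using F(1)[OF E] by (rule DERIV_continuous_on_UNIV)
  have inj: "F E x \<noteq> F E y" if "x < y" for x y using ex[of x y] that by auto
  \<comment> \<open>The speed is at most \<open>L\<close>, so travel times grow at least linearly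
    with distance and every value is attained.\<close>
  have surj: "\<exists>x. F E x = c" for c
  proof -
    define b where "b = L * \<bar>c\<bar>"
    have b: "b \<ge> 0" using L by (simp add: b_def)
    have "L * \<bar>c\<bar> \<le> L * F E b" using ex[of 0 b] b by (simp add: F(2)[OF E] b_def)
    then have 1: "\<bar>c\<bar> \<le> F E b" using L by simp
    have "L * \<bar>c\<bar> \<le> L * - F E (- b)" using ex[of "- b" 0] b by (simp add: F(2)[OF E] b_def)
    then have 2: "\<bar>c\<bar> \<le> - F E (- b)" using L by (simp only: mult_le_cancel_left_pos)
    have "\<exists>x\<ge>- b. x \<le> b \<and> F E x = c"
      using 1 2 b by (intro IVT') (auto intro: continuous_on_subset[OF cF])
    then show ?thesis by blast
  qed
  then obtain X where X: "\<And>c. F E (X c) = c" by metis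
  have X': "X (F E x) = x" for x
    using X[of "F E x"] inj[of "X (F E x)" x] inj[of x "X (F E x)"] by (cases "X (F E x)" x rule: linorder_cases) auto
  have lip: "\<bar>X c - X c'\<bar> \<le> L * \<bar>c - c'\<bar>" for c c'
  proof -
    have "\<bar>X c - X c'\<bar> \<le> L * \<bar>F E (X c) - F E (X c')\<bar>"
    proof (cases "X c \<le> X c'")
      case True
      have "L * (F E (X c') - F E (X c)) \<le> L * \<bar>F E (X c) - F E (X c')\<bar>" using L by (intro mult_left_mono) auto
      then show ?thesis using ex[OF True] True by simp
    next
      case False
      then have le: "X c' \<le> X c" by simp
      have "L * (F E (X c) - F E (X c')) \<le> L * \<bar>F E (X c) - F E (X c')\<bar>" using L by (intro mult_left_mono) auto
      then show ?thesis using ex[OF le] le by simp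
    qed
    then show ?thesis by (simp add: X)
  qed
  have cX: "isCont X c" for c
  proof -
    have "L-lipschitz_on UNIV X" using lip L by (intro lipschitz_onI) (auto simp: dist_real_def)
    then have "continuous_on UNIV X" by (rule lipschitz_on_continuous_on)
    then show ?thesis by (simp add: continuous_on_eq_continuous_at)
  qed
  have dX: "(X has_real_derivative sqrt (2 * (E + V (X c)))) (at c)" for c
  proof -
    have "(X has_real_derivative inverse (1 / sqrt (2 * (E + V (X c))))) (at c)"
      by (rule DERIV_inverse_function[where f = "F E" and a = "c - 1" and b = "c + 1"])
         (use F(1)[OF E] speed_pos[OF E, of "X c"] X cX in auto)
    then show ?thesis by simp
  qed
  show ?thesis by (rule that[OF X' X dX])
qed

text \<open>On a trajectory of energy \<open>E\<close> the Lagrangian, kinetic energy plus V, equals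
  the squared speed minus \<open>E\<close>; it integrates to the action minus \<open>E\<close> times
  the travel time, and the discrepancy then replaces the action.\<close>

lemma energy_path:
  fixes u :: "real \<times> real \<Rightarrow> real"
  assumes contu: "continuous_on (UNIV \<times> {0..}) u"
    and sub: "viscosity_subsolution (UNIV \<times> {0<..}) (evolution H) u"
    and E: "E > 0"
  shows "u (0, \<bar>F E y\<bar>) \<le> u (y, 0) + s E * \<bar>y\<bar> + C - E * \<bar>F E y\<bar>"
proof (cases "y = 0")
  case True
  have "C \<ge> 0" using disc0[of 0 0] by (simp add: S_0)
  then show ?thesis using True F(2)[OF E] by simp
next
  case False
  obtain X where X: "\<And>x. X (F E x) = x" "\<And>c. F E (X c) = c"
    and dX: "\<And>c. (X has_real_derivative sqrt (2 * (E + V (X c)))) (at c)"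
    using F_inverse[OF E] by blast
  define c0 where "c0 = F E y"
  define \<tau> where "\<tau> = \<bar>c0\<bar>"
  have c0: "c0 \<noteq> 0" using X(1)[of y] X(1)[of 0] F(2)[OF E] False by (auto simp: c0_def)
  then have \<tau>: "\<tau> > 0" by (simp add: \<tau>_def)
  \<comment> \<open>The sign is chosen so that the travel-time coordinate runs from
    \<open>c0\<close> to 0 in time \<open>\<tau>\<close>.\<close>
  define d :: real where "d = - sgn c0"
  have d: "d * d = 1" "c0 + d * \<tau> = 0" using c0 by (auto simp: d_def \<tau>_def sgn_if abs_if)
  define g where "g t = X (c0 + d * t)" for t
  define g' where "g' t = d * sqrt (2 * (E + V (g t)))" for t
  have dg: "(g has_real_derivative g' t) (at t)" for t
  proof -
    have "((\<lambda>t. c0 + d * t) has_real_derivative d) (at t)" by (auto intro!: derivative_eq_intros)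
    from DERIV_chain2[OF dX this] show ?thesis unfolding g_def[abs_def] g'_def by (simp add: mult.commute)
  qed
  have cg: "continuous_on UNIV g" using dg by (rule DERIV_continuous_on_UNIV)
  have cVg: "continuous_on UNIV (\<lambda>t. V (g t))" by (rule continuous_on_compose2[OF contV cg]) auto
  have cg': "continuous_on UNIV g'" unfolding g'_def by (intro continuous_intros cVg)
  have g'2: "(g' t)\<^sup>2 = 2 * (E + V (g t))" for t
  proof -
    have "(g' t)\<^sup>2 = (d * d) * (sqrt (2 * (E + V (g t))))\<^sup>2" unfolding g'_def by (simp only: power2_eq_square mult_ac)
    then show ?thesis using d E V_nonneg[of "g t"] by simp
  qed
  define \<Phi> where "\<Phi> t = d * S E (g t) - E * t" for t
  define \<Phi>' where "\<Phi>' t = E + 2 * V (g t)" for t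
  have d\<Phi>: "(\<Phi> has_real_derivative \<Phi>' t) (at t)" for t
  proof -
    have "((\<lambda>t. S E (g t)) has_real_derivative sqrt (2 * (E + V (g t))) * g' t) (at t)"
      using E by (intro DERIV_chain2[OF S_deriv dg]) auto
    then have "(\<Phi> has_real_derivative d * (sqrt (2 * (E + V (g t))) * g' t) - E) (at t)"
      unfolding \<Phi>_def[abs_def] by (auto intro!: derivative_eq_intros)
    moreover have "d * (sqrt (2 * (E + V (g t))) * g' t) = (g' t)\<^sup>2" unfolding g'_def by (simp add: power2_eq_square mult_ac)
    ultimately show ?thesis by (simp add: g'2 \<Phi>'_def)
  qed
  have "u (g \<tau>, \<tau>) - u (g 0, 0) \<le> \<Phi> \<tau> - \<Phi> 0"
  proof (rule subsolution_along_curve[OF contu sub order_refl \<tau> dg cg' d\<Phi>, where c = "\<lambda>z. (g' (snd z))\<^sup>2 / 2 + V (fst z)"])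
    show "continuous_on UNIV \<Phi>'" unfolding \<Phi>'_def by (intro continuous_intros cVg)
    show "continuous_on UNIV (\<lambda>z. (g' (snd z))\<^sup>2 / 2 + V (fst z))"
      by (intro continuous_intros continuous_on_compose2[OF cg'] continuous_on_compose2[OF contV]) auto
    show "q * g' t - H x q \<le> (g' (snd (x, t)))\<^sup>2 / 2 + V (fst (x, t))" for x t q
      using quadratic_Fenchel[of q "g' t"] by (simp add: H_def)
    show "(g' (snd (g t, t)))\<^sup>2 / 2 + V (fst (g t, t)) \<le> \<Phi>' t" for t
      by (simp add: g'2 \<Phi>'_def)
  qed
  moreover have "g \<tau> = 0" using d(2) X(1)[of 0] F(2)[OF E] by (simp add: g_def)
  moreover have "g 0 = y" using X(1)[of y] by (simp add: g_def c0_def)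
  ultimately have 1: "u (0, \<tau>) - u (y, 0) \<le> - (d * S E y) - E * \<tau>" by (simp add: \<Phi>_def S_0)
  have "\<bar>d * S E y\<bar> \<le> s E * \<bar>y\<bar> + C"
  proof -
    have "\<bar>d\<bar> = 1" using c0 by (simp add: d_def abs_sgn_eq)
    moreover have "\<bar>S E y\<bar> \<le> \<bar>s E * y\<bar> + C" using disc0[of E y] E by linarith
    ultimately show ?thesis using s_nonneg[of E] E by (simp add: abs_mult)
  qed
  then show ?thesis using 1 unfolding \<tau>_def c0_def by linarith
qed

text \<open>Go to \<open>x\<close> in time \<open>d\<close>, rest there at cost at most
  \<open>v\<close> per unit time, and return in time \<open>d\<close>. If no more than
  \<open>2 * d\<close> is left, resting at 0 costs at most \<open>K\<close> per unit time.\<close>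

lemma waiting:
  fixes u :: "real \<times> real \<Rightarrow> real"
  assumes contu: "continuous_on (UNIV \<times> {0..}) u"
    and sub: "viscosity_subsolution (UNIV \<times> {0<..}) (evolution H) u"
    and \<tau>: "0 \<le> \<tau>" "\<tau> \<le> 1" and d: "d > 0" and x: "\<bar>x\<bar> \<le> d" "V x \<le> v"
  shows "u (0, 1) \<le> u (0, \<tau>) + (2 * K + 1) * d + v"
proof -
  have v: "v \<ge> 0" using x V_nonneg[of x] by linarith
  note line = subsolution_line_quadratic[OF contu sub _ _ H_ge_square]
  show ?thesis
  proof (cases "1 - \<tau> \<le> 2 * d")
    case True
    have "u (0, 1) \<le> u (0, \<tau>) + K * (1 - \<tau>)"
    proof (cases "\<tau> = 1")
      case False
      then show ?thesis using line[of \<tau> 1 0 0] \<tau> by simp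
    qed simp
    also have "K * (1 - \<tau>) \<le> K * (2 * d)" using True K_nonneg by (rule mult_left_mono)
    finally show ?thesis using v d by (simp add: algebra_simps)
  next
    case False
    have x2: "x\<^sup>2 / (2 * d) \<le> d / 2"
    proof -
      have "x\<^sup>2 \<le> d\<^sup>2" using power_mono[OF x(1), of 2] by simp
      then show ?thesis using d by (simp add: field_simps power2_eq_square)
    qed
    have "u (x, \<tau> + d) \<le> u (0, \<tau>) + (x - 0)\<^sup>2 / (2 * (\<tau> + d - \<tau>)) + K * (\<tau> + d - \<tau>)"
      using \<tau> d by (intro line) auto
    then have 1: "u (x, \<tau> + d) \<le> u (0, \<tau>) + d / 2 + K * d" using x2 by simp
    have "u (0, 1) \<le> u (x, 1 - d) + (0 - x)\<^sup>2 / (2 * (1 - (1 - d))) + K * (1 - (1 - d))"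
      using \<tau> d False by (intro line) auto
    then have 2: "u (0, 1) \<le> u (x, 1 - d) + d / 2 + K * d" using x2 by simp
    have "u (x, 1 - d) - u (x, \<tau> + d) \<le> v * (1 - d) - v * (\<tau> + d)"
    proof (rule subsolution_along_curve[OF contu sub, where g = "\<lambda>t. x" and g' = "\<lambda>t. 0" and \<Phi> = "\<lambda>t. v * t"
          and \<Phi>' = "\<lambda>t. v" and c = "\<lambda>z. V (fst z)"])
      show "continuous_on UNIV (\<lambda>z :: real \<times> real. V (fst z))"
        by (rule continuous_on_compose2[OF contV]) (auto intro!: continuous_intros)
      show "q * 0 - H y q \<le> V (fst (y, t))" for y t q by (simp add: H_def)
    qed (use \<tau> d False x in \<open>auto intro!: derivative_eq_intros\<close>)
    also have "v * (1 - d) - v * (\<tau> + d) = v * (1 - \<tau> - 2 * d)" by (simp add: algebra_simps)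
    also have "\<dots> \<le> v" using v \<tau> d by (intro mult_left_le) auto
    finally have 3: "u (x, 1 - d) - u (x, \<tau> + d) \<le> v" .
    have "(2 * K + 1) * d = K * d + K * d + d / 2 + d / 2" by (simp add: algebra_simps)
    then show ?thesis using 1 2 3 by linarith
  qed
qed

lemma travel_time_continuous:
  assumes E0: "E0 > 0" shows "continuous_on {E0..} (\<lambda>E. F E y)"
proof (rule continuous_onI)
  fix E e :: real assume E: "E \<in> {E0..}" and e: "e > 0"
  define k where "k = 2 * E0 * e / (\<bar>y\<bar> + 1)"
  have k: "k > 0" using E0 e by (simp add: k_def)
  have "dist (F E' y) (F E y) \<le> e" if E': "E' \<in> {E0..}" "dist E' E < k\<^sup>2 / 2" for E'
  proof -
    have Ep: "E > 0" "E' > 0" using E E' E0 by auto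
    have bd: "\<bar>1 / sqrt (2 * (E' + V x)) - 1 / sqrt (2 * (E + V x))\<bar> \<le> e / (\<bar>y\<bar> + 1)" for x
    proof -
      define a where "a = sqrt (2 * (E' + V x))"
      define b where "b = sqrt (2 * (E + V x))"
      have ab: "a > 0" "b > 0" using Ep speed_pos by (auto simp: a_def b_def)
      have lo: "sqrt (2 * E0) \<le> a" "sqrt (2 * E0) \<le> b" using E E' V_nonneg[of x] by (auto simp: a_def b_def)
      have "sqrt (2 * E0) * sqrt (2 * E0) \<le> a * b" using lo E0 ab by (intro mult_mono) auto
      then have ab2: "2 * E0 \<le> a * b" using E0 by simp
      have h: "\<bar>sqrt (p + r) - sqrt p\<bar> \<le> sqrt r" if "0 \<le> p" "0 \<le> r" for p r :: real
        using sqrt_add_le_add_sqrt[OF that] that by simp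
      have "\<bar>b - a\<bar> \<le> sqrt (2 * \<bar>E' - E\<bar>)"
      proof (cases "E \<le> E'")
        case True
        have "2 * (E' + V x) = 2 * (E + V x) + 2 * (E' - E)" by simp
        have "\<bar>a - b\<bar> \<le> sqrt (2 * (E' - E))" unfolding a_def b_def \<open>2 * (E' + V x) = _\<close>
          using True Ep V_nonneg[of x] by (intro h) auto
        moreover have "\<bar>E' - E\<bar> = E' - E" using True by simp
        ultimately show ?thesis unfolding abs_minus_commute[of b a] by simp
      next
        case False
        have "2 * (E + V x) = 2 * (E' + V x) + 2 * (E - E')" by simp
        have "\<bar>b - a\<bar> \<le> sqrt (2 * (E - E'))" unfolding a_def b_def \<open>2 * (E + V x) = _\<close>
          using False Ep V_nonneg[of x] by (intro h) auto
        moreover have "\<bar>E' - E\<bar> = E - E'" using False by simp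
        ultimately show ?thesis by simp
      qed
      also have "\<dots> \<le> sqrt (k\<^sup>2)" using E'(2) by (intro real_sqrt_le_mono) (simp add: dist_real_def)
      also have "\<dots> = k" using k by simp
      finally have "\<bar>b - a\<bar> \<le> k" .
      then have "\<bar>b - a\<bar> / (a * b) \<le> k / (2 * E0)" using ab2 E0 k by (intro frac_le) auto
      moreover have "1 / a - 1 / b = (b - a) / (a * b)" using ab by (simp add: field_simps)
      ultimately have "\<bar>1 / a - 1 / b\<bar> \<le> k / (2 * E0)" using ab by (simp add: abs_mult)
      then show ?thesis using E0 by (simp add: k_def a_def b_def)
    qed
    have "\<bar>(F E' y - F E y) - (F E' 0 - F E 0)\<bar> \<le> e / (\<bar>y\<bar> + 1) * \<bar>y - 0\<bar>"
      by (rule Lipschitz_of_derivative_bound[OF DERIV_diff[OF F(1)[OF Ep(2)] F(1)[OF Ep(1)]] bd])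
    also have "\<dots> \<le> e" using e by (simp add: divide_le_eq field_simps)
    finally show ?thesis using F(2) Ep by (simp add: dist_real_def)
  qed
  moreover have "k\<^sup>2 / 2 > 0" using k by simp
  ultimately show "\<exists>d>0. \<forall>x'\<in>{E0..}. dist x' E < d \<longrightarrow> dist (F x' y) (F E y) \<le> e" by blast
qed

text \<open>If some energy carries \<open>y\<close> to \<open>0\<close> in exactly unit time, that trajectory is optimal up to the
  discrepancy; otherwise the trajectory of energy \<open>E0\<close> arrives early and waits near a zero of \<open>V\<close>.\<close>

lemma H_subsolution_upper_bound:
  fixes u :: "real \<times> real \<Rightarrow> real"
  assumes contu: "continuous_on (UNIV \<times> {0..}) u"
    and sub: "viscosity_subsolution (UNIV \<times> {0<..}) (evolution H) u"
    and E0: "E0 > 0" and d: "d > 0" and x: "\<bar>x\<bar> \<le> d" "V x \<le> v"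
    and y: "y\<^sup>2 \<le> 2 * M" and M: "E0 \<le> M"
  shows "\<exists>E\<in>{0..M}. u (0, 1) \<le> u (y, 0) + s E * \<bar>y\<bar> - E + (C + E0 + (2 * K + 1) * d + v)"
proof (cases "\<bar>F E0 y\<bar> \<le> 1")
  case True
  \<comment> \<open>Arriving early forgoes a gain of \<open>E0\<close> per unit of remaining time,
    at most \<open>E0\<close> in total.\<close>
  have "E0 * (1 - \<bar>F E0 y\<bar>) \<le> E0 * 1" using E0 by (intro mult_left_mono) auto
  then have "- (E0 * \<bar>F E0 y\<bar>) \<le> - E0 + E0" by (simp add: right_diff_distrib)
  then have "u (0, 1) \<le> u (y, 0) + s E0 * \<bar>y\<bar> - E0 + (C + E0 + (2 * K + 1) * d + v)"
    using energy_path[OF contu sub E0, of y] waiting[OF contu sub _ True d x] by simp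
  then show ?thesis using E0 M by (intro bexI[of _ E0]) auto
next
  case False
  have cont: "continuous_on {E0..max E0 (y\<^sup>2 / 2)} (\<lambda>E. - \<bar>F E y\<bar>)"
    by (intro continuous_intros continuous_on_subset[OF travel_time_continuous[OF E0]]) auto
  \<comment> \<open>From energy \<open>y\<^sup>2 / 2\<close> on the speed is at least
    \<open>\<bar>y\<bar>\<close>, so the time is at most 1; at \<open>E0\<close> it exceeds 1, and
    some energy in between gives exactly 1.\<close>
  have Y: "\<bar>F E y\<bar> \<le> 1" if "E > 0" "E \<ge> y\<^sup>2 / 2" for E
  proof -
    have "\<bar>F E y - F E 0\<bar> \<le> 1 / sqrt (2 * E) * \<bar>y - 0\<bar>"
    proof (rule Lipschitz_of_derivative_bound[OF F(1)[OF that(1)]])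
      fix x
      show "\<bar>1 / sqrt (2 * (E + V x))\<bar> \<le> 1 / sqrt (2 * E)"
        using that V_nonneg[of x] by (simp add: frac_le)
    qed
    moreover have "\<bar>y\<bar> \<le> sqrt (2 * E)" using that by (intro real_le_rsqrt) simp
    then have "1 / sqrt (2 * E) * \<bar>y\<bar> \<le> 1" using that by (simp add: divide_le_eq)
    ultimately show ?thesis using F(2)[OF that(1)] by simp
  qed
  have "\<bar>F (max E0 (y\<^sup>2 / 2)) y\<bar> \<le> 1" using E0 by (intro Y) auto
  then have "\<exists>E\<ge>E0. E \<le> max E0 (y\<^sup>2 / 2) \<and> - \<bar>F E y\<bar> = - 1"
    using False by (intro IVT' cont) auto
  then obtain E where E: "E \<ge> E0" "E \<le> max E0 (y\<^sup>2 / 2)" "\<bar>F E y\<bar> = 1" by auto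
  have Ep: "E > 0" using E E0 by simp
  have "v \<ge> 0" using x V_nonneg[of x] by linarith
  moreover have "0 \<le> (2 * K + 1) * d" using K_nonneg d by simp
  ultimately have "u (0, 1) \<le> u (y, 0) + s E * \<bar>y\<bar> - E + (C + E0 + (2 * K + 1) * d + v)"
    using energy_path[OF contu sub Ep, of y] E(3) E0 by simp
  moreover have "E \<le> M" using E(2) y M by simp
  ultimately show ?thesis using Ep by (intro bexI[of _ E]) auto
qed

lemma solution_at_rest:
  fixes u :: "real \<times> real \<Rightarrow> real"
  assumes "continuous_on (UNIV \<times> {0..}) u" "viscosity_subsolution (UNIV \<times> {0<..}) (evolution G) u"
    "\<And>x q. q\<^sup>2 / 2 - K \<le> G x q"
  shows "u (0, 1) \<le> u (0, 0) + K"
  using subsolution_line_quadratic[OF assms(1,2) _ _ assms(3), of 0 1 0 0] by simp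

end

subsection \<open>Rates of convergence\<close>

text \<open>Rescaling space leaves the mean slopes unchanged, hence also \<open>Hb\<close>, and
  multiplies the discrepancy by \<open>\<epsilon>\<close>.\<close>

lemma recurrent_potential_scale:
  assumes "recurrent_potential V K C S s" and \<epsilon>: "\<epsilon> > 0"
  shows "recurrent_potential (\<lambda>x. V (x / \<epsilon>)) K (C * \<epsilon>) (\<lambda>E x. \<epsilon> * S E (x / \<epsilon>)) s"
proof -
  interpret recurrent_potential V K C S s by fact
  show ?thesis
  proof
    show "continuous_on UNIV (\<lambda>x. V (x / \<epsilon>))"
      by (rule continuous_on_compose2[OF contV]) (use \<epsilon> in \<open>auto intro!: continuous_intros\<close>)
    show "0 \<le> V (x / \<epsilon>)" "V (x / \<epsilon>) \<le> K" for x by (rule V_nonneg, rule V_le)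
    show "\<epsilon> * S E (0 / \<epsilon>) = 0" for E by (simp add: S_0)
    fix E :: real assume E: "E \<ge> 0"
    show "((\<lambda>x. \<epsilon> * S E (x / \<epsilon>)) has_real_derivative sqrt (2 * (E + V (x / \<epsilon>)))) (at x)" for x
    proof -
      have "((\<lambda>x. x / \<epsilon>) has_real_derivative 1 / \<epsilon>) (at x)"
        using DERIV_cdivide[OF DERIV_ident, of \<epsilon>] by simp
      from DERIV_cmult[OF DERIV_chain2[OF S_deriv[OF E] this], of \<epsilon>] show ?thesis using \<epsilon> by simp
    qed
    show "\<bar>\<epsilon> * S E (b / \<epsilon>) - \<epsilon> * S E (a / \<epsilon>) - s E * (b - a)\<bar> \<le> C * \<epsilon>" for a b
    proof -
      have "\<epsilon> * S E (b / \<epsilon>) - \<epsilon> * S E (a / \<epsilon>) - s E * (b - a) =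
        \<epsilon> * (S E (b / \<epsilon>) - S E (a / \<epsilon>) - s E * (b / \<epsilon> - a / \<epsilon>))"
        using \<epsilon> by (simp add: field_simps)
      moreover have "\<epsilon> * \<bar>S E (b / \<epsilon>) - S E (a / \<epsilon>) - s E * (b / \<epsilon> - a / \<epsilon>)\<bar> \<le> \<epsilon> * C"
        using disc[OF E] \<epsilon> by (intro mult_left_mono) auto
      ultimately show ?thesis using \<epsilon> by (simp add: abs_mult mult.commute)
    qed
  next
    fix \<delta> :: real assume "\<delta> > 0"
    from recurrence[OF this] obtain d where d: "d > 0" "\<And>a. \<exists>t\<in>{a..a + d}. V t \<le> \<delta>" by blast
    have "\<exists>t\<in>{a..a + d * \<epsilon>}. V (t / \<epsilon>) \<le> \<delta>" for a
    proof -
      obtain t where t: "t \<in> {a / \<epsilon>..a / \<epsilon> + d}" "V t \<le> \<delta>" using d(2) by blast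
      have "a \<le> t * \<epsilon>" "t \<le> a / \<epsilon> + d" using t(1) \<epsilon> by (auto simp: divide_le_eq)
      moreover from this(2) have "t * \<epsilon> \<le> (a / \<epsilon> + d) * \<epsilon>" using \<epsilon> by (intro mult_right_mono) auto
      ultimately have "t * \<epsilon> \<in> {a..a + d * \<epsilon>}" using \<epsilon> by (simp add: distrib_right)
      then show ?thesis using t(2) \<epsilon> by (intro bexI[of _ "t * \<epsilon>"]) auto
    qed
    then show "\<exists>d>0. \<forall>a. \<exists>t\<in>{a..a + d}. V (t / \<epsilon>) \<le> \<delta>"
      using d(1) \<epsilon> by (intro exI[of _ "d * \<epsilon>"]) auto
  qed
qed

lemma recurrent_potential_orbit:
  fixes \<xi> :: "real ^ 2"
  assumes \<gamma>: "\<gamma> > 2" and D: "diophantine_index \<xi> \<sigma>" and \<sigma>: "\<sigma> < 2"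
  obtains C S s where "recurrent_potential (\<lambda>t. potential \<gamma> (t *\<^sub>R \<xi>)) (4 powr \<gamma>) C S s"
proof -
  define V where "V t = potential \<gamma> (t *\<^sub>R \<xi>)" for t
  obtain C where C: "\<And>E F. E \<ge> 0 \<Longrightarrow> (\<And>t. (F has_real_derivative sqrt (2 * (E + V t))) (at t)) \<Longrightarrow>
     \<exists>m. \<forall>a b. \<bar>F b - F a - m * (b - a)\<bar> \<le> C"
    using energy_discrepancy[OF assms] unfolding V_def by metis
  have cV: "continuous_on UNIV V" unfolding V_def using \<gamma> by (intro continuous_potential_line) simp
  have "\<exists>F m. F 0 = 0 \<and> (E \<ge> 0 \<longrightarrow> (\<forall>t. (F has_real_derivative sqrt (2 * (E + V t))) (at t)) \<and>
     (\<forall>a b. \<bar>F b - F a - m * (b - a)\<bar> \<le> C))" for E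
  proof (cases "E \<ge> 0")
    case True
    have "continuous_on UNIV (\<lambda>t. sqrt (2 * (E + V t)))" by (intro continuous_intros cV)
    then obtain f where f: "\<And>t. (f has_real_derivative sqrt (2 * (E + V t))) (at t)"
      using ex_antiderivative by blast
    have F: "((\<lambda>t. f t - f 0) has_real_derivative sqrt (2 * (E + V t))) (at t)" for t
      using DERIV_diff[OF f DERIV_const[of "f 0"]] by simp
    from C[OF True F] obtain m where "\<forall>a b. \<bar>(f b - f 0) - (f a - f 0) - m * (b - a)\<bar> \<le> C" ..
    with F show ?thesis by (intro exI[of _ "\<lambda>t. f t - f 0"] exI[of _ m]) simp
  qed (auto intro: exI[of _ "\<lambda>_. 0"])
  then obtain S s where S: "\<And>E. S E 0 = 0"
    "\<And>E t. E \<ge> 0 \<Longrightarrow> (S E has_real_derivative sqrt (2 * (E + V t))) (at t)"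
    "\<And>E a b. E \<ge> 0 \<Longrightarrow> \<bar>S E b - S E a - s E * (b - a)\<bar> \<le> C"
    by metis
  obtain R where R: "R > 0" "\<And>(n::nat) a. n \<ge> 1 \<Longrightarrow> \<exists>t\<in>{a..a + R * real n ^ 4}. V t \<le> R / (real n)\<^sup>2"
    using potential_recurrence[OF assms] unfolding V_def by metis
  have "recurrent_potential V (4 powr \<gamma>) C S s"
  proof
    show "0 \<le> V x" "V x \<le> 4 powr \<gamma>" for x using potential_range[of \<gamma>] \<gamma> by (auto simp: V_def)
    fix \<delta> :: real assume \<delta>: "\<delta> > 0"
    obtain n :: nat where n: "real n > R / \<delta> + 1" using reals_Archimedean2 by blast
    have "R / \<delta> > 0" using R(1) \<delta> by simp
    then have n1: "real n \<ge> 1" "R / \<delta> < real n" using n by auto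
    have "real n \<le> (real n)\<^sup>2" using n1 by (simp add: power2_eq_square)
    then have "R / \<delta> \<le> (real n)\<^sup>2" using n1(2) by linarith
    then have "R / (real n)\<^sup>2 \<le> \<delta>" using \<delta> n1 by (simp add: divide_le_eq mult.commute)
    then have "\<forall>a. \<exists>t\<in>{a..a + R * real n ^ 4}. V t \<le> \<delta>"
    proof -
      have "n \<ge> 1" using n1(1) by simp
      then show ?thesis using R(2) \<open>R / (real n)\<^sup>2 \<le> \<delta>\<close> by (meson order_trans)
    qed
    moreover have "R * real n ^ 4 > 0" using R(1) n1 by simp
    ultimately show "\<exists>d>0. \<forall>a. \<exists>t\<in>{a..a + d}. V t \<le> \<delta>" by blast
  qed (use cV S in auto)
  then show ?thesis using that unfolding V_def by blast
qed

lemma cauchy_viscosity_solutionD: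
  assumes "cauchy_viscosity_solution H u\<^sub>0 u"
  shows "continuous_on (UNIV \<times> {0..}) u" "viscosity_subsolution (UNIV \<times> {0<..}) (evolution H) u"
    "viscosity_supersolution (UNIV \<times> {0<..}) (evolution H) u" "u (x, 0) = u\<^sub>0 x"
  using assms unfolding cauchy_viscosity_solution_def viscosity_solution_def by auto

text \<open>After rescaling, a point with V of order n^-2 is found within a distance of order
  \<open>\<epsilon> * n ^ 4\<close>. Equating the two gives n of order
  \<open>\<epsilon> powr (- (1 / 6))\<close> and both errors of order
  \<open>\<epsilon> powr (1 / 3)\<close>; rounding up at most doubles n, whence 16.\<close>

lemma ex_scale_index:
  assumes "0 < \<epsilon>" "\<epsilon> < (1::real)"
  obtains n :: nat where "n \<ge> 1" "\<epsilon> * real n ^ 4 \<le> 16 * \<epsilon> powr (1 / 3)" "1 / (real n)\<^sup>2 \<le> \<epsilon> powr (1 / 3)"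
proof -
  define z where "z = \<epsilon> powr (- (1 / 6))"
  have z1: "z \<ge> 1" using powr_mono'[of "- (1 / 6)" 0 \<epsilon>] assms by (simp add: z_def)
  define n where "n = nat \<lceil>z\<rceil>"
  have n: "z \<le> real n" "real n \<le> 2 * z" using z1 unfolding n_def by linarith+
  have z2: "1 / z\<^sup>2 = \<epsilon> powr (1 / 3)" and z4: "\<epsilon> * z ^ 4 = \<epsilon> powr (1 / 3)"
  proof -
    have "z\<^sup>2 = z powr 2" "z ^ 4 = z powr 4" using z1 by simp_all
    then have zz: "z\<^sup>2 = \<epsilon> powr (- (1 / 3))" "z ^ 4 = \<epsilon> powr (- (2 / 3))"
      unfolding z_def powr_powr by simp_all
    show "1 / z\<^sup>2 = \<epsilon> powr (1 / 3)" unfolding zz(1) using assms by (simp add: powr_minus_divide)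
    have "\<epsilon> * z ^ 4 = \<epsilon> powr 1 * \<epsilon> powr (- (2 / 3))" unfolding zz(2) using assms by simp
    also have "\<dots> = \<epsilon> powr (1 + - (2 / 3))" by (rule powr_add[symmetric])
    also have "1 + - (2 / 3) = 1 / (3 :: real)" by simp
    finally show "\<epsilon> * z ^ 4 = \<epsilon> powr (1 / 3)" .
  qed
  show ?thesis
  proof (rule that[of n])
    show "n \<ge> 1" using n z1 by simp
    have "real n ^ 4 \<le> (2 * z) ^ 4" using n by (intro power_mono) auto
    then have "\<epsilon> * real n ^ 4 \<le> \<epsilon> * (16 * z ^ 4)" using assms by (intro mult_left_mono) (auto simp: power_mult_distrib)
    then show "\<epsilon> * real n ^ 4 \<le> 16 * \<epsilon> powr (1 / 3)" using z4 by simp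
    have "1 / (real n)\<^sup>2 \<le> 1 / z\<^sup>2" using n z1 by (intro divide_left_mono power_mono) auto
    then show "1 / (real n)\<^sup>2 \<le> \<epsilon> powr (1 / 3)" using z2 by simp
  qed
qed

theorem corollary4p12:
  fixes \<gamma> \<sigma> :: real
    and \<xi> :: "real ^ 2"
    and u\<^sub>0 :: "real \<Rightarrow> real"
    and u\<^sub>\<epsilon> :: "real \<Rightarrow> real \<times> real \<Rightarrow> real"
    and u :: "real \<times> real \<Rightarrow> real"
  assumes "\<gamma> > 2"
    and "diophantine_index \<xi> \<sigma>" and "\<sigma> < 2"
    and "u\<^sub>0 \<in> BUC \<inter> Lip"
    and "\<And>\<epsilon>. \<epsilon> > 0 \<Longrightarrow>
           cauchy_viscosity_solution (\<lambda>x p. hamiltonian \<gamma> \<xi> (x / \<epsilon>) p) u\<^sub>0 (u\<^sub>\<epsilon> \<epsilon>)"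
    and "cauchy_viscosity_solution (\<lambda>x p. effective_hamiltonian (hamiltonian \<gamma> \<xi>) p) u\<^sub>0 u"
  shows "\<exists>C>0. \<forall>\<epsilon>\<in>{0<..<1}.
           - C * \<epsilon> \<le> u\<^sub>\<epsilon> \<epsilon> (0, 1) - u (0, 1) \<and>
           u\<^sub>\<epsilon> \<epsilon> (0, 1) - u (0, 1) \<le> C * \<epsilon> powr ((\<gamma> - 2) / (3 * \<gamma> - 2))"
proof -
  define V where "V t = potential \<gamma> (t *\<^sub>R \<xi>)" for t
  define K where "K = 4 powr \<gamma>"
  obtain C S s where rp: "recurrent_potential V K C S s"
    using recurrent_potential_orbit[OF assms(1-3)] unfolding V_def K_def by blast
  interpret recurrent_potential V K C S s by (rule rp)
  have "hamiltonian \<gamma> \<xi> = H" by (intro ext) (simp add: hamiltonian_def H_def V_def)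
  then have eff: "(\<lambda>x p. effective_hamiltonian (hamiltonian \<gamma> \<xi>) p) = (\<lambda>x. Hb)"
    using effective_hamiltonian_eq by auto
  note u = cauchy_viscosity_solutionD[OF assms(6)[unfolded eff]]
  have C0: "C \<ge> 0" using disc0[of 0 0] by (simp add: S_0)
  obtain B where B: "\<And>x. \<bar>u\<^sub>0 x\<bar> \<le> B" using BUC_bounded[of u\<^sub>0] assms(4) by blast
  have B0: "B \<ge> 0" using B[of 0] by linarith
  \<comment> \<open>Both values at (0,1) are at most \<open>B + K\<close>. Beyond this radius the
    energy 1 alone satisfies the cone condition for that bound, since
    \<open>s 1 \<ge> 1\<close>.\<close>
  define R where "R = 2 * B + K + 1"
  have R: "R \<ge> 1" using B0 K_nonneg by (simp add: R_def)
  \<comment> \<open>One range for all energies used: the maximisers in the effective problem for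
    \<open>\<bar>y\<bar> \<le> R\<close>, the energies up to \<open>y\<^sup>2 / 2\<close>, and the
    energies 1 and \<open>\<epsilon>\<close>.\<close>
  define M where "M = 4 * R\<^sup>2 + K + 1"
  have M: "M \<ge> 1" "M \<ge> 4 * R\<^sup>2 + K" using K_nonneg by (auto simp: M_def)
  have far: "\<exists>E\<in>{0..M}. B + K \<le> u\<^sub>0 y + s E * \<bar>y\<bar> - E" if "\<bar>y\<bar> > R" for y
  proof (rule bexI[of _ 1])
    have "sqrt 2 \<le> s 1" using s_ge[of 1] by simp
    moreover have "1 \<le> sqrt (2::real)" by simp
    ultimately have "1 * R \<le> s 1 * \<bar>y\<bar>" using that R by (intro mult_mono) linarith+
    then have "2 * B + K + 1 \<le> s 1 * \<bar>y\<bar>" by (simp add: R_def)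
    moreover have "u\<^sub>0 y \<ge> - B" using B[of y] by linarith
    ultimately show "B + K \<le> u\<^sub>0 y + s 1 * \<bar>y\<bar> - 1" by linarith
  qed (use M in simp)
  obtain Q where Q: "Q > 0" "\<And>(n::nat) a. n \<ge> 1 \<Longrightarrow> \<exists>t\<in>{a..a + Q * real n ^ 4}. V t \<le> Q / (real n)\<^sup>2"
    using potential_recurrence[OF assms(1-3)] unfolding V_def by metis
  \<comment> \<open>The summands belong to the discrepancy, the energy \<open>\<epsilon>\<close> of
    the early trajectory, the excursion to the waiting point, and V at that point.\<close>
  define C' where "C' = C + 1 + (2 * K + 1) * (16 * Q) + Q"
  have C': "C' > 0" "C \<le> C'" using C0 Q K_nonneg by (auto simp: C'_def add_pos_nonneg)
  have "- C' * \<epsilon> \<le> u\<^sub>\<epsilon> \<epsilon> (0, 1) - u (0, 1) \<and>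
     u\<^sub>\<epsilon> \<epsilon> (0, 1) - u (0, 1) \<le> C' * \<epsilon> powr ((\<gamma> - 2) / (3 * \<gamma> - 2))" if "\<epsilon> \<in> {0<..<1}" for \<epsilon>
  proof
    have \<epsilon>: "0 < \<epsilon>" "\<epsilon> < 1" using that by auto
    interpret e: recurrent_potential "\<lambda>x. V (x / \<epsilon>)" K "C * \<epsilon>" "\<lambda>E x. \<epsilon> * S E (x / \<epsilon>)" s
      by (rule recurrent_potential_scale[OF rp \<epsilon>(1)])
    have "(\<lambda>x p. hamiltonian \<gamma> \<xi> (x / \<epsilon>) p) = e.H"
      by (intro ext, subst e.H_def) (simp add: hamiltonian_def V_def)
    note ue = cauchy_viscosity_solutionD[OF assms(5)[OF \<epsilon>(1), unfolded this]]
    have ur: "u (0, 1) \<le> B + K"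
      using solution_at_rest[OF u(1,2) Hb_ge_square] u(4)[of 0] B[of 0] by linarith
    have uer: "u\<^sub>\<epsilon> \<epsilon> (0, 1) \<le> B + K"
      using e.solution_at_rest[OF ue(1,2) e.H_ge_square] ue(4)[of 0] B[of 0] by linarith
    \<comment> \<open>The upper bound for the effective solution supplies, at each \<open>y\<close>,
      the energy required by the lower bound for the oscillating one. No waiting occurs in this
      direction, hence an error of order \<open>\<epsilon>\<close>.\<close>
    have "u (0, 1) - C * \<epsilon> \<le> u\<^sub>\<epsilon> \<epsilon> (0, 1)"
    proof (rule e.H_solution_lower_bound[OF ue(1-3), of M])
      fix y
      have "\<exists>E\<in>{0..M}. u (0, 1) \<le> u\<^sub>0 y + s E * \<bar>y\<bar> - E"
      proof (cases "\<bar>y\<bar> \<le> R")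
        case True
        then show ?thesis using Hb_subsolution_upper_bound[OF u(1,2) True M(2)] u(4) by simp
      next
        case False
        then show ?thesis using far[of y] ur by force
      qed
      then obtain E where "E \<in> {0..M}" "u (0, 1) \<le> u\<^sub>0 y + s E * \<bar>y\<bar> - E" by blast
      then show "\<exists>E\<in>{0..M}. u (0, 1) - C * \<epsilon> \<le> u\<^sub>\<epsilon> \<epsilon> (y, 0) + s E * \<bar>y\<bar> - E - C * \<epsilon>"
        using ue(4)[of y] by (intro bexI[of _ E]) auto
    qed (use M in simp)
    moreover have "C * \<epsilon> \<le> C' * \<epsilon>" using C'(2) \<epsilon> by (intro mult_right_mono) auto
    ultimately show "- C' * \<epsilon> \<le> u\<^sub>\<epsilon> \<epsilon> (0, 1) - u (0, 1)" by simp
    obtain n :: nat where n: "n \<ge> 1" "\<epsilon> * real n ^ 4 \<le> 16 * \<epsilon> powr (1 / 3)" "1 / (real n)\<^sup>2 \<le> \<epsilon> powr (1 / 3)"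
      using ex_scale_index[OF \<epsilon>] by blast
    obtain t where t: "0 \<le> t" "t \<le> Q * real n ^ 4" "V t \<le> Q / (real n)\<^sup>2"
      using Q(2)[OF n(1), of 0] by auto
    define d where "d = \<epsilon> * (Q * real n ^ 4)"
    have d: "d > 0" using \<epsilon> Q n by (simp add: d_def)
    have x: "\<bar>\<epsilon> * t\<bar> \<le> d" "V (\<epsilon> * t / \<epsilon>) \<le> Q / (real n)\<^sup>2"
      using t \<epsilon> by (auto simp: d_def abs_mult)
    \<comment> \<open>The threshold energy in the waiting argument is taken to be
      \<open>\<epsilon>\<close>, which gives the second summand; \<open>\<epsilon> * t\<close> is
      the waiting point and \<open>d\<close> the time allotted to reach it.\<close>
    define err where "err = C * \<epsilon> + \<epsilon> + (2 * K + 1) * d + Q / (real n)\<^sup>2"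
    have err0: "err \<ge> 0" using C0 \<epsilon> K_nonneg d Q by (simp add: err_def)
    have "u\<^sub>\<epsilon> \<epsilon> (0, 1) - err \<le> u (0, 1)"
    proof (rule Hb_solution_lower_bound[OF u(1-3), of M])
      fix y
      have "\<exists>E\<in>{0..M}. u\<^sub>\<epsilon> \<epsilon> (0, 1) \<le> u\<^sub>0 y + s E * \<bar>y\<bar> - E + err"
      proof (cases "\<bar>y\<bar> \<le> R")
        case True
        have "\<bar>y\<bar>\<^sup>2 \<le> R\<^sup>2" using True by (intro power_mono) auto
        then have "y\<^sup>2 \<le> 2 * M" using M(2) K_nonneg zero_le_power2[of R] by (simp only: power2_abs)
        moreover have "\<epsilon> \<le> M" using \<epsilon> M by simp
        ultimately show ?thesis
          using e.H_subsolution_upper_bound[OF ue(1,2) \<epsilon>(1) d x] ue(4) by (simp add: err_def)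
      next
        case False
        then show ?thesis using far[of y] uer err0 by force
      qed
      then obtain E where "E \<in> {0..M}" "u\<^sub>\<epsilon> \<epsilon> (0, 1) \<le> u\<^sub>0 y + s E * \<bar>y\<bar> - E + err" by blast
      then show "\<exists>E\<in>{0..M}. u\<^sub>\<epsilon> \<epsilon> (0, 1) - err \<le> u (y, 0) + s E * \<bar>y\<bar> - E"
        using u(4)[of y] by (intro bexI[of _ E]) auto
    qed (use M in simp)
    moreover have "err \<le> C' * \<epsilon> powr ((\<gamma> - 2) / (3 * \<gamma> - 2))"
    proof -
      define z where "z = \<epsilon> powr (1 / 3)"
      have "\<epsilon> powr 1 \<le> z" unfolding z_def using \<epsilon> by (intro powr_mono') auto
      then have ez: "\<epsilon> \<le> z" using \<epsilon> by simp
      have "C * \<epsilon> \<le> C * z" using ez C0 by (rule mult_left_mono)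
      moreover have "(2 * K + 1) * d \<le> (2 * K + 1) * (16 * Q) * z"
      proof -
        have "d = Q * (\<epsilon> * real n ^ 4)" by (simp add: d_def)
        also have "\<dots> \<le> Q * (16 * z)" using n(2) Q unfolding z_def by (intro mult_left_mono) auto
        finally have "(2 * K + 1) * d \<le> (2 * K + 1) * (Q * (16 * z))" using K_nonneg by (intro mult_left_mono) auto
        then show ?thesis by (simp add: mult_ac)
      qed
      moreover have "Q / (real n)\<^sup>2 \<le> Q * z"
      proof -
        have "Q * (1 / (real n)\<^sup>2) \<le> Q * z" using n(3) Q unfolding z_def by (intro mult_left_mono) auto
        then show ?thesis by simp
      qed
      moreover have "C' * z = C * z + z + (2 * K + 1) * (16 * Q) * z + Q * z"
        unfolding C'_def by (simp only: distrib_right mult_1)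
      ultimately have "err \<le> C' * z" using ez unfolding err_def by linarith
      also have "\<dots> \<le> C' * \<epsilon> powr ((\<gamma> - 2) / (3 * \<gamma> - 2))"
      proof (rule mult_left_mono)
        \<comment> \<open>As \<open>\<epsilon> < 1\<close>, a smaller exponent gives a larger bound,
          so the rate with exponent 1/3 implies the stated one.\<close>
        have "(\<gamma> - 2) / (3 * \<gamma> - 2) \<le> 1 / 3" using assms(1) by (simp add: divide_simps)
        then show "z \<le> \<epsilon> powr ((\<gamma> - 2) / (3 * \<gamma> - 2))" unfolding z_def using \<epsilon> by (intro powr_mono') auto
      qed (use C' in simp)
      finally show ?thesis .
    qed
    ultimately show "u\<^sub>\<epsilon> \<epsilon> (0, 1) - u (0, 1) \<le> C' * \<epsilon> powr ((\<gamma> - 2) / (3 * \<gamma> - 2))" by linarith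
  qed
  then show ?thesis using C'(1) by blast
qed

end
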